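(* Let $R$ be a commutative local ring whose maximal ideal $\mathfrak{m}$ is principal with $\mathfrak{m}^2 = 0$. Then for all integers $i, j, i', j' \geq 0$, \[ \Sigma^{i'} E_{j'} \gg \Sigma^i E_j \iff (i,j) \leq (i',j'), \] where pairs are ordered lexicographically: $(i,j) < (i',j')$ if $i < i'$, or $i = i'$ and $j < j'$. Moreover, let $X$ be a perfect chain complex over $R$, written as $X \cong P \oplus Q$ with $P$ acyclic and $Q$ a finite direct sum of complexes $\Sigma^i E_j$; let $S_X$ be the set of pairs $(i,j)$ such that $\Sigma^i E_j$ appears as a summand of $Q$, and let $(i_X, j_X)$ be the minimal element of $S_X$ in the lexicographic order. Then $\mathcal{C}(X) = \mathcal{C}(\Sigma^{i_X} E_{j_X})$, unless $X$ is contractible, in which case $\mathcal{C}(X) = \mathcal{C}(0)$.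
   Context: Fix a generator $r$ of $\mathfrak{m}$. Chain complexes are non-negatively graded chain complexes of $R$-modules, with differentials lowering degree. A weak equivalence is a chain map inducing an isomorphism on homology. A chain complex is perfect if it consists of projective modules in each degree and $\bigoplus_i X_i$ is finitely generated; every perfect complex admits a decomposition $X \cong P \oplus Q$ as described in the claim. For integers $i, j \geq 0$, $\Sigma^i E_j$ is the complex with $(\Sigma^i E_j)_n = R$ for $i \leq n \leq i+j$ and $0$ otherwise, with every differential $R \to R$ given by multiplication by $(-1)^i r$ (its isomorphism type does not depend on $r$). For a chain complex $A$, $\mathcal{C}(A)$ denotes the smallest collection of chain complexes that (1) contains $A$, (2) is closed under arbitrary direct sums and under weak equivalences, and (3) whenever $0 \to X \to Y \to Z \to 0$ is a short exact sequence of chain complexes with $X, Y \in \mathcal{C}(A)$, also $Z \in \mathcal{C}(A)$. One writes $Y \gg A$ if $Y \in \mathcal{C}(A)$.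
   Formalization: The maximal ideal is assumed nonzero: over a field the equivalence fails, since Σ^iE_0 is a summand of Σ^iE_1 and so lies in C(Σ^iE_1). C(A) is formed among complexes whose elements lie in an arbitrary fixed infinite set large enough to contain R. *)

theory Defs
  imports "HOL-Algebra.Module" "HOL-Algebra.Ideal" "HOL-Library.Product_Lexorder"
begin

definition local_ring :: "'r ring \<Rightarrow> 'r set \<Rightarrow> bool" where
  "local_ring R m \<longleftrightarrow> cring R \<and> maximalideal m R \<and>
     (\<forall>J. maximalideal J R \<longrightarrow> J = m)"

definition linmap :: "'r ring \<Rightarrow> ('r,'a) module \<Rightarrow> ('r,'b) module \<Rightarrow> ('a \<Rightarrow> 'b) \<Rightarrow> bool" where
  "linmap R M N f \<longleftrightarrow> module R M \<and> module R N \<and>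
     (\<forall>x\<in>carrier M. f x \<in> carrier N) \<and>
     (\<forall>x\<in>carrier M. \<forall>y\<in>carrier M. f (x \<oplus>\<^bsub>M\<^esub> y) = f x \<oplus>\<^bsub>N\<^esub> f y) \<and>
     (\<forall>a\<in>carrier R. \<forall>x\<in>carrier M. f (a \<odot>\<^bsub>M\<^esub> x) = a \<odot>\<^bsub>N\<^esub> f x)"

definition fin_gen :: "'r ring \<Rightarrow> ('r,'a) module \<Rightarrow> bool" where
  "fin_gen R M \<longleftrightarrow> (\<exists>S. finite S \<and> S \<subseteq> carrier M \<and>
     carrier M = {finsum M (\<lambda>s. c s \<odot>\<^bsub>M\<^esub> s) S | c. c \<in> S \<rightarrow> carrier R})"

text \<open>Projective module (lifting property, against modules whose elements live
  in the same type as those of P).\<close>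
definition projective :: "'r ring \<Rightarrow> ('r,'a) module \<Rightarrow> bool" where
  "projective R P \<longleftrightarrow> module R P \<and>
     (\<forall>(M::('r,'a) module) (N::('r,'a) module) g f.
        linmap R M N g \<and> g ` carrier M = carrier N \<and> linmap R P N f \<longrightarrow>
        (\<exists>h. linmap R P M h \<and> (\<forall>x\<in>carrier P. g (h x) = f x)))"

text \<open>A non-negatively graded chain complex: modules obj X n for n \<ge> 0 and
  differentials dif X n : X_(n+1) \<rightarrow> X_n.\<close>
record ('r,'a) cx =
  obj :: "nat \<Rightarrow> ('r,'a) module"
  dif :: "nat \<Rightarrow> 'a \<Rightarrow> 'a"

definition chain_complex :: "'r ring \<Rightarrow> ('r,'a) cx \<Rightarrow> bool" where
  "chain_complex R X \<longleftrightarrow> (\<forall>n. module R (obj X n)) \<and>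
     (\<forall>n. linmap R (obj X (Suc n)) (obj X n) (dif X n)) \<and>
     (\<forall>n. \<forall>x\<in>carrier (obj X (Suc (Suc n))). dif X n (dif X (Suc n) x) = zero (obj X n))"

definition cycles :: "('r,'a) cx \<Rightarrow> nat \<Rightarrow> 'a set" where
  "cycles X n = (case n of 0 \<Rightarrow> carrier (obj X 0)
     | Suc k \<Rightarrow> {x \<in> carrier (obj X (Suc k)). dif X k x = zero (obj X k)})"

definition boundaries :: "('r,'a) cx \<Rightarrow> nat \<Rightarrow> 'a set" where
  "boundaries X n = dif X n ` carrier (obj X (Suc n))"

definition chain_map :: "'r ring \<Rightarrow> ('r,'a) cx \<Rightarrow> ('r,'b) cx \<Rightarrow> (nat \<Rightarrow> 'a \<Rightarrow> 'b) \<Rightarrow> bool" where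
  "chain_map R X Y f \<longleftrightarrow> chain_complex R X \<and> chain_complex R Y \<and>
     (\<forall>n. linmap R (obj X n) (obj Y n) (f n)) \<and>
     (\<forall>n. \<forall>x\<in>carrier (obj X (Suc n)). f n (dif X n x) = dif Y n (f (Suc n) x))"

text \<open>A weak equivalence: chain map inducing an isomorphism H_n(X) \<rightarrow> H_n(Y) for all n
  (surjectivity and injectivity on homology written out).\<close>
definition weq :: "'r ring \<Rightarrow> ('r,'a) cx \<Rightarrow> ('r,'b) cx \<Rightarrow> (nat \<Rightarrow> 'a \<Rightarrow> 'b) \<Rightarrow> bool" where
  "weq R X Y f \<longleftrightarrow> chain_map R X Y f \<and>
     (\<forall>n. \<forall>y\<in>cycles Y n. \<exists>x\<in>cycles X n. y \<ominus>\<^bsub>(obj Y n)\<^esub> f n x \<in> boundaries Y n) \<and>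
     (\<forall>n. \<forall>x\<in>cycles X n. f n x \<in> boundaries Y n \<longrightarrow> x \<in> boundaries X n)"

definition cx_iso :: "'r ring \<Rightarrow> ('r,'a) cx \<Rightarrow> ('r,'b) cx \<Rightarrow> bool" where
  "cx_iso R X Y \<longleftrightarrow> (\<exists>f. chain_map R X Y f \<and>
     (\<forall>n. bij_betw (f n) (carrier (obj X n)) (carrier (obj Y n))))"

definition ses :: "'r ring \<Rightarrow> ('r,'a) cx \<Rightarrow> ('r,'a) cx \<Rightarrow> ('r,'a) cx
    \<Rightarrow> (nat \<Rightarrow> 'a \<Rightarrow> 'a) \<Rightarrow> (nat \<Rightarrow> 'a \<Rightarrow> 'a) \<Rightarrow> bool" where
  "ses R X Y Z f g \<longleftrightarrow> chain_map R X Y f \<and> chain_map R Y Z g \<and>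
     (\<forall>n. inj_on (f n) (carrier (obj X n))) \<and>
     (\<forall>n. g n ` carrier (obj Y n) = carrier (obj Z n)) \<and>
     (\<forall>n. f n ` carrier (obj X n) = {y \<in> carrier (obj Y n). g n y = zero (obj Z n)})"

definition is_dsum :: "'r ring \<Rightarrow> ('r,'a) cx \<Rightarrow> 'k set \<Rightarrow> ('k \<Rightarrow> ('r,'b) cx)
    \<Rightarrow> ('k \<Rightarrow> nat \<Rightarrow> 'b \<Rightarrow> 'a) \<Rightarrow> bool" where
  "is_dsum R Y K Xs \<iota> \<longleftrightarrow> chain_complex R Y \<and>
     (\<forall>k\<in>K. chain_map R (Xs k) Y (\<iota> k)) \<and>
     (\<forall>n. bij_betw
        (\<lambda>x. finsum (obj Y n) (\<lambda>k. \<iota> k n (x k)) {k\<in>K. x k \<noteq> zero (obj (Xs k) n)})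
        {x. (\<forall>k\<in>K. x k \<in> carrier (obj (Xs k) n)) \<and> (\<forall>k. k \<notin> K \<longrightarrow> x k = undefined) \<and>
            finite {k\<in>K. x k \<noteq> zero (obj (Xs k) n)}}
        (carrier (obj Y n)))"

definition acyclic :: "'r ring \<Rightarrow> ('r,'a) cx \<Rightarrow> bool" where
  "acyclic R X \<longleftrightarrow> chain_complex R X \<and> (\<forall>n. cycles X n \<subseteq> boundaries X n)"

definition contractible :: "'r ring \<Rightarrow> ('r,'a) cx \<Rightarrow> bool" where
  "contractible R X \<longleftrightarrow> chain_complex R X \<and>
     (\<exists>s. (\<forall>n. linmap R (obj X n) (obj X (Suc n)) (s n)) \<and>
        (\<forall>x\<in>carrier (obj X 0). dif X 0 (s 0 x) = x) \<and>
        (\<forall>n. \<forall>x\<in>carrier (obj X (Suc n)).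
           dif X (Suc n) (s (Suc n) x) \<oplus>\<^bsub>(obj X (Suc n))\<^esub> s n (dif X n x) = x))"

text \<open>Perfect: projective in each degree and the total module \<oplus>_i X_i finitely
  generated, i.e. all X_i finitely generated and almost all zero.\<close>
definition perfect :: "'r ring \<Rightarrow> ('r,'a) cx \<Rightarrow> bool" where
  "perfect R X \<longleftrightarrow> chain_complex R X \<and> (\<forall>n. projective R (obj X n)) \<and>
     (\<forall>n. fin_gen R (obj X n)) \<and> finite {n. carrier (obj X n) \<noteq> {zero (obj X n)}}"

definition ring_mod :: "'r ring \<Rightarrow> ('r,'r) module" where
  "ring_mod R = \<lparr>carrier = carrier R, mult = mult R, one = one R, zero = zero R,
     add = add R, smult = mult R\<rparr>"

definition zero_mod :: "'r ring \<Rightarrow> ('r,'r) module" where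
  "zero_mod R = \<lparr>carrier = {zero R}, mult = mult R, one = zero R, zero = zero R,
     add = add R, smult = mult R\<rparr>"

definition sigmaE :: "'r ring \<Rightarrow> 'r \<Rightarrow> nat \<Rightarrow> nat \<Rightarrow> ('r,'r) cx" where
  "sigmaE R r i j = \<lparr>obj = (\<lambda>n. if i \<le> n \<and> n \<le> i + j then ring_mod R else zero_mod R),
     dif = (\<lambda>n x. if i \<le> n \<and> Suc n \<le> i + j
                   then (if even i then r else \<ominus>\<^bsub>R\<^esub> r) \<otimes>\<^bsub>R\<^esub> x else zero R)\<rparr>"

definition zero_cx :: "'r ring \<Rightarrow> ('r,'r) cx" where
  "zero_cx R = \<lparr>obj = (\<lambda>n. zero_mod R), dif = (\<lambda>n x. zero R)\<rparr>"

text \<open>gg R A Y means Y \<in> C(A) (written Y \<gg> A), where C(A) is the smallest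
  collection of chain complexes (with elements in the type 'a) containing A (up to
  isomorphism), closed under direct sums, weak equivalences and cofibres.\<close>
inductive gg :: "'r ring \<Rightarrow> ('r,'b) cx \<Rightarrow> ('r,'a) cx \<Rightarrow> bool" for R A where
  base: "cx_iso R A Y \<Longrightarrow> gg R A Y"
| dsum: "(\<forall>k\<in>K. gg R A (Xs k)) \<Longrightarrow> is_dsum R Y (K :: 'a set) Xs \<iota> \<Longrightarrow> gg R A Y"
| weq_fwd: "gg R A X \<Longrightarrow> weq R X Y f \<Longrightarrow> gg R A Y"
| weq_bwd: "gg R A Y \<Longrightarrow> weq R X Y f \<Longrightarrow> gg R A X"
| cofib: "gg R A X \<Longrightarrow> gg R A Y \<Longrightarrow> ses R X Y Z f g \<Longrightarrow> gg R A Z"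

end

theory Submission
  imports Defs
begin

text \<open>
  Necessity of \<open>(i, j) \<le> (i', j')\<close>: the complexes that are exact below degree \<open>i\<close> and in which every
  cycle \<open>y\<^sub>0\<close> of degree \<open>i\<close> extends to elements \<open>y\<^sub>0, \<dots>, y\<^sub>j\<close> with \<open>d y\<^sub>n\<^sub>+\<^sub>1 = r y\<^sub>n\<close> are closed under direct
  sums, weak equivalences (as \<open>r\<^sup>2 = 0\<close>) and cofibres.  \<open>\<Sigma>\<^sup>i E\<^sub>j\<close> is such a complex, and \<open>\<Sigma>\<^sup>i E\<^sub>k\<close> is
  not if \<open>k < j\<close>.

  Sufficiency: the class is closed under extensions \<open>0 \<rightarrow> Y \<rightarrow> W \<rightarrow> \<Sigma>X \<rightarrow> 0\<close>.  Splicing shifted copies of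
  \<open>\<Sigma>\<^sup>i E\<^sub>j\<close> gives arbitrarily long intervals starting in degree \<open>i\<close>; their union is a resolution of
  the maximal ideal in degree \<open>i\<close>, which therefore lies in the class.  The extension of \<open>R\<close> by two
  copies of the maximal ideal then yields \<open>R\<close> in degree \<open>i + 1\<close>, and every \<open>\<Sigma>\<^sup>i\<^sup>' E\<^sub>j\<^sub>'\<close> allowed by the
  order is built from such pieces one degree at a time.

  For a perfect complex, every summand is in the class by an Eilenberg swindle, and conversely all
  summands lie in the class of the lexicographically smallest one.
\<close>

section \<open>Linear maps and chain complexes\<close>

text \<open>The class contains suspensions but no desuspensions, so an extension cannot be reached
  by rotating a triangle downwards. Extensions by a suspension \<open>Sigma X\<close> are still
  available because the homotopy fibre of \<open>W -> Sigma X\<close> lives in non-negative degrees,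
  contains \<open>X\<close> with quotient \<open>W\<close>, and is weakly equivalent to
  \<open>Y\<close>. The ring enters through one fact: since \<open>m\<close> is maximal,
  \<open>m\<close> squares to zero and \<open>r\<close> is nonzero, the annihilator of
  \<open>r\<close> is \<open>rR\<close>. So the ray with all differentials \<open>r\<close> has
  homology only in its lowest degree, namely \<open>R/rR\<close>, and \<open>r\<close> identifies
  this with \<open>rR\<close>. The same fact makes \<open>R\<close> an extension of
  \<open>rR\<close> by \<open>rR\<close>. As the quotient of an extension has to be a suspension,
  \<open>R\<close> is obtained only one degree above the maximal ideal; in degree \<open>i\<close>
  itself it is out of reach when \<open>j > 0\<close>, and this produces the lexicographic order.
  The class lives over one type \<open>'a\<close>. Sums, fibres and telescopes are formed in
  function types and brought back along injections; an infinite \<open>'a\<close> is closed under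
  pairing, which suffices for pairs and for eventually constant sequences.\<close>

lemma linmapI:
  assumes "module R M" "module R N" "\<And>x. x \<in> carrier M \<Longrightarrow> f x \<in> carrier N"
    "\<And>x y. x \<in> carrier M \<Longrightarrow> y \<in> carrier M \<Longrightarrow> f (x \<oplus>\<^bsub>M\<^esub> y) = f x \<oplus>\<^bsub>N\<^esub> f y"
    "\<And>a x. a \<in> carrier R \<Longrightarrow> x \<in> carrier M \<Longrightarrow> f (a \<odot>\<^bsub>M\<^esub> x) = a \<odot>\<^bsub>N\<^esub> f x"
  shows "linmap R M N f"
  using assms unfolding linmap_def by blast

lemma
  assumes "linmap R M N f"
  shows linmap_dom: "module R M" and linmap_cod: "module R N"
    and linmap_closed: "x \<in> carrier M \<Longrightarrow> f x \<in> carrier N"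
    and linmap_add: "x \<in> carrier M \<Longrightarrow> y \<in> carrier M \<Longrightarrow> f (x \<oplus>\<^bsub>M\<^esub> y) = f x \<oplus>\<^bsub>N\<^esub> f y"
    and linmap_smult: "a \<in> carrier R \<Longrightarrow> x \<in> carrier M \<Longrightarrow> f (a \<odot>\<^bsub>M\<^esub> x) = a \<odot>\<^bsub>N\<^esub> f x"
  using assms unfolding linmap_def by blast+

lemma linmap_zero:
  assumes f: "linmap R M N f" shows "f \<zero>\<^bsub>M\<^esub> = \<zero>\<^bsub>N\<^esub>"
proof -
  interpret M: module R M by (rule linmap_dom[OF f])
  interpret N: module R N by (rule linmap_cod[OF f])
  have "f (\<zero>\<^bsub>R\<^esub> \<odot>\<^bsub>M\<^esub> \<zero>\<^bsub>M\<^esub>) = \<zero>\<^bsub>R\<^esub> \<odot>\<^bsub>N\<^esub> f \<zero>\<^bsub>M\<^esub>"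
    by (rule linmap_smult[OF f]) auto
  then show ?thesis using linmap_closed[OF f M.M.zero_closed] by simp
qed

lemma linmap_minus:
  assumes f: "linmap R M N f" and x: "x \<in> carrier M"
  shows "f (\<ominus>\<^bsub>M\<^esub> x) = \<ominus>\<^bsub>N\<^esub> f x"
proof -
  interpret M: module R M by (rule linmap_dom[OF f])
  interpret N: module R N by (rule linmap_cod[OF f])
  have "f (\<ominus>\<^bsub>M\<^esub> x) \<oplus>\<^bsub>N\<^esub> f x = \<zero>\<^bsub>N\<^esub>"
    using linmap_add[OF f, of "\<ominus>\<^bsub>M\<^esub> x" x] x by (simp add: M.M.l_neg linmap_zero[OF f])
  then show ?thesis
    using x by (metis M.M.a_inv_closed N.M.minus_equality linmap_closed[OF f])
qed

lemma linmap_diff: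
  assumes f: "linmap R M N f" and x: "x \<in> carrier M" "y \<in> carrier M"
  shows "f (x \<ominus>\<^bsub>M\<^esub> y) = f x \<ominus>\<^bsub>N\<^esub> f y"
proof -
  interpret M: module R M by (rule linmap_dom[OF f])
  show ?thesis using x by (simp add: a_minus_def linmap_add[OF f] linmap_minus[OF f])
qed

lemma linmap_comp:
  assumes "linmap R M N f" "linmap R N P g" shows "linmap R M P (\<lambda>x. g (f x))"
  using assms unfolding linmap_def by simp

lemma linmap_ident: "module R M \<Longrightarrow> linmap R M M (\<lambda>x. x)"
  unfolding linmap_def by simp

lemma linmap_plus:
  assumes f: "linmap R M N f" and g: "linmap R M N g"
  shows "linmap R M N (\<lambda>x. f x \<oplus>\<^bsub>N\<^esub> g x)"
proof -
  interpret N: module R N by (rule linmap_cod[OF f])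
  show ?thesis
    using linmap_closed[OF f] linmap_closed[OF g]
    by (intro linmapI linmap_dom[OF f] linmap_cod[OF f])
      (simp_all add: linmap_add[OF f] linmap_add[OF g] linmap_smult[OF f] linmap_smult[OF g]
        N.M.a_ac N.smult_r_distr)
qed

lemma linmap_uminus:
  assumes f: "linmap R M N f"
  shows "linmap R M N (\<lambda>x. \<ominus>\<^bsub>N\<^esub> f x)"
proof -
  interpret N: module R N by (rule linmap_cod[OF f])
  show ?thesis
    using linmap_closed[OF f]
    by (intro linmapI linmap_dom[OF f] linmap_cod[OF f])
      (simp_all add: linmap_add[OF f] linmap_smult[OF f] N.M.minus_add N.smult_r_minus N.M.a_ac)
qed

lemma linmap_minus_map:
  assumes f: "linmap R M N f" and g: "linmap R M N g"
  shows "linmap R M N (\<lambda>x. f x \<ominus>\<^bsub>N\<^esub> g x)"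
  using linmap_plus[OF f linmap_uminus[OF g]] by (simp add: a_minus_def)

lemma linmap_inv_into:
  assumes f: "linmap R M N f" and b: "bij_betw f (carrier M) (carrier N)"
  shows "linmap R N M (inv_into (carrier M) f)"
proof -
  interpret M: module R M by (rule linmap_dom[OF f])
  let ?g = "inv_into (carrier M) f"
  have g: "?g y \<in> carrier M" "f (?g y) = y" if "y \<in> carrier N" for y
    using that b by (auto simp: bij_betw_def inv_into_into f_inv_into_f)
  have e: "?g (f x) = x" if "x \<in> carrier M" for x
    using that b by (auto simp: bij_betw_def)
  show ?thesis
  proof (rule linmapI[OF linmap_cod[OF f] linmap_dom[OF f]])
    fix x y assume xy: "x \<in> carrier N" "y \<in> carrier N"
    then have "x \<oplus>\<^bsub>N\<^esub> y = f (?g x \<oplus>\<^bsub>M\<^esub> ?g y)" by (simp add: g linmap_add[OF f])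
    then show "?g (x \<oplus>\<^bsub>N\<^esub> y) = ?g x \<oplus>\<^bsub>M\<^esub> ?g y" using e g xy by simp
  next
    fix a x assume xy: "a \<in> carrier R" "x \<in> carrier N"
    then have "a \<odot>\<^bsub>N\<^esub> x = f (a \<odot>\<^bsub>M\<^esub> ?g x)" by (simp add: g linmap_smult[OF f])
    then show "?g (a \<odot>\<^bsub>N\<^esub> x) = a \<odot>\<^bsub>M\<^esub> ?g x" using e g xy by simp
  qed (use g in auto)
qed

lemma linmap_finsum:
  assumes f: "linmap R M N f" and "finite J" "\<And>j. j \<in> J \<Longrightarrow> x j \<in> carrier M"
  shows "f (finsum M x J) = finsum N (\<lambda>j. f (x j)) J"
proof -
  interpret M: module R M by (rule linmap_dom[OF f])
  interpret N: module R N by (rule linmap_cod[OF f])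
  show ?thesis using assms(2,3)
  proof (induction J)
    case empty
    then show ?case by (simp add: linmap_zero[OF f])
  next
    case (insert j J)
    then show ?case
      by (simp add: M.M.finsum_insert N.M.finsum_insert Pi_def linmap_closed[OF f] linmap_add[OF f])
  qed
qed

lemma finsum_induct:
  assumes M: "module R M" and "finite J" "\<And>j. j \<in> J \<Longrightarrow> x j \<in> carrier M" "P \<zero>\<^bsub>M\<^esub>"
    "\<And>j. j \<in> J \<Longrightarrow> P (x j)"
    "\<And>u v. u \<in> carrier M \<Longrightarrow> v \<in> carrier M \<Longrightarrow> P u \<Longrightarrow> P v \<Longrightarrow> P (u \<oplus>\<^bsub>M\<^esub> v)"
  shows "P (finsum M x J)"
proof -
  interpret M: module R M by (rule M)
  show ?thesis using assms(2,3,5)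
  proof (induction J)
    case empty
    then show ?case using assms(4) by simp
  next
    case (insert j J)
    then show ?case by (simp add: M.M.finsum_insert Pi_def assms(6))
  qed
qed

section \<open>Chain complexes, cycles and boundaries\<close>

lemma
  assumes "chain_complex R X"
  shows cc_module: "module R (obj X n)"
    and cc_lin: "linmap R (obj X (Suc n)) (obj X n) (dif X n)"
    and cc_dd: "x \<in> carrier (obj X (Suc (Suc n))) \<Longrightarrow> dif X n (dif X (Suc n) x) = \<zero>\<^bsub>obj X n\<^esub>"
  using assms unfolding chain_complex_def by blast+

lemma
  assumes "chain_map R X Y f"
  shows cm_dom: "chain_complex R X" and cm_cod: "chain_complex R Y"
    and cm_lin: "linmap R (obj X n) (obj Y n) (f n)"
    and cm_comm: "x \<in> carrier (obj X (Suc n)) \<Longrightarrow> f n (dif X n x) = dif Y n (f (Suc n) x)"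
  using assms unfolding chain_map_def by blast+

lemma chain_mapI:
  assumes "chain_complex R X" "chain_complex R Y" "\<And>n. linmap R (obj X n) (obj Y n) (f n)"
    "\<And>n x. x \<in> carrier (obj X (Suc n)) \<Longrightarrow> f n (dif X n x) = dif Y n (f (Suc n) x)"
  shows "chain_map R X Y f"
  using assms unfolding chain_map_def by blast

lemma chain_map_comp:
  assumes f: "chain_map R X Y f" and g: "chain_map R Y Z g"
  shows "chain_map R X Z (\<lambda>n x. g n (f n x))"
proof (rule chain_mapI[OF cm_dom[OF f] cm_cod[OF g] linmap_comp[OF cm_lin[OF f] cm_lin[OF g]]])
  fix n x assume "x \<in> carrier (obj X (Suc n))"
  then show "g n (f n (dif X n x)) = dif Z n (g (Suc n) (f (Suc n) x))"
    using cm_comm[OF f] cm_comm[OF g] linmap_closed[OF cm_lin[OF f]] by simp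
qed

lemma chain_map_ident: "chain_complex R X \<Longrightarrow> chain_map R X X (\<lambda>n x. x)"
  by (intro chain_mapI linmap_ident cc_module) auto

lemma cycles_iff:
  "x \<in> cycles X n \<longleftrightarrow> x \<in> carrier (obj X n) \<and> (\<forall>k. n = Suc k \<longrightarrow> dif X k x = \<zero>\<^bsub>obj X k\<^esub>)"
  unfolding cycles_def by (cases n) auto

lemma boundary_cycle:
  assumes X: "chain_complex R X" and w: "w \<in> carrier (obj X (Suc n))"
  shows "dif X n w \<in> cycles X n"
  using w linmap_closed[OF cc_lin[OF X]] cc_dd[OF X] by (auto simp: cycles_iff)

lemma cycles_add:
  assumes X: "chain_complex R X" and "x \<in> cycles X n" "y \<in> cycles X n"
  shows "x \<oplus>\<^bsub>obj X n\<^esub> y \<in> cycles X n"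
proof -
  interpret M: module R "obj X n" by (rule cc_module[OF X])
  have "dif X k (x \<oplus>\<^bsub>obj X n\<^esub> y) = \<zero>\<^bsub>obj X k\<^esub>" if "n = Suc k" for k
  proof -
    interpret N: module R "obj X k" by (rule cc_module[OF X])
    show ?thesis using assms that by (simp add: cycles_iff linmap_add[OF cc_lin[OF X]])
  qed
  then show ?thesis using assms by (auto simp: cycles_iff)
qed

lemma cycles_zero:
  assumes X: "chain_complex R X" shows "\<zero>\<^bsub>obj X n\<^esub> \<in> cycles X n"
proof -
  interpret M: module R "obj X n" by (rule cc_module[OF X])
  show ?thesis using linmap_zero[OF cc_lin[OF X]] by (auto simp: cycles_iff)
qed

lemma cycles_image:
  assumes f: "chain_map R X Y f" and x: "x \<in> cycles X n"
  shows "f n x \<in> cycles Y n"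
proof -
  have "dif Y k (f n x) = \<zero>\<^bsub>obj Y k\<^esub>" if "n = Suc k" for k
    using x that cm_comm[OF f, of x k] linmap_zero[OF cm_lin[OF f]] by (simp add: cycles_iff)
  then show ?thesis using x linmap_closed[OF cm_lin[OF f]] by (auto simp: cycles_iff)
qed

lemma boundaries_image:
  assumes f: "chain_map R X Y f" and x: "x \<in> boundaries X n"
  shows "f n x \<in> boundaries Y n"
  using x cm_comm[OF f] linmap_closed[OF cm_lin[OF f]] unfolding boundaries_def by auto

section \<open>Weak equivalences\<close>

lemma weqI:
  assumes f: "chain_map R X Y f"
    and s: "\<And>n y. y \<in> cycles Y n \<Longrightarrow>
      \<exists>x\<in>cycles X n. \<exists>w\<in>carrier (obj Y (Suc n)). y = f n x \<oplus>\<^bsub>obj Y n\<^esub> dif Y n w"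
    and i: "\<And>n x. x \<in> cycles X n \<Longrightarrow> f n x \<in> boundaries Y n \<Longrightarrow> x \<in> boundaries X n"
  shows "weq R X Y f"
  unfolding weq_def
proof (intro conjI allI ballI f impI)
  fix n y assume "y \<in> cycles Y n"
  then obtain x w where *: "x \<in> cycles X n" "w \<in> carrier (obj Y (Suc n))"
    "y = f n x \<oplus>\<^bsub>obj Y n\<^esub> dif Y n w" using s by blast
  interpret Y: module R "obj Y n" by (rule cc_module[OF cm_cod[OF f]])
  have c: "f n x \<in> carrier (obj Y n)" "dif Y n w \<in> carrier (obj Y n)"
    using * linmap_closed[OF cm_lin[OF f]] linmap_closed[OF cc_lin[OF cm_cod[OF f]]]
    by (auto simp: cycles_iff)
  have "y \<ominus>\<^bsub>obj Y n\<^esub> f n x = dif Y n w"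
    unfolding *(3) a_minus_def using c Y.M.r_neg1 by (simp add: Y.M.a_ac Y.M.r_neg)
  then show "\<exists>x\<in>cycles X n. y \<ominus>\<^bsub>obj Y n\<^esub> f n x \<in> boundaries Y n"
    using *(1,2) unfolding boundaries_def by (metis imageI)
qed (use i in auto)

lemma weq_cm: "weq R X Y f \<Longrightarrow> chain_map R X Y f"
  unfolding weq_def by blast

lemma weq_inj: "weq R X Y f \<Longrightarrow> x \<in> cycles X n \<Longrightarrow> f n x \<in> boundaries Y n \<Longrightarrow> x \<in> boundaries X n"
  unfolding weq_def by blast

lemma weq_surj:
  assumes w: "weq R X Y f" and y: "y \<in> cycles Y n"
  obtains x w where "x \<in> cycles X n" "w \<in> carrier (obj Y (Suc n))" "y = f n x \<oplus>\<^bsub>obj Y n\<^esub> dif Y n w"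
proof -
  note f = weq_cm[OF w]
  obtain x where x: "x \<in> cycles X n" "y \<ominus>\<^bsub>obj Y n\<^esub> f n x \<in> boundaries Y n"
    using w y unfolding weq_def by blast
  then obtain v where v: "v \<in> carrier (obj Y (Suc n))" "y \<ominus>\<^bsub>obj Y n\<^esub> f n x = dif Y n v"
    unfolding boundaries_def by auto
  interpret Y: module R "obj Y n" by (rule cc_module[OF cm_cod[OF f]])
  have c: "f n x \<in> carrier (obj Y n)" "y \<in> carrier (obj Y n)"
    using x y linmap_closed[OF cm_lin[OF f]] by (auto simp: cycles_iff)
  have "y = f n x \<oplus>\<^bsub>obj Y n\<^esub> dif Y n v"
    unfolding v(2)[symmetric] a_minus_def using c by (simp add: Y.M.a_lcomm Y.M.r_neg)
  then show ?thesis using that x v by blast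
qed

lemma weq_trans:
  assumes f: "weq R X Y f" and g: "weq R Y Z g"
  shows "weq R X Z (\<lambda>n x. g n (f n x))"
proof (rule weqI)
  note cf = weq_cm[OF f] and cg = weq_cm[OF g]
  show "chain_map R X Z (\<lambda>n x. g n (f n x))" by (rule chain_map_comp[OF cf cg])
  fix n
  interpret Z: module R "obj Z n" by (rule cc_module[OF cm_cod[OF cg]])
  interpret Z': module R "obj Z (Suc n)" by (rule cc_module[OF cm_cod[OF cg]])
  show "\<exists>x\<in>cycles X n. \<exists>w\<in>carrier (obj Z (Suc n)). z = g n (f n x) \<oplus>\<^bsub>obj Z n\<^esub> dif Z n w"
    if z: "z \<in> cycles Z n" for z
  proof -
    obtain y w where y: "y \<in> cycles Y n" "w \<in> carrier (obj Z (Suc n))"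
      "z = g n y \<oplus>\<^bsub>obj Z n\<^esub> dif Z n w" by (rule weq_surj[OF g z])
    obtain x u where x: "x \<in> cycles X n" "u \<in> carrier (obj Y (Suc n))"
      "y = f n x \<oplus>\<^bsub>obj Y n\<^esub> dif Y n u" by (rule weq_surj[OF f y(1)])
    have c: "f n x \<in> carrier (obj Y n)" "dif Y n u \<in> carrier (obj Y n)"
      using x linmap_closed[OF cm_lin[OF cf]] linmap_closed[OF cc_lin[OF cm_cod[OF cf]]]
      by (auto simp: cycles_iff)
    have c': "g n (f n x) \<in> carrier (obj Z n)" "g (Suc n) u \<in> carrier (obj Z (Suc n))"
      using c x linmap_closed[OF cm_lin[OF cg]] by auto
    have "z = g n (f n x) \<oplus>\<^bsub>obj Z n\<^esub> dif Z n (g (Suc n) u \<oplus>\<^bsub>obj Z (Suc n)\<^esub> w)"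
      using y x c c' linmap_closed[OF cc_lin[OF cm_cod[OF cg]]]
      by (simp add: linmap_add[OF cm_lin[OF cg]] linmap_add[OF cc_lin[OF cm_cod[OF cg]]]
        cm_comm[OF cg] Z.M.a_assoc)
    then show ?thesis using x(1) c' y(2) by blast
  qed
  show "x \<in> boundaries X n" if "x \<in> cycles X n" "g n (f n x) \<in> boundaries Z n" for x
    using that cycles_image[OF cf] weq_inj[OF f] weq_inj[OF g] by blast
qed

section \<open>Isomorphisms of complexes\<close>

lemma cx_isoI:
  assumes "chain_map R X Y f" "\<And>n. bij_betw (f n) (carrier (obj X n)) (carrier (obj Y n))"
  shows "cx_iso R X Y"
  using assms unfolding cx_iso_def by blast

lemma chain_map_inv:
  assumes f: "chain_map R X Y f" and b: "\<And>n. bij_betw (f n) (carrier (obj X n)) (carrier (obj Y n))"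
  shows "chain_map R Y X (\<lambda>n. inv_into (carrier (obj X n)) (f n))"
proof (rule chain_mapI[OF cm_cod[OF f] cm_dom[OF f] linmap_inv_into[OF cm_lin[OF f] b]])
  fix n y assume y: "y \<in> carrier (obj Y (Suc n))"
  let ?x = "inv_into (carrier (obj X (Suc n))) (f (Suc n)) y"
  have x: "?x \<in> carrier (obj X (Suc n))" "f (Suc n) ?x = y"
    using b[of "Suc n"] y by (auto simp: bij_betw_def inv_into_into f_inv_into_f)
  have "f n (dif X n ?x) = dif Y n y" using cm_comm[OF f x(1)] x(2) by simp
  moreover have "dif X n ?x \<in> carrier (obj X n)"
    using x linmap_closed[OF cc_lin[OF cm_dom[OF f]]] by blast
  ultimately show "inv_into (carrier (obj X n)) (f n) (dif Y n y) = dif X n ?x"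
    using b[of n] by (metis bij_betw_imp_inj_on inv_into_f_f)
qed

lemma cx_isoE:
  assumes "cx_iso R X Y"
  obtains f g where "chain_map R X Y f" "chain_map R Y X g"
    "\<And>n x. x \<in> carrier (obj X n) \<Longrightarrow> g n (f n x) = x"
    "\<And>n y. y \<in> carrier (obj Y n) \<Longrightarrow> f n (g n y) = y"
proof -
  obtain f where f: "chain_map R X Y f" "\<And>n. bij_betw (f n) (carrier (obj X n)) (carrier (obj Y n))"
    using assms unfolding cx_iso_def by blast
  show ?thesis
    by (rule that[OF f(1) chain_map_inv[OF f]]) (use f(2) in \<open>auto simp: bij_betw_def f_inv_into_f\<close>)
qed

lemma cx_isoI2:
  assumes "chain_map R X Y f" "chain_map R Y X g"
    "\<And>n x. x \<in> carrier (obj X n) \<Longrightarrow> g n (f n x) = x"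
    "\<And>n y. y \<in> carrier (obj Y n) \<Longrightarrow> f n (g n y) = y"
  shows "cx_iso R X Y"
proof (rule cx_isoI[OF assms(1)])
  fix n show "bij_betw (f n) (carrier (obj X n)) (carrier (obj Y n))"
    using assms(3,4) linmap_closed[OF cm_lin[OF assms(1)]] linmap_closed[OF cm_lin[OF assms(2)]]
    by (intro bij_betwI[where g = "g n"]) auto
qed

lemma cx_iso_sym: "cx_iso R X Y \<Longrightarrow> cx_iso R Y X"
  by (erule cx_isoE) (rule cx_isoI2)

lemma cx_iso_trans:
  assumes "cx_iso R X Y" "cx_iso R Y Z" shows "cx_iso R X Z"
proof -
  obtain f g where f: "chain_map R X Y f" "chain_map R Y X g"
    "\<And>n x. x \<in> carrier (obj X n) \<Longrightarrow> g n (f n x) = x"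
    "\<And>n y. y \<in> carrier (obj Y n) \<Longrightarrow> f n (g n y) = y" using cx_isoE[OF assms(1)] by metis
  obtain f' g' where f': "chain_map R Y Z f'" "chain_map R Z Y g'"
    "\<And>n x. x \<in> carrier (obj Y n) \<Longrightarrow> g' n (f' n x) = x"
    "\<And>n y. y \<in> carrier (obj Z n) \<Longrightarrow> f' n (g' n y) = y" using cx_isoE[OF assms(2)] by metis
  show ?thesis
    by (rule cx_isoI2[OF chain_map_comp[OF f(1) f'(1)] chain_map_comp[OF f'(2) f(2)]])
      (use f f' linmap_closed[OF cm_lin[OF f(1)]] linmap_closed[OF cm_lin[OF f'(2)]] in auto)
qed

lemma cx_iso_refl: "chain_complex R X \<Longrightarrow> cx_iso R X X"
  by (rule cx_isoI2[OF chain_map_ident chain_map_ident]) auto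

lemma weq_iso:
  assumes f: "chain_map R X Y f" and g: "chain_map R Y X g"
    and gf: "\<And>n x. x \<in> carrier (obj X n) \<Longrightarrow> g n (f n x) = x"
    and fg: "\<And>n y. y \<in> carrier (obj Y n) \<Longrightarrow> f n (g n y) = y"
  shows "weq R X Y f"
proof (rule weqI[OF f])
  fix n
  interpret Y: module R "obj Y n" by (rule cc_module[OF cm_cod[OF f]])
  interpret Y': module R "obj Y (Suc n)" by (rule cc_module[OF cm_cod[OF f]])
  show "\<exists>x\<in>cycles X n. \<exists>w\<in>carrier (obj Y (Suc n)). y = f n x \<oplus>\<^bsub>obj Y n\<^esub> dif Y n w"
    if y: "y \<in> cycles Y n" for y
  proof (intro bexI)
    show "g n y \<in> cycles X n" by (rule cycles_image[OF g y])
    show "y = f n (g n y) \<oplus>\<^bsub>obj Y n\<^esub> dif Y n \<zero>\<^bsub>obj Y (Suc n)\<^esub>"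
      using y by (simp add: cycles_iff fg linmap_zero[OF cc_lin[OF cm_cod[OF f]]])
  qed auto
  show "x \<in> boundaries X n" if x: "x \<in> cycles X n" "f n x \<in> boundaries Y n" for x
    using boundaries_image[OF g x(2)] gf x(1) by (simp add: cycles_iff)
qed

text \<open>Through this, closure under weak equivalences also yields closure under
  isomorphism.\<close>

lemma cx_iso_weqE:
  assumes "cx_iso R X Y" obtains f where "weq R X Y f"
  using assms by (elim cx_isoE) (rule that, rule weq_iso)

lemma cx_iso_cc: assumes "cx_iso R X Y" shows "chain_complex R X" "chain_complex R Y"
  using assms unfolding cx_iso_def chain_map_def by auto

section \<open>Direct sums through projections\<close>

text \<open>A direct sum described by its coordinates instead of by a bijection with finitely
  supported families: orthogonality, finite support, and joint injectivity of the projections. These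
  conditions are easy to check for concrete complexes and easy to move along isomorphisms and
  reindexings. The projections are only required to be linear in each degree.\<close>

definition dsum_proj :: "'r ring \<Rightarrow> ('r,'a) cx \<Rightarrow> 'k set \<Rightarrow> ('k \<Rightarrow> ('r,'b) cx)
    \<Rightarrow> ('k \<Rightarrow> nat \<Rightarrow> 'b \<Rightarrow> 'a) \<Rightarrow> ('k \<Rightarrow> nat \<Rightarrow> 'a \<Rightarrow> 'b) \<Rightarrow> bool" where
  "dsum_proj R Y K Xs \<iota> \<pi> \<longleftrightarrow> chain_complex R Y \<and> (\<forall>k\<in>K. chain_map R (Xs k) Y (\<iota> k)) \<and>
     (\<forall>k\<in>K. \<forall>n. linmap R (obj Y n) (obj (Xs k) n) (\<pi> k n)) \<and>
     (\<forall>k\<in>K. \<forall>n. \<forall>x\<in>carrier (obj (Xs k) n). \<pi> k n (\<iota> k n x) = x) \<and>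
     (\<forall>k\<in>K. \<forall>l\<in>K. k \<noteq> l \<longrightarrow> (\<forall>n. \<forall>x\<in>carrier (obj (Xs k) n). \<pi> l n (\<iota> k n x) = zero (obj (Xs l) n))) \<and>
     (\<forall>n. \<forall>y\<in>carrier (obj Y n). finite {k\<in>K. \<pi> k n y \<noteq> zero (obj (Xs k) n)}) \<and>
     (\<forall>n. \<forall>y\<in>carrier (obj Y n). (\<forall>k\<in>K. \<pi> k n y = zero (obj (Xs k) n)) \<longrightarrow> y = zero (obj Y n))"

lemma
  assumes "dsum_proj R Y K Xs \<iota> \<pi>"
  shows dp_cc: "chain_complex R Y"
    and dp_cm: "k \<in> K \<Longrightarrow> chain_map R (Xs k) Y (\<iota> k)"
    and dp_lin: "k \<in> K \<Longrightarrow> linmap R (obj Y n) (obj (Xs k) n) (\<pi> k n)"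
    and dp_same: "k \<in> K \<Longrightarrow> x \<in> carrier (obj (Xs k) n) \<Longrightarrow> \<pi> k n (\<iota> k n x) = x"
    and dp_diff: "k \<in> K \<Longrightarrow> l \<in> K \<Longrightarrow> k \<noteq> l \<Longrightarrow> x \<in> carrier (obj (Xs k) n) \<Longrightarrow>
      \<pi> l n (\<iota> k n x) = zero (obj (Xs l) n)"
    and dp_fin: "y \<in> carrier (obj Y n) \<Longrightarrow> finite {k\<in>K. \<pi> k n y \<noteq> zero (obj (Xs k) n)}"
    and dp_inj: "y \<in> carrier (obj Y n) \<Longrightarrow> (\<And>k. k \<in> K \<Longrightarrow> \<pi> k n y = zero (obj (Xs k) n)) \<Longrightarrow>
      y = zero (obj Y n)"
  using assms unfolding dsum_proj_def by blast+

lemma proj_finsum: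
  assumes dp: "dsum_proj R Y K Xs \<iota> \<pi>" and J: "finite J" "J \<subseteq> K"
    and x: "\<And>k. k \<in> J \<Longrightarrow> x k \<in> carrier (obj (Xs k) n)" and l: "l \<in> K"
  shows "\<pi> l n (finsum (obj Y n) (\<lambda>k. \<iota> k n (x k)) J) = (if l \<in> J then x l else zero (obj (Xs l) n))"
proof -
  interpret L: module R "obj (Xs l) n" by (rule linmap_cod[OF dp_lin[OF dp l]])
  have c: "\<iota> k n (x k) \<in> carrier (obj Y n)" if "k \<in> J" for k
    using linmap_closed[OF cm_lin[OF dp_cm[OF dp]]] x J that by blast
  have "\<pi> l n (finsum (obj Y n) (\<lambda>k. \<iota> k n (x k)) J) =
    finsum (obj (Xs l) n) (\<lambda>k. \<pi> l n (\<iota> k n (x k))) J"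
    by (rule linmap_finsum[OF dp_lin[OF dp l] J(1) c])
  also have "\<dots> = finsum (obj (Xs l) n) (\<lambda>k. if l = k then x l else zero (obj (Xs l) n)) J"
    by (rule L.M.finsum_cong') (use J x dp_same[OF dp] dp_diff[OF dp _ l] in \<open>auto simp: subset_iff\<close>)
  also have "\<dots> = (if l \<in> J then x l else zero (obj (Xs l) n))"
  proof (cases "l \<in> J")
    case True
    then show ?thesis using L.M.finsum_singleton[OF True J(1), of "\<lambda>_. x l"] x by (auto simp: Pi_def)
  next
    case False
    then have "finsum (obj (Xs l) n) (\<lambda>k. if l = k then x l else zero (obj (Xs l) n)) J =
      finsum (obj (Xs l) n) (\<lambda>k. zero (obj (Xs l) n)) J"
      by (intro L.M.finsum_cong') auto
    then show ?thesis using False by simp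
  qed
  finally show ?thesis .
qed

text \<open>Both sides have the same coordinates, and an element all of whose coordinates vanish is
  zero.\<close>

lemma dsum_proj_expand:
  assumes dp: "dsum_proj R Y K Xs \<iota> \<pi>" and y: "y \<in> carrier (obj Y n)"
  shows "y = finsum (obj Y n) (\<lambda>k. \<iota> k n (\<pi> k n y)) {k\<in>K. \<pi> k n y \<noteq> zero (obj (Xs k) n)}"
    (is "y = finsum _ ?f ?J")
proof -
  interpret Y: module R "obj Y n" by (rule cc_module[OF dp_cc[OF dp]])
  have c: "?f k \<in> carrier (obj Y n)" "\<pi> k n y \<in> carrier (obj (Xs k) n)" if "k \<in> K" for k
    using linmap_closed[OF cm_lin[OF dp_cm[OF dp]]] linmap_closed[OF dp_lin[OF dp] y] that by auto
  have z: "finsum (obj Y n) ?f ?J \<in> carrier (obj Y n)"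
    using c by (intro Y.M.finsum_closed) auto
  have "y \<ominus>\<^bsub>obj Y n\<^esub> finsum (obj Y n) ?f ?J = \<zero>\<^bsub>obj Y n\<^esub>"
  proof (rule dp_inj[OF dp])
    show "y \<ominus>\<^bsub>obj Y n\<^esub> finsum (obj Y n) ?f ?J \<in> carrier (obj Y n)" using y z by simp
    fix l assume l: "l \<in> K"
    interpret L: module R "obj (Xs l) n" by (rule linmap_cod[OF dp_lin[OF dp l]])
    have "\<pi> l n (finsum (obj Y n) ?f ?J) = \<pi> l n y"
      using proj_finsum[OF dp dp_fin[OF dp y], of "\<lambda>k. \<pi> k n y" n l] c l by auto
    then show "\<pi> l n (y \<ominus>\<^bsub>obj Y n\<^esub> finsum (obj Y n) ?f ?J) = \<zero>\<^bsub>obj (Xs l) n\<^esub>"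
      using c(2)[OF l] unfolding linmap_diff[OF dp_lin[OF dp l] y z] by (simp add: a_minus_def L.M.r_neg)
  qed
  moreover have "(y \<ominus>\<^bsub>obj Y n\<^esub> finsum (obj Y n) ?f ?J) \<oplus>\<^bsub>obj Y n\<^esub> finsum (obj Y n) ?f ?J = y"
    using y z by (simp add: a_minus_def Y.M.a_assoc Y.M.l_neg)
  ultimately show ?thesis using z by simp
qed

text \<open>Compatibility with the differentials comes for free: expand \<open>y\<close> in
  coordinates and use that the injections are chain maps.\<close>

lemma dsum_proj_chain_map:
  assumes dp: "dsum_proj R Y K Xs \<iota> \<pi>" and l: "l \<in> K"
  shows "chain_map R Y (Xs l) (\<pi> l)"
proof (rule chain_mapI[OF dp_cc[OF dp] cm_dom[OF dp_cm[OF dp l]] dp_lin[OF dp l]])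
  fix n y assume y: "y \<in> carrier (obj Y (Suc n))"
  let ?J = "{k\<in>K. \<pi> k (Suc n) y \<noteq> zero (obj (Xs k) (Suc n))}"
  have c: "\<iota> k (Suc n) (\<pi> k (Suc n) y) \<in> carrier (obj Y (Suc n))" "\<pi> k (Suc n) y \<in> carrier (obj (Xs k) (Suc n))"
    "dif (Xs k) n (\<pi> k (Suc n) y) \<in> carrier (obj (Xs k) n)" if "k \<in> K" for k
    using linmap_closed[OF cm_lin[OF dp_cm[OF dp]]] linmap_closed[OF dp_lin[OF dp] y]
      linmap_closed[OF cc_lin[OF cm_dom[OF dp_cm[OF dp]]]] that by auto
  interpret Y: module R "obj Y n" by (rule cc_module[OF dp_cc[OF dp]])
  have "dif Y n y = dif Y n (finsum (obj Y (Suc n)) (\<lambda>k. \<iota> k (Suc n) (\<pi> k (Suc n) y)) ?J)"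
    using dsum_proj_expand[OF dp y] by simp
  also have "\<dots> = finsum (obj Y n) (\<lambda>k. dif Y n (\<iota> k (Suc n) (\<pi> k (Suc n) y))) ?J"
    by (rule linmap_finsum[OF cc_lin[OF dp_cc[OF dp]] dp_fin[OF dp y]]) (use c in auto)
  also have "\<dots> = finsum (obj Y n) (\<lambda>k. \<iota> k n (dif (Xs k) n (\<pi> k (Suc n) y))) ?J"
    using c cm_comm[OF dp_cm[OF dp], symmetric] linmap_closed[OF cm_lin[OF dp_cm[OF dp]]]
    by (intro Y.M.finsum_cong') auto
  finally have "\<pi> l n (dif Y n y) = (if l \<in> ?J then dif (Xs l) n (\<pi> l (Suc n) y) else zero (obj (Xs l) n))"
    using proj_finsum[OF dp dp_fin[OF dp y], of "\<lambda>k. dif (Xs k) n (\<pi> k (Suc n) y)" n l] c l by auto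
  then show "\<pi> l n (dif Y n y) = dif (Xs l) n (\<pi> l (Suc n) y)"
    using l linmap_zero[OF cc_lin[OF cm_dom[OF dp_cm[OF dp l]]]] by (auto split: if_splits)
qed

lemma dsum_proj_is_dsum:
  assumes dp: "dsum_proj R Y K Xs \<iota> \<pi>"
  shows "is_dsum R Y K Xs \<iota>"
  unfolding is_dsum_def
proof (intro conjI ballI allI dp_cc[OF dp] dp_cm[OF dp])
  fix n
  let ?D = "{x. (\<forall>k\<in>K. x k \<in> carrier (obj (Xs k) n)) \<and> (\<forall>k. k \<notin> K \<longrightarrow> x k = undefined) \<and>
            finite {k\<in>K. x k \<noteq> zero (obj (Xs k) n)}}"
  let ?\<Phi> = "\<lambda>x. finsum (obj Y n) (\<lambda>k. \<iota> k n (x k)) {k\<in>K. x k \<noteq> zero (obj (Xs k) n)}"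
  let ?\<Psi> = "\<lambda>y k. if k \<in> K then \<pi> k n y else undefined"
  interpret Y: module R "obj Y n" by (rule cc_module[OF dp_cc[OF dp]])
  show "bij_betw ?\<Phi> ?D (carrier (obj Y n))"
  proof (rule bij_betwI[where g = ?\<Psi>])
    show "?\<Phi> \<in> ?D \<rightarrow> carrier (obj Y n)"
      using linmap_closed[OF cm_lin[OF dp_cm[OF dp]]] by (auto intro!: Y.M.finsum_closed)
    have *: "{k \<in> K. ?\<Psi> y k \<noteq> \<zero>\<^bsub>obj (Xs k) n\<^esub>} = {k \<in> K. \<pi> k n y \<noteq> \<zero>\<^bsub>obj (Xs k) n\<^esub>}" for y by auto
    show "?\<Psi> \<in> carrier (obj Y n) \<rightarrow> ?D"
      using dp_fin[OF dp] linmap_closed[OF dp_lin[OF dp]] * by simp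
    show "?\<Psi> (?\<Phi> x) = x" if "x \<in> ?D" for x
    proof
      fix l
      show "?\<Psi> (?\<Phi> x) l = x l"
        using that proj_finsum[OF dp, of "{k \<in> K. x k \<noteq> \<zero>\<^bsub>obj (Xs k) n\<^esub>}" x n l] by auto
    qed
    show "?\<Phi> (?\<Psi> y) = y" if y: "y \<in> carrier (obj Y n)" for y
    proof -
      have "?\<Phi> (?\<Psi> y) = finsum (obj Y n) (\<lambda>k. \<iota> k n (\<pi> k n y)) {k\<in>K. \<pi> k n y \<noteq> zero (obj (Xs k) n)}"
        unfolding * using linmap_closed[OF cm_lin[OF dp_cm[OF dp]]] linmap_closed[OF dp_lin[OF dp] y]
        by (intro Y.M.finsum_cong') auto
      then show ?thesis using dsum_proj_expand[OF dp y] by simp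
    qed
  qed
qed

text \<open>The projections are the coordinates of the inverse bijection. They are linear because a
  coordinatewise sum or multiple of families is sent to the sum or multiple in \<open>Y\<close>, and
  the bijection is injective.\<close>

lemma is_dsum_dsum_proj:
  assumes ds: "is_dsum R Y K Xs \<iota>"
  obtains \<pi> where "dsum_proj R Y K Xs \<iota> \<pi>"
proof -
  define D where "D n = {x. (\<forall>k\<in>K. x k \<in> carrier (obj (Xs k) n)) \<and> (\<forall>k. k \<notin> K \<longrightarrow> x k = undefined) \<and>
            finite {k\<in>K. x k \<noteq> zero (obj (Xs k) n)}}" for n
  define \<Phi> where "\<Phi> n x = finsum (obj Y n) (\<lambda>k. \<iota> k n (x k)) {k\<in>K. x k \<noteq> zero (obj (Xs k) n)}" for n x
  have Y: "chain_complex R Y" and cm: "\<And>k. k \<in> K \<Longrightarrow> chain_map R (Xs k) Y (\<iota> k)"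
    and bij: "\<And>n. bij_betw (\<Phi> n) (D n) (carrier (obj Y n))"
    using ds unfolding is_dsum_def D_def \<Phi>_def by blast+
  define c where "c n = inv_into (D n) (\<Phi> n)" for n
  have c: "c n y \<in> D n" "\<Phi> n (c n y) = y" if "y \<in> carrier (obj Y n)" for n y
    using that bij[of n] by (auto simp: c_def bij_betw_def inv_into_into f_inv_into_f)
  have c\<Phi>: "c n (\<Phi> n x) = x" if "x \<in> D n" for n x
    using that bij[of n] by (auto simp: c_def bij_betw_def)
  have cl: "\<iota> k n x \<in> carrier (obj Y n)" if "k \<in> K" "x \<in> carrier (obj (Xs k) n)" for k n x
    using linmap_closed[OF cm_lin[OF cm]] that by blast
  \<comment> \<open>The bijection sums over the exact support of a family, which changes under
    addition and scaling. Zero coordinates contribute nothing, so any finite index set containing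
    the support gives the same value, and two families can be summed over a common one.\<close>
  have ext: "\<Phi> n x = finsum (obj Y n) (\<lambda>k. \<iota> k n (x k)) J"
    if "x \<in> D n" "finite J" "J \<subseteq> K" "{k\<in>K. x k \<noteq> zero (obj (Xs k) n)} \<subseteq> J" for n x J
  proof -
    interpret Yn: module R "obj Y n" by (rule cc_module[OF Y])
    have z: "\<iota> k n (x k) = \<zero>\<^bsub>obj Y n\<^esub>" if "k \<in> J - {k\<in>K. x k \<noteq> zero (obj (Xs k) n)}" for k
      using that \<open>J \<subseteq> K\<close> linmap_zero[OF cm_lin[OF cm]] by auto
    show ?thesis unfolding \<Phi>_def
      by (rule Yn.M.add.finprod_mono_neutral_cong_left[OF that(2,4) z])
        (use that cl in \<open>auto simp: D_def\<close>)
  qed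
  have supp: "finite {k\<in>K. x k \<noteq> zero (obj (Xs k) n)}" if "x \<in> D n" for x n
    using that by (simp add: D_def)
  have cmod: "module R (obj (Xs k) n)" if "k \<in> K" for k n
    using cc_module[OF cm_dom[OF cm[OF that]]] .
  have "dsum_proj R Y K Xs \<iota> (\<lambda>k n y. c n y k)"
    unfolding dsum_proj_def
  proof (intro conjI ballI allI impI)
    show "chain_complex R Y" by (rule Y)
    show "chain_map R (Xs k) Y (\<iota> k)" if "k \<in> K" for k by (rule cm[OF that])
    show "finite {k \<in> K. c n y k \<noteq> \<zero>\<^bsub>obj (Xs k) n\<^esub>}" if "y \<in> carrier (obj Y n)" for n y
      using supp[OF c(1)[OF that]] .
    show "y = \<zero>\<^bsub>obj Y n\<^esub>" if "y \<in> carrier (obj Y n)" "\<forall>k\<in>K. c n y k = \<zero>\<^bsub>obj (Xs k) n\<^esub>" for n y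
    proof -
      interpret Yn: module R "obj Y n" by (rule cc_module[OF Y])
      have e: "{k \<in> K. c n y k \<noteq> \<zero>\<^bsub>obj (Xs k) n\<^esub>} = {}" using that(2) by auto
      have "\<Phi> n (c n y) = \<zero>\<^bsub>obj Y n\<^esub>" unfolding \<Phi>_def e by simp
      then show ?thesis using c(2)[OF that(1)] by simp
    qed
    have single: "c n (\<iota> k n x) = (\<lambda>l. if l = k then x else if l \<in> K then \<zero>\<^bsub>obj (Xs l) n\<^esub> else undefined)"
      (is "_ = ?x") if k: "k \<in> K" and x: "x \<in> carrier (obj (Xs k) n)" for k n x
    proof -
      interpret Yn: module R "obj Y n" by (rule cc_module[OF Y])
      have sub: "{l\<in>K. ?x l \<noteq> \<zero>\<^bsub>obj (Xs l) n\<^esub>} \<subseteq> {k}" by auto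
      have "\<zero>\<^bsub>obj (Xs l) n\<^esub> \<in> carrier (obj (Xs l) n)" if "l \<in> K" for l
      proof -
        interpret L: module R "obj (Xs l) n" by (rule cmod[OF that])
        show ?thesis by simp
      qed
      then have D: "?x \<in> D n"
        using k x finite_subset[OF sub] by (auto simp: D_def)
      have "\<Phi> n ?x = finsum (obj Y n) (\<lambda>l. \<iota> l n (?x l)) {k}"
        by (rule ext[OF D _ _ sub]) (use k in auto)
      also have "\<dots> = \<iota> k n x" using cl[OF k x] by simp
      finally show ?thesis using c\<Phi>[OF D] by simp
    qed
    show "c n (\<iota> k n x) k = x" if "k \<in> K" "x \<in> carrier (obj (Xs k) n)" for k n x
      using single[OF that] by simp
    show "c n (\<iota> k n x) l = \<zero>\<^bsub>obj (Xs l) n\<^esub>"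
      if "k \<in> K" "l \<in> K" "k \<noteq> l" "x \<in> carrier (obj (Xs k) n)" for k l n x
      using single[OF that(1,4)] that by simp
    show "linmap R (obj Y n) (obj (Xs k) n) (\<lambda>y. c n y k)" if k: "k \<in> K" for k n
    proof -
      interpret Yn: module R "obj Y n" by (rule cc_module[OF Y])
      interpret L: module R "obj (Xs k) n" by (rule cmod[OF k])
      have cc: "c n y l \<in> carrier (obj (Xs l) n)" if "y \<in> carrier (obj Y n)" "l \<in> K" for l y
        using c(1)[OF that(1)] that(2) by (auto simp: D_def)
      show ?thesis
      proof (rule linmapI[OF cc_module[OF Y] cmod[OF k]])
        show "c n y k \<in> carrier (obj (Xs k) n)" if "y \<in> carrier (obj Y n)" for y by (rule cc[OF that k])
      next
        fix y z assume yz: "y \<in> carrier (obj Y n)" "z \<in> carrier (obj Y n)"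
        let ?x = "\<lambda>l. if l \<in> K then c n y l \<oplus>\<^bsub>obj (Xs l) n\<^esub> c n z l else undefined"
        let ?J = "{l\<in>K. c n y l \<noteq> \<zero>\<^bsub>obj (Xs l) n\<^esub>} \<union> {l\<in>K. c n z l \<noteq> \<zero>\<^bsub>obj (Xs l) n\<^esub>}"
        have J: "finite ?J" "?J \<subseteq> K" using supp[OF c(1)[OF yz(1)]] supp[OF c(1)[OF yz(2)]] by auto
        have xc: "?x l \<in> carrier (obj (Xs l) n)"
            "c n y l = \<zero>\<^bsub>obj (Xs l) n\<^esub> \<Longrightarrow> c n z l = \<zero>\<^bsub>obj (Xs l) n\<^esub> \<Longrightarrow> ?x l = \<zero>\<^bsub>obj (Xs l) n\<^esub>"
            if "l \<in> K" for l
        proof -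
          interpret L: module R "obj (Xs l) n" by (rule cmod[OF that])
          show "?x l \<in> carrier (obj (Xs l) n)"
            "c n y l = \<zero>\<^bsub>obj (Xs l) n\<^esub> \<Longrightarrow> c n z l = \<zero>\<^bsub>obj (Xs l) n\<^esub> \<Longrightarrow> ?x l = \<zero>\<^bsub>obj (Xs l) n\<^esub>"
            using that cc yz by simp_all
        qed
        have sub: "{l\<in>K. ?x l \<noteq> \<zero>\<^bsub>obj (Xs l) n\<^esub>} \<subseteq> ?J" using xc(2) by fastforce
        have D: "?x \<in> D n" using xc(1) finite_subset[OF sub J(1)] by (auto simp: D_def)
        have "\<Phi> n ?x = finsum (obj Y n) (\<lambda>l. \<iota> l n (?x l)) ?J"
          by (rule ext[OF D J sub])
        also have "\<dots> = finsum (obj Y n) (\<lambda>l. \<iota> l n (c n y l) \<oplus>\<^bsub>obj Y n\<^esub> \<iota> l n (c n z l)) ?J"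
          using cc yz cl linmap_add[OF cm_lin[OF cm]]
          by (intro Yn.M.finsum_cong') auto
        also have "\<dots> = finsum (obj Y n) (\<lambda>l. \<iota> l n (c n y l)) ?J \<oplus>\<^bsub>obj Y n\<^esub>
            finsum (obj Y n) (\<lambda>l. \<iota> l n (c n z l)) ?J"
          using cc yz cl by (intro Yn.M.finsum_addf) auto
        also have "\<dots> = \<Phi> n (c n y) \<oplus>\<^bsub>obj Y n\<^esub> \<Phi> n (c n z)"
          using ext[OF c(1)[OF yz(1)] J] ext[OF c(1)[OF yz(2)] J] by auto
        also have "\<dots> = y \<oplus>\<^bsub>obj Y n\<^esub> z" using c yz by simp
        finally have "c n (y \<oplus>\<^bsub>obj Y n\<^esub> z) = ?x" using c\<Phi>[OF D] by simp
        then show "c n (y \<oplus>\<^bsub>obj Y n\<^esub> z) k = c n y k \<oplus>\<^bsub>obj (Xs k) n\<^esub> c n z k" using k by simp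
      next
        fix a y assume ay: "a \<in> carrier R" "y \<in> carrier (obj Y n)"
        let ?x = "\<lambda>l. if l \<in> K then a \<odot>\<^bsub>obj (Xs l) n\<^esub> c n y l else undefined"
        let ?J = "{l\<in>K. c n y l \<noteq> \<zero>\<^bsub>obj (Xs l) n\<^esub>}"
        have J: "finite ?J" "?J \<subseteq> K" using supp[OF c(1)[OF ay(2)]] by auto
        have xc: "?x l \<in> carrier (obj (Xs l) n)"
            "c n y l = \<zero>\<^bsub>obj (Xs l) n\<^esub> \<Longrightarrow> ?x l = \<zero>\<^bsub>obj (Xs l) n\<^esub>" if "l \<in> K" for l
        proof -
          interpret L: module R "obj (Xs l) n" by (rule cmod[OF that])
          show "?x l \<in> carrier (obj (Xs l) n)"
            "c n y l = \<zero>\<^bsub>obj (Xs l) n\<^esub> \<Longrightarrow> ?x l = \<zero>\<^bsub>obj (Xs l) n\<^esub>"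
            using that cc ay by simp_all
        qed
        have sub: "{l\<in>K. ?x l \<noteq> \<zero>\<^bsub>obj (Xs l) n\<^esub>} \<subseteq> ?J" using xc(2) by fastforce
        have D: "?x \<in> D n" using xc(1) finite_subset[OF sub J(1)] by (auto simp: D_def)
        have "\<Phi> n ?x = finsum (obj Y n) (\<lambda>l. \<iota> l n (?x l)) ?J"
          by (rule ext[OF D J sub])
        also have "\<dots> = finsum (obj Y n) (\<lambda>l. a \<odot>\<^bsub>obj Y n\<^esub> \<iota> l n (c n y l)) ?J"
          using cc ay cl linmap_smult[OF cm_lin[OF cm]]
          by (intro Yn.M.finsum_cong') auto
        also have "\<dots> = a \<odot>\<^bsub>obj Y n\<^esub> finsum (obj Y n) (\<lambda>l. \<iota> l n (c n y l)) ?J"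
          using cc ay cl J by (intro Yn.finsum_smult_ldistr[symmetric]) auto
        also have "\<dots> = a \<odot>\<^bsub>obj Y n\<^esub> y"
          using ext[OF c(1)[OF ay(2)] J] c(2)[OF ay(2)] by auto
        finally have "c n (a \<odot>\<^bsub>obj Y n\<^esub> y) = ?x" using c\<Phi>[OF D] by simp
        then show "c n (a \<odot>\<^bsub>obj Y n\<^esub> y) k = a \<odot>\<^bsub>obj (Xs k) n\<^esub> c n y k" using k by simp
      qed
    qed
  qed
  then show ?thesis by (rule that)
qed

section \<open>Invariants of the class\<close>

definition exact_at :: "('r,'a) cx \<Rightarrow> nat \<Rightarrow> bool" where
  "exact_at X n \<longleftrightarrow> cycles X n \<subseteq> boundaries X n"

lemma exact_atE:
  assumes "exact_at X n" "x \<in> cycles X n"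
  obtains w where "w \<in> carrier (obj X (Suc n))" "x = dif X n w"
  using assms unfolding exact_at_def boundaries_def by blast

lemma add_diff_cancel_module:
  assumes "module R M" "a \<in> carrier M" "b \<in> carrier M"
  shows "(a \<oplus>\<^bsub>M\<^esub> b) \<ominus>\<^bsub>M\<^esub> a = b"
proof -
  interpret M: module R M by (rule assms)
  have "(a \<oplus>\<^bsub>M\<^esub> b) \<oplus>\<^bsub>M\<^esub> \<ominus>\<^bsub>M\<^esub> a = b \<oplus>\<^bsub>M\<^esub> (a \<oplus>\<^bsub>M\<^esub> \<ominus>\<^bsub>M\<^esub> a)"
    using assms by (simp add: M.M.a_ac)
  then show ?thesis using assms by (simp add: a_minus_def M.M.r_neg)
qed

lemma exact_at_weq_fwd:
  assumes f: "weq R X Y f" and X: "exact_at X n"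
  shows "exact_at Y n"
  unfolding exact_at_def
proof
  note cf = weq_cm[OF f]
  interpret Y: module R "obj Y (Suc n)" by (rule cc_module[OF cm_cod[OF cf]])
  fix y assume "y \<in> cycles Y n"
  then obtain x w where x: "x \<in> cycles X n" "w \<in> carrier (obj Y (Suc n))"
    "y = f n x \<oplus>\<^bsub>obj Y n\<^esub> dif Y n w" by (rule weq_surj[OF f])
  obtain u where u: "u \<in> carrier (obj X (Suc n))" "x = dif X n u" by (rule exact_atE[OF X x(1)])
  note fu = linmap_closed[OF cm_lin[OF cf] u(1)]
  have "y = dif Y n (f (Suc n) u \<oplus>\<^bsub>obj Y (Suc n)\<^esub> w)"
    using x(3) u cm_comm[OF cf u(1)] by (simp add: linmap_add[OF cc_lin[OF cm_cod[OF cf]] fu x(2)])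
  then show "y \<in> boundaries Y n" using fu x(2) unfolding boundaries_def by auto
qed

lemma exact_at_weq_bwd:
  assumes f: "weq R X Y f" and Y: "exact_at Y n"
  shows "exact_at X n"
  using weq_inj[OF f] cycles_image[OF weq_cm[OF f]] Y unfolding exact_at_def by blast

text \<open>The obstruction to lifting a cycle is its image under the connecting map, a class in the
  homology of \<open>X\<close> one degree lower, which is zero by exactness. In degree 0 there is no
  obstruction.\<close>

lemma ses_lift_cycle:
  assumes s: "ses R X Y Z f g" and X: "\<And>k. n = Suc k \<Longrightarrow> exact_at X k" and z: "z \<in> cycles Z n"
  obtains y where "y \<in> cycles Y n" "g n y = z"
proof -
  have f: "chain_map R X Y f" and g: "chain_map R Y Z g"
    and inj: "\<And>n. inj_on (f n) (carrier (obj X n))"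
    and sur: "\<And>n. g n ` carrier (obj Y n) = carrier (obj Z n)"
    and ker: "\<And>n. f n ` carrier (obj X n) = {y \<in> carrier (obj Y n). g n y = zero (obj Z n)}"
    using s unfolding ses_def by blast+
  have "z \<in> g n ` carrier (obj Y n)" using z sur[of n] by (simp add: cycles_iff)
  then obtain y where y: "y \<in> carrier (obj Y n)" "g n y = z" by blast
  show ?thesis
  proof (cases n)
    case 0
    then show ?thesis using y that by (auto simp: cycles_iff)
  next
    case (Suc k)
    have dy: "dif Y k y \<in> carrier (obj Y k)" using linmap_closed[OF cc_lin[OF cm_cod[OF f]]] y Suc by auto
    have "g k (dif Y k y) = zero (obj Z k)" using cm_comm[OF g, of y k] y z Suc by (simp add: cycles_iff)
    then obtain x where x: "x \<in> carrier (obj X k)" "dif Y k y = f k x" using dy ker[of k] by auto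
    \<comment> \<open>The preimage \<open>x\<close> of the boundary of \<open>y\<close> is a cycle,
      since \<open>f\<close> is injective and two differentials of \<open>y\<close> compose to
      zero.\<close>
    have "dif X l x = zero (obj X l)" if "k = Suc l" for l
    proof (rule inj_onD[OF inj])
      have "f l (dif X l x) = dif Y l (dif Y k y)" using x that cm_comm[OF f] by simp
      also have "\<dots> = zero (obj Y l)" using y Suc that cc_dd[OF cm_cod[OF f]] by simp
      finally show "f l (dif X l x) = f l (zero (obj X l))" using linmap_zero[OF cm_lin[OF f]] by simp
      show "dif X l x \<in> carrier (obj X l)" using linmap_closed[OF cc_lin[OF cm_dom[OF f]]] x that by auto
      interpret X: module R "obj X l" by (rule cc_module[OF cm_dom[OF f]])
      show "zero (obj X l) \<in> carrier (obj X l)" by simp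
    qed
    then have "x \<in> cycles X k" using x by (simp add: cycles_iff)
    then obtain w where w: "w \<in> carrier (obj X n)" "x = dif X k w"
      using exact_atE[OF X[OF Suc]] Suc by metis
    interpret Y: module R "obj Y n" by (rule cc_module[OF cm_cod[OF f]])
    interpret Yk: module R "obj Y k" by (rule cc_module[OF cm_cod[OF f]])
    interpret Z: module R "obj Z n" by (rule cc_module[OF cm_cod[OF g]])
    have fw: "f n w \<in> carrier (obj Y n)" "g n (f n w) = zero (obj Z n)" using ker[of n] w by auto
    have "dif Y k (y \<ominus>\<^bsub>obj Y n\<^esub> f n w) = zero (obj Y k)"
      using linmap_diff[OF cc_lin[OF cm_cod[OF f]], of y k "f n w"] y fw w Suc dy x cm_comm[OF f]
      by (simp add: a_minus_def Yk.M.r_neg)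
    moreover have "g n (y \<ominus>\<^bsub>obj Y n\<^esub> f n w) = z"
      using linmap_diff[OF cm_lin[OF g] y(1) fw(1)] fw y linmap_closed[OF cm_lin[OF g] y(1)]
      by (simp add: a_minus_def)
    moreover have "y \<ominus>\<^bsub>obj Y n\<^esub> f n w \<in> carrier (obj Y n)" using y fw by simp
    ultimately show ?thesis
      using that[of "y \<ominus>\<^bsub>obj Y n\<^esub> f n w"] Suc unfolding cycles_iff by blast
  qed
qed

lemma exact_at_cofib:
  assumes s: "ses R X Y Z f g" and Y: "exact_at Y n" and X: "\<And>k. n = Suc k \<Longrightarrow> exact_at X k"
  shows "exact_at Z n"
  unfolding exact_at_def
proof
  have g: "chain_map R Y Z g" using s unfolding ses_def by blast
  fix z assume z: "z \<in> cycles Z n"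
  obtain y where y: "y \<in> cycles Y n" "g n y = z" by (rule ses_lift_cycle[OF s X z])
  then show "z \<in> boundaries Z n" using Y boundaries_image[OF g, of y n] unfolding exact_at_def by auto
qed

lemma boundaries_add:
  assumes Y: "chain_complex R Y" and "u \<in> boundaries Y n" "v \<in> boundaries Y n"
  shows "u \<oplus>\<^bsub>obj Y n\<^esub> v \<in> boundaries Y n"
proof -
  interpret Y: module R "obj Y (Suc n)" by (rule cc_module[OF Y])
  obtain u' v' where "u' \<in> carrier (obj Y (Suc n))" "u = dif Y n u'"
    "v' \<in> carrier (obj Y (Suc n))" "v = dif Y n v'" using assms unfolding boundaries_def by blast
  then show ?thesis
    using linmap_add[OF cc_lin[OF Y], of u' n v'] unfolding boundaries_def
    by (metis Y.M.a_closed imageI)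
qed

lemma boundaries_zero:
  assumes Y: "chain_complex R Y" shows "\<zero>\<^bsub>obj Y n\<^esub> \<in> boundaries Y n"
proof -
  interpret Y: module R "obj Y (Suc n)" by (rule cc_module[OF Y])
  show ?thesis using linmap_zero[OF cc_lin[OF Y]] unfolding boundaries_def by (metis Y.M.zero_closed imageI)
qed

lemma exact_at_dsum:
  assumes ds: "is_dsum R Y K Xs \<iota>" and X: "\<And>k. k \<in> K \<Longrightarrow> exact_at (Xs k) n"
  shows "exact_at Y n"
  unfolding exact_at_def
proof
  obtain \<pi> where dp: "dsum_proj R Y K Xs \<iota> \<pi>" by (rule is_dsum_dsum_proj[OF ds])
  fix y assume "y \<in> cycles Y n"
  then have y: "y \<in> carrier (obj Y n)" and p: "\<And>k. k \<in> K \<Longrightarrow> \<pi> k n y \<in> cycles (Xs k) n"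
    using cycles_image[OF dsum_proj_chain_map[OF dp]] by (auto simp: cycles_iff)
  have "finsum (obj Y n) (\<lambda>k. \<iota> k n (\<pi> k n y)) {k\<in>K. \<pi> k n y \<noteq> zero (obj (Xs k) n)} \<in> boundaries Y n"
  proof (rule finsum_induct[OF cc_module[OF dp_cc[OF dp]] dp_fin[OF dp y]])
    show "\<iota> k n (\<pi> k n y) \<in> boundaries Y n" if "k \<in> {k\<in>K. \<pi> k n y \<noteq> zero (obj (Xs k) n)}" for k
      using that p X boundaries_image[OF dp_cm[OF dp]] unfolding exact_at_def by blast
    show "\<iota> k n (\<pi> k n y) \<in> carrier (obj Y n)" if "k \<in> {k\<in>K. \<pi> k n y \<noteq> zero (obj (Xs k) n)}" for k
      using that p linmap_closed[OF cm_lin[OF dp_cm[OF dp]]] by (auto simp: cycles_iff)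
  qed (auto intro: boundaries_add boundaries_zero dp_cc[OF dp])
  then show "y \<in> boundaries Y n" using dsum_proj_expand[OF dp y] by simp
qed

lemma gg_chain_complex: "gg R A Y \<Longrightarrow> chain_complex R Y"
  by (induction rule: gg.induct)
    (auto simp: cx_iso_def is_dsum_def weq_def ses_def dest: cm_dom cm_cod)

text \<open>A cofibre is exact in degree \<open>n\<close> only if the subcomplex is exact in degree
  \<open>n - 1\<close>, so the induction has to carry all degrees below \<open>i\<close> at
  once.\<close>

lemma gg_exact_below:
  assumes "gg R A Y" and "\<And>n. n < i \<Longrightarrow> exact_at A n"
  shows "n < i \<Longrightarrow> exact_at Y n"
  using assms(1)
proof (induction arbitrary: n rule: gg.induct)
  case (base Y)
  then show ?case using assms(2) by (meson cx_iso_weqE exact_at_weq_fwd)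
next
  case (dsum K Xs Y \<iota>)
  then show ?case using exact_at_dsum by blast
next
  case (cofib X Y Z f g)
  then show ?case by (intro exact_at_cofib[OF cofib.hyps(3)]) auto
qed (use exact_at_weq_fwd exact_at_weq_bwd in blast)+

lemma acyclic_iff: "acyclic R X \<longleftrightarrow> chain_complex R X \<and> (\<forall>n. exact_at X n)"
  unfolding acyclic_def exact_at_def by simp

lemma gg_acyclic: "gg R A Y \<Longrightarrow> acyclic R A \<Longrightarrow> acyclic R Y"
  unfolding acyclic_iff using gg_exact_below[of R A Y "Suc n" n for n] gg_chain_complex by auto

section \<open>Extending cycles along multiplication by r\<close>

definition rchain :: "('r,'a) cx \<Rightarrow> 'r \<Rightarrow> nat \<Rightarrow> nat \<Rightarrow> (nat \<Rightarrow> 'a) \<Rightarrow> bool" where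
  "rchain Y r i j y \<longleftrightarrow> (\<forall>n\<le>j. y n \<in> carrier (obj Y (i + n))) \<and>
     (\<forall>n<j. dif Y (i + n) (y (Suc n)) = r \<odot>\<^bsub>obj Y (i + n)\<^esub> y n)"

text \<open>Every homology class of degree \<open>i\<close> extends to a map from \<open>\<Sigma>\<^sup>i E\<^sub>j\<close>.\<close>
definition extendable :: "('r,'a) cx \<Rightarrow> 'r \<Rightarrow> nat \<Rightarrow> nat \<Rightarrow> bool" where
  "extendable Y r i j \<longleftrightarrow> (\<forall>y0\<in>cycles Y i. \<exists>y. rchain Y r i j y \<and> y 0 = y0)"

lemma rchain_image:
  assumes f: "chain_map R X Y f" and r: "r \<in> carrier R" and x: "rchain X r i j x"
  shows "rchain Y r i j (\<lambda>n. f (i + n) (x n))"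
  unfolding rchain_def
proof (intro conjI allI impI)
  show "f (i + n) (x n) \<in> carrier (obj Y (i + n))" if "n \<le> j" for n
    using linmap_closed[OF cm_lin[OF f]] x that by (simp add: rchain_def)
  show "dif Y (i + n) (f (i + Suc n) (x (Suc n))) = r \<odot>\<^bsub>obj Y (i + n)\<^esub> f (i + n) (x n)" if "n < j" for n
  proof -
    have "x (Suc n) \<in> carrier (obj X (Suc (i + n)))" "x n \<in> carrier (obj X (i + n))"
      "dif X (i + n) (x (Suc n)) = r \<odot>\<^bsub>obj X (i + n)\<^esub> x n"
      using x that unfolding rchain_def by (metis Suc_leI add_Suc_right, simp_all)
    then show ?thesis using cm_comm[OF f, of "x (Suc n)" "i + n"] linmap_smult[OF cm_lin[OF f] r] by simp
  qed
qed

lemma rchain_add: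
  assumes Y: "chain_complex R Y" and r: "r \<in> carrier R" and x: "rchain Y r i j x" and y: "rchain Y r i j y"
  shows "rchain Y r i j (\<lambda>n. x n \<oplus>\<^bsub>obj Y (i + n)\<^esub> y n)"
  unfolding rchain_def
proof (intro conjI allI impI)
  fix n
  interpret Y: module R "obj Y (i + n)" by (rule cc_module[OF Y])
  show "x n \<oplus>\<^bsub>obj Y (i + n)\<^esub> y n \<in> carrier (obj Y (i + n))" if "n \<le> j"
    using x y that by (simp add: rchain_def)
  show "dif Y (i + n) (x (Suc n) \<oplus>\<^bsub>obj Y (i + Suc n)\<^esub> y (Suc n)) =
    r \<odot>\<^bsub>obj Y (i + n)\<^esub> (x n \<oplus>\<^bsub>obj Y (i + n)\<^esub> y n)" if "n < j"
  proof -
    have c: "x (Suc n) \<in> carrier (obj Y (Suc (i + n)))" "y (Suc n) \<in> carrier (obj Y (Suc (i + n)))"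
      using x y that unfolding rchain_def by (metis Suc_leI add_Suc_right)+
    show ?thesis
      using linmap_add[OF cc_lin[OF Y] c] x y r that by (simp add: rchain_def Y.smult_r_distr)
  qed
qed

lemma rchain_zero:
  assumes Y: "chain_complex R Y" and r: "r \<in> carrier R"
  shows "rchain Y r i j (\<lambda>n. \<zero>\<^bsub>obj Y (i + n)\<^esub>)"
  unfolding rchain_def
proof (intro conjI allI impI)
  fix n
  interpret Y: module R "obj Y (i + n)" by (rule cc_module[OF Y])
  show "\<zero>\<^bsub>obj Y (i + n)\<^esub> \<in> carrier (obj Y (i + n))" by simp
  show "dif Y (i + n) \<zero>\<^bsub>obj Y (i + Suc n)\<^esub> = r \<odot>\<^bsub>obj Y (i + n)\<^esub> \<zero>\<^bsub>obj Y (i + n)\<^esub>"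
    using linmap_zero[OF cc_lin[OF Y]] r by simp
qed

text \<open>A cycle of \<open>Y\<close> is the image of a cycle of \<open>X\<close> up to a
  boundary. The image is extended by transporting the extension from \<open>X\<close>, and the
  boundary is extended by hand; chains add up.\<close>

lemma extendable_weq_fwd:
  assumes f: "weq R X Y f" and r: "r \<in> carrier R" "r \<otimes>\<^bsub>R\<^esub> r = \<zero>\<^bsub>R\<^esub>" and X: "extendable X r i j"
  shows "extendable Y r i j"
  unfolding extendable_def
proof
  note cf = weq_cm[OF f]
  note Y = cm_cod[OF cf]
  fix y0 assume "y0 \<in> cycles Y i"
  then obtain x0 w where x0: "x0 \<in> cycles X i" and w: "w \<in> carrier (obj Y (Suc i))"
    and y0: "y0 = f i x0 \<oplus>\<^bsub>obj Y i\<^esub> dif Y i w" by (rule weq_surj[OF f])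
  obtain x where x: "rchain X r i j x" "x 0 = x0" using X x0 unfolding extendable_def by blast
  \<comment> \<open>The boundary of \<open>w\<close> extends by \<open>r w\<close>, whose
    differential is \<open>r\<close> times that boundary. After that zeros are enough, because
    \<open>r (r w) = 0\<close>.\<close>
  define e where "e n = (if n = 0 then dif Y i w else if n = 1 then r \<odot>\<^bsub>obj Y (Suc i)\<^esub> w
    else \<zero>\<^bsub>obj Y (i + n)\<^esub>)" for n
  have "rchain Y r i j e"
    unfolding rchain_def
  proof (intro conjI allI impI)
    fix n
    interpret Yn: module R "obj Y (i + n)" by (rule cc_module[OF Y])
    interpret Y1: module R "obj Y (Suc i)" by (rule cc_module[OF Y])
    show "e n \<in> carrier (obj Y (i + n))"
      using w r linmap_closed[OF cc_lin[OF Y] w] by (auto simp: e_def)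
    consider "n = 0" | "n = 1" | "n > 1" by linarith
    then show "dif Y (i + n) (e (Suc n)) = r \<odot>\<^bsub>obj Y (i + n)\<^esub> e n"
    proof cases
      case 2
      have "r \<odot>\<^bsub>obj Y (Suc i)\<^esub> (r \<odot>\<^bsub>obj Y (Suc i)\<^esub> w) = \<zero>\<^bsub>obj Y (Suc i)\<^esub>"
        using Y1.smult_assoc1[of r r w] r w by simp
      then show ?thesis using 2 linmap_zero[OF cc_lin[OF Y], of "Suc i"] by (simp add: e_def)
    qed (use linmap_smult[OF cc_lin[OF Y] r(1) w] linmap_zero[OF cc_lin[OF Y], of "i + n"] r in
      \<open>auto simp: e_def\<close>)
  qed
  note e = rchain_add[OF Y r(1) rchain_image[OF cf r(1) x(1)] this]
  show "\<exists>y. rchain Y r i j y \<and> y 0 = y0"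
    by (rule exI, rule conjI, rule e) (use x(2) y0 in \<open>simp add: e_def\<close>)
qed

text \<open>The extension is lifted one degree at a time; \<open>w\<close> records the homotopy between the image
  of the lift and the given extension.\<close>
lemma rchain_lift:
  assumes f: "weq R X Y f" and r: "r \<in> carrier R" "r \<otimes>\<^bsub>R\<^esub> r = \<zero>\<^bsub>R\<^esub>"
    and x0: "x0 \<in> cycles X i" and y: "rchain Y r i j y" "y 0 = f i x0"
  shows "n \<le> j \<Longrightarrow> \<exists>x w. rchain X r i n x \<and> x 0 = x0 \<and> w \<in> carrier (obj Y (Suc (i + n))) \<and>
    r \<odot>\<^bsub>obj Y (i + n)\<^esub> f (i + n) (x n) =
      r \<odot>\<^bsub>obj Y (i + n)\<^esub> y n \<oplus>\<^bsub>obj Y (i + n)\<^esub> dif Y (i + n) (r \<odot>\<^bsub>obj Y (Suc (i + n))\<^esub> w)"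
proof (induction n)
  note cf = weq_cm[OF f]
  note X = cm_dom[OF cf] and Y = cm_cod[OF cf]
  case 0
  interpret Yn: module R "obj Y i" by (rule cc_module[OF Y])
  interpret Y1: module R "obj Y (Suc i)" by (rule cc_module[OF Y])
  have "y 0 \<in> carrier (obj Y i)" using y(1) by (metis Nat.add_0_right le0 rchain_def)
  then show ?case
    using x0 y r linmap_zero[OF cc_lin[OF Y], of i]
    by (intro exI[of _ "\<lambda>_. x0"] exI[of _ "\<zero>\<^bsub>obj Y (Suc i)\<^esub>"]) (simp add: rchain_def cycles_iff)
next
  note cf = weq_cm[OF f]
  note X = cm_dom[OF cf] and Y = cm_cod[OF cf]
  case (Suc n)
  let ?m = "i + n"
  interpret X0: module R "obj X ?m" by (rule cc_module[OF X])
  interpret X1: module R "obj X (Suc ?m)" by (rule cc_module[OF X])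
  interpret Y0: module R "obj Y ?m" by (rule cc_module[OF Y])
  interpret Y1: module R "obj Y (Suc ?m)" by (rule cc_module[OF Y])
  interpret Y2: module R "obj Y (Suc (Suc ?m))" by (rule cc_module[OF Y])
  obtain x w where x: "rchain X r i n x" "x 0 = x0" and w: "w \<in> carrier (obj Y (Suc ?m))"
    and e: "r \<odot>\<^bsub>obj Y ?m\<^esub> f ?m (x n) =
      r \<odot>\<^bsub>obj Y ?m\<^esub> y n \<oplus>\<^bsub>obj Y ?m\<^esub> dif Y ?m (r \<odot>\<^bsub>obj Y (Suc ?m)\<^esub> w)"
    using Suc.IH Suc_leD[OF Suc.prems] by blast
  have yc: "y n \<in> carrier (obj Y ?m)" "y (Suc n) \<in> carrier (obj Y (Suc ?m))"
    "dif Y ?m (y (Suc n)) = r \<odot>\<^bsub>obj Y ?m\<^esub> y n"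
    using y(1) Suc.prems unfolding rchain_def by (simp, metis add_Suc_right, simp)
  have xc: "x n \<in> carrier (obj X ?m)" using x by (simp add: rchain_def)
  \<comment> \<open>By the induction hypothesis the differential of \<open>?t\<close> is the image
    of \<open>r x_n\<close>; so \<open>r x_n\<close> maps to a boundary, and hence is a boundary in
    \<open>X\<close> as soon as it is a cycle.\<close>
  let ?t = "y (Suc n) \<oplus>\<^bsub>obj Y (Suc ?m)\<^esub> r \<odot>\<^bsub>obj Y (Suc ?m)\<^esub> w"
  have t: "?t \<in> carrier (obj Y (Suc ?m))" using yc w r by simp
  \<comment> \<open>For \<open>n = 0\<close> this uses that \<open>x0\<close> is a cycle. For
    \<open>n > 0\<close> the differential of \<open>r x_n\<close> is
    \<open>r (r x_(n-1)) = 0\<close>.\<close>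
  have rx: "r \<odot>\<^bsub>obj X ?m\<^esub> x n \<in> cycles X ?m"
  proof -
    have "dif X k (r \<odot>\<^bsub>obj X ?m\<^esub> x n) = \<zero>\<^bsub>obj X k\<^esub>" if k: "?m = Suc k" for k
    proof -
      interpret Xk: module R "obj X k" by (rule cc_module[OF X])
      have 1: "dif X k (r \<odot>\<^bsub>obj X ?m\<^esub> x n) = r \<odot>\<^bsub>obj X k\<^esub> dif X k (x n)"
        using linmap_smult[OF cc_lin[OF X], of r "x n" k] r xc k by simp
      show ?thesis
      proof (cases n)
        case 0
        then show ?thesis using 1 x0 x(2) k r by (simp add: cycles_iff)
      next
        case (Suc l)
        then have "k = i + l" using k by simp
        then have "dif X k (x n) = r \<odot>\<^bsub>obj X k\<^esub> x l" "x l \<in> carrier (obj X k)"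
          using x Suc by (auto simp: rchain_def)
        then show ?thesis using 1 r Xk.smult_assoc1[of r r "x l"] by simp
      qed
    qed
    then show ?thesis using r xc by (simp add: cycles_iff)
  qed
  have "f ?m (r \<odot>\<^bsub>obj X ?m\<^esub> x n) = dif Y ?m ?t"
    using e yc w r linmap_smult[OF cm_lin[OF cf] r(1) xc]
    by (simp add: linmap_add[OF cc_lin[OF Y]])
  then have "r \<odot>\<^bsub>obj X ?m\<^esub> x n \<in> boundaries X ?m"
    using weq_inj[OF f rx] t by (auto simp: boundaries_def)
  then obtain u where u: "u \<in> carrier (obj X (Suc ?m))" "dif X ?m u = r \<odot>\<^bsub>obj X ?m\<^esub> x n"
    unfolding boundaries_def by auto
  have fu: "f (Suc ?m) u \<in> carrier (obj Y (Suc ?m))" by (rule linmap_closed[OF cm_lin[OF cf] u(1)])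
  have "dif Y ?m (f (Suc ?m) u) = dif Y ?m ?t"
    using cm_comm[OF cf u(1)] u(2) \<open>f ?m (r \<odot>\<^bsub>obj X ?m\<^esub> x n) = dif Y ?m ?t\<close> by simp
  then have "f (Suc ?m) u \<ominus>\<^bsub>obj Y (Suc ?m)\<^esub> ?t \<in> cycles Y (Suc ?m)"
    using fu t linmap_diff[OF cc_lin[OF Y] fu t] linmap_closed[OF cc_lin[OF Y] t]
    by (simp add: cycles_iff a_minus_def Y0.M.r_neg)
  then obtain c v where c: "c \<in> cycles X (Suc ?m)" and v: "v \<in> carrier (obj Y (Suc (Suc ?m)))"
    and cv: "f (Suc ?m) u \<ominus>\<^bsub>obj Y (Suc ?m)\<^esub> ?t = f (Suc ?m) c \<oplus>\<^bsub>obj Y (Suc ?m)\<^esub> dif Y (Suc ?m) v"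
    by (rule weq_surj[OF f])
  have cc: "c \<in> carrier (obj X (Suc ?m))" "dif X ?m c = \<zero>\<^bsub>obj X ?m\<^esub>"
    using c by (auto simp: cycles_iff)
  have fc: "f (Suc ?m) c \<in> carrier (obj Y (Suc ?m))" by (rule linmap_closed[OF cm_lin[OF cf] cc(1)])
  have dv: "dif Y (Suc ?m) v \<in> carrier (obj Y (Suc ?m))" by (rule linmap_closed[OF cc_lin[OF Y] v])
  \<comment> \<open>The image of \<open>u\<close> differs from \<open>?t\<close> by a cycle of
    \<open>Y\<close>, which is the image of \<open>c\<close> up to the boundary of \<open>v\<close>.
    Subtracting \<open>c\<close> leaves the differential of \<open>u\<close> unchanged and makes the
    error a boundary plus \<open>r w\<close>.\<close>
  let ?x' = "u \<ominus>\<^bsub>obj X (Suc ?m)\<^esub> c"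
  have x': "?x' \<in> carrier (obj X (Suc ?m))" "dif X ?m ?x' = r \<odot>\<^bsub>obj X ?m\<^esub> x n"
    using u cc r xc linmap_diff[OF cc_lin[OF X] u(1) cc(1)] by (simp_all add: a_minus_def)
  have "f (Suc ?m) u = (f (Suc ?m) u \<ominus>\<^bsub>obj Y (Suc ?m)\<^esub> ?t) \<oplus>\<^bsub>obj Y (Suc ?m)\<^esub> ?t"
    using fu t by (simp add: a_minus_def Y1.M.a_assoc Y1.M.l_neg)
  then have "f (Suc ?m) u = f (Suc ?m) c \<oplus>\<^bsub>obj Y (Suc ?m)\<^esub> dif Y (Suc ?m) v \<oplus>\<^bsub>obj Y (Suc ?m)\<^esub> ?t"
    unfolding cv .
  then have "f (Suc ?m) ?x' = dif Y (Suc ?m) v \<oplus>\<^bsub>obj Y (Suc ?m)\<^esub> ?t"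
    using linmap_diff[OF cm_lin[OF cf] u(1) cc(1)] add_diff_cancel_module[OF cc_module[OF Y] fc, of "dif Y (Suc ?m) v \<oplus>\<^bsub>obj Y (Suc ?m)\<^esub> ?t"] fc dv t
    by (simp add: Y1.M.a_assoc)
  \<comment> \<open>Multiplying by \<open>r\<close> kills the term \<open>r w\<close> in the error.
    For this reason the induction only controls \<open>r\<close> times the image of the lift, with
    \<open>v\<close> as the new homotopy.\<close>
  then have "r \<odot>\<^bsub>obj Y (Suc ?m)\<^esub> f (Suc ?m) ?x' = r \<odot>\<^bsub>obj Y (Suc ?m)\<^esub> y (Suc n) \<oplus>\<^bsub>obj Y (Suc ?m)\<^esub>
      dif Y (Suc ?m) (r \<odot>\<^bsub>obj Y (Suc (Suc ?m))\<^esub> v)"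
    using r yc w dv v linmap_smult[OF cc_lin[OF Y] r(1) v] Y1.smult_assoc1[of r r w, symmetric]
    by (simp add: Y1.smult_r_distr Y1.M.a_comm)
  moreover have "rchain X r i (Suc n) (x(Suc n := ?x'))"
    using x(1) x' by (auto simp: rchain_def le_Suc_eq less_Suc_eq)
  ultimately show ?case using x(2) v by (intro exI[of _ "x(Suc n := ?x')"] exI[of _ v]) (auto simp: fun_upd_def)
qed

lemma extendable_weq_bwd:
  assumes f: "weq R X Y f" and r: "r \<in> carrier R" "r \<otimes>\<^bsub>R\<^esub> r = \<zero>\<^bsub>R\<^esub>" and Y: "extendable Y r i j"
  shows "extendable X r i j"
  unfolding extendable_def
proof
  fix x0 assume x0: "x0 \<in> cycles X i"
  then obtain y where "rchain Y r i j y" "y 0 = f i x0"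
    using Y cycles_image[OF weq_cm[OF f] x0] unfolding extendable_def by blast
  then show "\<exists>x. rchain X r i j x \<and> x 0 = x0" using rchain_lift[OF f r x0] by blast
qed

text \<open>Lift the cycle to \<open>Y\<close>, extend it there, and push the extension forward.
  Only the lifting needs the exactness of \<open>X\<close> one degree below.\<close>

lemma extendable_cofib:
  assumes s: "ses R X Y Z f g" and r: "r \<in> carrier R" and Y: "extendable Y r i j"
    and X: "\<And>k. i = Suc k \<Longrightarrow> exact_at X k"
  shows "extendable Z r i j"
  unfolding extendable_def
proof
  have g: "chain_map R Y Z g" using s unfolding ses_def by blast
  fix z assume z: "z \<in> cycles Z i"
  obtain y where y: "y \<in> cycles Y i" "g i y = z" by (rule ses_lift_cycle[OF s X z])
  then obtain c where c: "rchain Y r i j c" "c 0 = y" using Y unfolding extendable_def by blast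
  show "\<exists>y. rchain Z r i j y \<and> y 0 = z"
    by (rule exI, rule conjI, rule rchain_image[OF g r c(1)]) (use c(2) y(2) in simp)
qed

lemma extendable_dsum:
  assumes ds: "is_dsum R Y K Xs \<iota>" and r: "r \<in> carrier R" and X: "\<And>k. k \<in> K \<Longrightarrow> extendable (Xs k) r i j"
  shows "extendable Y r i j"
  unfolding extendable_def
proof
  obtain \<pi> where dp: "dsum_proj R Y K Xs \<iota> \<pi>" by (rule is_dsum_dsum_proj[OF ds])
  note Y = dp_cc[OF dp]
  fix y assume "y \<in> cycles Y i"
  then have y: "y \<in> carrier (obj Y i)" and p: "\<And>k. k \<in> K \<Longrightarrow> \<pi> k i y \<in> cycles (Xs k) i"
    using cycles_image[OF dsum_proj_chain_map[OF dp]] by (auto simp: cycles_iff)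
  let ?P = "\<lambda>u. \<exists>c. rchain Y r i j c \<and> c 0 = u"
  have "?P (finsum (obj Y i) (\<lambda>k. \<iota> k i (\<pi> k i y)) {k\<in>K. \<pi> k i y \<noteq> zero (obj (Xs k) i)})"
  proof (rule finsum_induct[OF cc_module[OF Y] dp_fin[OF dp y]])
    show "\<iota> k i (\<pi> k i y) \<in> carrier (obj Y i)" if "k \<in> {k\<in>K. \<pi> k i y \<noteq> zero (obj (Xs k) i)}" for k
      using that p linmap_closed[OF cm_lin[OF dp_cm[OF dp]]] by (auto simp: cycles_iff)
    show "?P (\<iota> k i (\<pi> k i y))" if k: "k \<in> {k\<in>K. \<pi> k i y \<noteq> zero (obj (Xs k) i)}" for k
    proof -
      obtain c where c: "rchain (Xs k) r i j c" "c 0 = \<pi> k i y"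
        using X k p unfolding extendable_def by blast
      show ?thesis
        by (rule exI, rule conjI, rule rchain_image[OF dp_cm[OF dp] r c(1)]) (use c(2) k in simp_all)
    qed
    show "?P \<zero>\<^bsub>obj Y i\<^esub>"
      by (rule exI, rule conjI, rule rchain_zero[OF Y r]) simp
    show "?P (u \<oplus>\<^bsub>obj Y i\<^esub> v)" if "?P u" "?P v" for u v
    proof -
      obtain c d where c: "rchain Y r i j c" "c 0 = u" and d: "rchain Y r i j d" "d 0 = v"
        using \<open>?P u\<close> \<open>?P v\<close> by blast
      show ?thesis
        by (rule exI, rule conjI, rule rchain_add[OF Y r c(1) d(1)]) (use c(2) d(2) in simp)
    qed
  qed
  then show "?P y" using dsum_proj_expand[OF dp y] by simp
qed

lemma gg_extendable:
  assumes "gg R A Y" and r: "r \<in> carrier R" "r \<otimes>\<^bsub>R\<^esub> r = \<zero>\<^bsub>R\<^esub>"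
    and A: "\<And>n. n < i \<Longrightarrow> exact_at A n" "extendable A r i j"
  shows "extendable Y r i j"
  using assms(1)
proof (induction rule: gg.induct)
  case (base Y)
  then obtain f where "weq R A Y f" by (rule cx_iso_weqE)
  then show ?case by (rule extendable_weq_fwd[OF _ r A(2)])
next
  case (dsum K Xs Y \<iota>)
  show ?case by (rule extendable_dsum[OF dsum(2) r(1)]) (use dsum(1) in blast)
next
  case (weq_fwd X Y f)
  show ?case by (rule extendable_weq_fwd[OF weq_fwd(2) r weq_fwd(3)])
next
  case (weq_bwd Y X f)
  show ?case by (rule extendable_weq_bwd[OF weq_bwd(2) r weq_bwd(3)])
next
  case (cofib X Y Z f g)
  show ?case
  proof (rule extendable_cofib[OF cofib.hyps(3) r(1) cofib.IH(2)])
    show "exact_at X k" if "i = Suc k" for k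
      using gg_exact_below[OF cofib.hyps(1), of i k] A(1) that by auto
  qed
qed

section \<open>Complexes in other types\<close>

definition transport_mod :: "('c \<Rightarrow> 'a) \<Rightarrow> ('r,'c) module \<Rightarrow> ('r,'a) module" where
  "transport_mod e M = \<lparr>carrier = e ` carrier M, mult = undefined, one = undefined, zero = e \<zero>\<^bsub>M\<^esub>,
     add = (\<lambda>x y. e (inv_into (carrier M) e x \<oplus>\<^bsub>M\<^esub> inv_into (carrier M) e y)),
     smult = (\<lambda>a x. e (a \<odot>\<^bsub>M\<^esub> inv_into (carrier M) e x))\<rparr>"

definition prod_mod :: "('k \<Rightarrow> ('r,'c) module) \<Rightarrow> ('r,'k \<Rightarrow> 'c) module" where
  "prod_mod Ms = \<lparr>carrier = {x. \<forall>k. x k \<in> carrier (Ms k)}, mult = undefined, one = undefined,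
     zero = (\<lambda>k. \<zero>\<^bsub>Ms k\<^esub>), add = (\<lambda>x y k. x k \<oplus>\<^bsub>Ms k\<^esub> y k), smult = (\<lambda>a x k. a \<odot>\<^bsub>Ms k\<^esub> x k)\<rparr>"

lemma prod_mod_simps [simp]:
  "x \<in> carrier (prod_mod Ms) \<longleftrightarrow> (\<forall>k. x k \<in> carrier (Ms k))"
  "\<zero>\<^bsub>prod_mod Ms\<^esub> = (\<lambda>k. \<zero>\<^bsub>Ms k\<^esub>)"
  "x \<oplus>\<^bsub>prod_mod Ms\<^esub> y = (\<lambda>k. x k \<oplus>\<^bsub>Ms k\<^esub> y k)"
  "a \<odot>\<^bsub>prod_mod Ms\<^esub> x = (\<lambda>k. a \<odot>\<^bsub>Ms k\<^esub> x k)"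
  by (simp_all add: prod_mod_def)

lemma module_transport_mod:
  assumes M: "module R M" and e: "inj_on e (carrier M)"
  shows "module R (transport_mod e M)" and "linmap R M (transport_mod e M) e"
proof -
  interpret M: module R M by (rule M)
  note [simp] = inv_into_f_f[OF e] and [simp] = transport_mod_def
  have "abelian_group (transport_mod e M)"
  proof (rule abelian_groupI)
    fix x assume "x \<in> carrier (transport_mod e M)"
    then obtain u where "u \<in> carrier M" "x = e u" by auto
    then show "\<exists>y\<in>carrier (transport_mod e M). y \<oplus>\<^bsub>transport_mod e M\<^esub> x = \<zero>\<^bsub>transport_mod e M\<^esub>"
      by (intro bexI[of _ "e (\<ominus>\<^bsub>M\<^esub> u)"]) (simp_all add: M.M.l_neg)
  qed (auto simp: M.M.a_ac)
  then show T: "module R (transport_mod e M)"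
    by (intro moduleI M.R.is_cring) (auto simp: M.smult_l_distr M.smult_r_distr M.smult_assoc1)
  show "linmap R M (transport_mod e M) e" by (rule linmapI[OF M T]) auto
qed

lemma module_prod_mod:
  assumes M: "\<And>k. module R (Ms k)"
  shows "module R (prod_mod Ms)"
proof -
  have R: "cring R" using M unfolding module_def by blast
  have ag: "abelian_group (Ms k)" for k using M unfolding module_def by blast
  have am: "abelian_monoid (Ms k)" for k using ag unfolding abelian_group_def by blast
  show ?thesis
  proof (rule moduleI[OF R])
    show "abelian_group (prod_mod Ms)"
    proof (rule abelian_groupI)
      fix x assume x: "x \<in> carrier (prod_mod Ms)"
      show "\<exists>y\<in>carrier (prod_mod Ms). y \<oplus>\<^bsub>prod_mod Ms\<^esub> x = \<zero>\<^bsub>prod_mod Ms\<^esub>"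
        by (rule bexI[of _ "\<lambda>k. \<ominus>\<^bsub>Ms k\<^esub> x k"])
          (use x in \<open>auto simp: abelian_group.l_neg[OF ag] abelian_group.a_inv_closed[OF ag]\<close>)
    qed (auto simp: abelian_monoid.a_closed[OF am] abelian_monoid.zero_closed[OF am]
        abelian_monoid.a_assoc[OF am] abelian_monoid.a_comm[OF am] abelian_monoid.a_lcomm[OF am]
        abelian_monoid.l_zero[OF am] abelian_monoid.r_zero[OF am])
  qed (auto simp: module.smult_closed[OF M] module.smult_l_distr[OF M] module.smult_r_distr[OF M]
      module.smult_assoc1[OF M] module.smult_one[OF M])
qed

lemma submoduleI':
  assumes M: "module R M" and H: "H \<subseteq> carrier M" "\<zero>\<^bsub>M\<^esub> \<in> H"
    "\<And>x y. x \<in> H \<Longrightarrow> y \<in> H \<Longrightarrow> x \<oplus>\<^bsub>M\<^esub> y \<in> H"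
    "\<And>a x. a \<in> carrier R \<Longrightarrow> x \<in> H \<Longrightarrow> a \<odot>\<^bsub>M\<^esub> x \<in> H"
  shows "submodule H R M"
proof -
  interpret M: module R M by (rule M)
  show ?thesis
  proof (rule M.submoduleI)
    fix x assume x: "x \<in> H"
    then have "\<ominus>\<^bsub>M\<^esub> x = (\<ominus>\<^bsub>R\<^esub> \<one>\<^bsub>R\<^esub>) \<odot>\<^bsub>M\<^esub> x" using H(1) M.smult_l_minus[of "\<one>\<^bsub>R\<^esub>" x] by auto
    then show "\<ominus>\<^bsub>M\<^esub> x \<in> H" using H(4)[of "\<ominus>\<^bsub>R\<^esub> \<one>\<^bsub>R\<^esub>" x] x by simp
  qed (use H in auto)
qed

lemma submodule_restrict:
  assumes "module R M" "submodule H R M" shows "module R (M\<lparr>carrier := H\<rparr>)"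
  using submodule.submodule_is_module[OF assms(2,1)] .

lemma submodule_subset: "submodule H R M \<Longrightarrow> H \<subseteq> carrier M"
  using submodule.axioms(1) subgroup.subset by fastforce

definition sub_cx :: "('r,'a) cx \<Rightarrow> (nat \<Rightarrow> 'a set) \<Rightarrow> ('r,'a) cx" where
  "sub_cx X H = \<lparr>obj = (\<lambda>n. (obj X n)\<lparr>carrier := H n\<rparr>), dif = dif X\<rparr>"

lemma sub_cx_simps [simp]:
  "carrier (obj (sub_cx X H) n) = H n" "dif (sub_cx X H) = dif X"
  "\<zero>\<^bsub>obj (sub_cx X H) n\<^esub> = \<zero>\<^bsub>obj X n\<^esub>" "x \<oplus>\<^bsub>obj (sub_cx X H) n\<^esub> y = x \<oplus>\<^bsub>obj X n\<^esub> y"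
  "a \<odot>\<^bsub>obj (sub_cx X H) n\<^esub> x = a \<odot>\<^bsub>obj X n\<^esub> x"
  by (simp_all add: sub_cx_def)

lemma chain_complex_sub_cx:
  assumes X: "chain_complex R X" and H: "\<And>n. submodule (H n) R (obj X n)"
    and d: "\<And>n x. x \<in> H (Suc n) \<Longrightarrow> dif X n x \<in> H n"
  shows "chain_complex R (sub_cx X H)" and "chain_map R (sub_cx X H) X (\<lambda>n x. x)"
proof -
  have M: "module R (obj (sub_cx X H) n)" for n
    using submodule_restrict[OF cc_module[OF X] H] by (simp add: sub_cx_def)
  note sub = submodule_subset[OF H, THEN subsetD]
  show cc: "chain_complex R (sub_cx X H)"
    unfolding chain_complex_def
  proof (intro conjI allI ballI M)
    show "linmap R (obj (sub_cx X H) (Suc n)) (obj (sub_cx X H) n) (dif (sub_cx X H) n)" for n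
      by (rule linmapI[OF M M]) (auto simp: d sub linmap_add[OF cc_lin[OF X]] linmap_smult[OF cc_lin[OF X]])
  qed (simp add: cc_dd[OF X] sub)
  show "chain_map R (sub_cx X H) X (\<lambda>n x. x)"
    by (intro chain_mapI cc X linmapI M cc_module[OF X]) (auto simp: sub)
qed

text \<open>Injectivity is demanded on the carriers only: the type of sequences over
  \<open>'c\<close> is in general too large for \<open>'a\<close>, whereas the sequences that occur
  in the carriers fit. One map serves all degrees, so a copy needs no choice per degree.\<close>

definition embeds :: "'a itself \<Rightarrow> ('r,'c) cx \<Rightarrow> bool" where
  "embeds T Z \<longleftrightarrow> (\<exists>e :: 'c \<Rightarrow> 'a. \<forall>n. inj_on e (carrier (obj Z n)))"

lemma embedsI: "(\<And>n. inj_on (e :: 'c \<Rightarrow> 'a) (carrier (obj (Z :: ('r,'c) cx) n))) \<Longrightarrow> embeds TYPE('a) Z"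
  unfolding embeds_def by blast

lemma embeds_copy:
  fixes Z :: "('r,'c) cx"
  assumes Z: "chain_complex R Z" and "embeds TYPE('a) Z"
  obtains Y :: "('r,'a) cx" where "cx_iso R Z Y"
proof -
  obtain e :: "'c \<Rightarrow> 'a" where e: "\<And>n. inj_on e (carrier (obj Z n))"
    using assms(2) unfolding embeds_def by blast
  note T = module_transport_mod[OF cc_module[OF Z] e]
  define Y where "Y = \<lparr>obj = (\<lambda>n. transport_mod e (obj Z n)),
    dif = (\<lambda>n y. e (dif Z n (inv_into (carrier (obj Z (Suc n))) e y)))\<rparr>"
  have carr: "carrier (transport_mod e (obj Z n)) = e ` carrier (obj Z n)" for n
    by (simp add: transport_mod_def)
  have b: "bij_betw e (carrier (obj Z n)) (carrier (obj Y n))" for n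
    using e by (simp add: Y_def carr bij_betw_def)
  have lin: "linmap R (obj Z n) (obj Y n) e" for n using T(2) by (simp add: Y_def)
  have d: "linmap R (obj Y (Suc n)) (obj Y n) (dif Y n)" for n
    using linmap_comp[OF linmap_comp[OF linmap_inv_into[OF lin b] cc_lin[OF Z]] lin, of n] by (simp add: Y_def)
  have dd: "dif Y n (e x) = e (dif Z n x)" if "x \<in> carrier (obj Z (Suc n))" for x n
    using that by (simp add: Y_def inv_into_f_f[OF e])
  have Y: "chain_complex R Y"
    unfolding chain_complex_def
  proof (intro conjI allI ballI d)
    show "module R (obj Y n)" for n using T(1) by (simp add: Y_def)
    fix n y assume "y \<in> carrier (obj Y (Suc (Suc n)))"
    then obtain x where x: "x \<in> carrier (obj Z (Suc (Suc n)))" "y = e x" by (auto simp: Y_def carr)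
    then show "dif Y n (dif Y (Suc n) y) = \<zero>\<^bsub>obj Y n\<^esub>"
      using linmap_closed[OF cc_lin[OF Z] x(1)] linmap_zero[OF lin, of n]
      by (simp add: dd cc_dd[OF Z])
  qed
  have "chain_map R Z Y (\<lambda>n. e)"
    by (rule chain_mapI[OF Z Y lin]) (simp add: dd)
  then show ?thesis using that cx_isoI b by blast
qed

text \<open>The class of \<open>A\<close> only contains complexes with elements in \<open>'a\<close>; constructions such as powers
  live in other types and are compared with it up to isomorphism.\<close>
definition in_class :: "'r ring \<Rightarrow> ('r,'b) cx \<Rightarrow> 'a itself \<Rightarrow> ('r,'c) cx \<Rightarrow> bool" where
  "in_class R A T Z \<longleftrightarrow> (\<exists>Y :: ('r,'a) cx. cx_iso R Z Y \<and> gg R A Y)"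

lemma in_classE:
  fixes R :: "'r ring"
  assumes "in_class R A TYPE('a) Z"
  obtains Y :: "('r,'a) cx" where "cx_iso R Z Y" "gg R A Y"
  using assms unfolding in_class_def by blast

text \<open>Membership is independent of the copy, since two copies are isomorphic and isomorphisms
  are weak equivalences.\<close>

lemma in_class_gg:
  fixes Y :: "('r,'a) cx"
  assumes "in_class R A TYPE('a) Z" "cx_iso R Z Y"
  shows "gg R A Y"
proof -
  obtain Y' :: "('r,'a) cx" where "cx_iso R Z Y'" "gg R A Y'" by (rule in_classE[OF assms(1)])
  then show ?thesis
    using assms(2) by (meson cx_iso_sym cx_iso_trans cx_iso_weqE gg.weq_fwd)
qed

lemma in_class_self:
  assumes "gg R A (Y :: ('r,'a) cx)" shows "in_class R A TYPE('a) Y"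
  unfolding in_class_def using assms cx_iso_refl gg_chain_complex by blast

lemma in_class_iso: "in_class R A T Z \<Longrightarrow> cx_iso R Z' Z \<Longrightarrow> in_class R A T Z'"
  unfolding in_class_def using cx_iso_trans by blast

lemma in_class_base:
  assumes "chain_complex R A" "embeds TYPE('a) A" shows "in_class R A TYPE('a) A"
  using embeds_copy[OF assms] gg.base unfolding in_class_def by metis

lemma in_class_weq_fwd:
  fixes R :: "'r ring"
  assumes Z: "in_class R A TYPE('a) Z" and f: "weq R Z Z' f" and Z': "embeds TYPE('a) Z'"
  shows "in_class R A TYPE('a) Z'"
proof -
  obtain Y :: "('r,'a) cx" where Y: "cx_iso R Z Y" "gg R A Y" by (rule in_classE[OF Z])
  obtain Y' :: "('r,'a) cx" where Y': "cx_iso R Z' Y'"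
    by (rule embeds_copy[OF cm_cod[OF weq_cm[OF f]] Z'])
  obtain p where p: "weq R Y Z p" using cx_iso_weqE cx_iso_sym Y(1) by metis
  obtain q where q: "weq R Z' Y' q" using cx_iso_weqE Y' by metis
  show ?thesis
    using gg.weq_fwd[OF Y(2) weq_trans[OF weq_trans[OF p f] q]] Y' unfolding in_class_def by blast
qed

text \<open>Unlike in \<open>ses\<close>, the three complexes may have elements in different types.
  The sequence is conjugated by isomorphisms to copies in \<open>'a\<close>.\<close>

lemma in_class_cofib:
  fixes R :: "'r ring"
  assumes X: "in_class R A TYPE('a) X" and Y: "in_class R A TYPE('a) Y" and Z: "embeds TYPE('a) Z"
    and f: "chain_map R X Y f" and g: "chain_map R Y Z g"
    and inj: "\<And>n. inj_on (f n) (carrier (obj X n))"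
    and sur: "\<And>n z. z \<in> carrier (obj Z n) \<Longrightarrow> \<exists>y\<in>carrier (obj Y n). g n y = z"
    and gf: "\<And>n x. x \<in> carrier (obj X n) \<Longrightarrow> g n (f n x) = \<zero>\<^bsub>obj Z n\<^esub>"
    and ker: "\<And>n y. y \<in> carrier (obj Y n) \<Longrightarrow> g n y = \<zero>\<^bsub>obj Z n\<^esub> \<Longrightarrow> \<exists>x\<in>carrier (obj X n). f n x = y"
  shows "in_class R A TYPE('a) Z"
proof -
  obtain X' :: "('r,'a) cx" where X': "cx_iso R X X'" "gg R A X'" by (rule in_classE[OF X])
  obtain Y' :: "('r,'a) cx" where Y': "cx_iso R Y Y'" "gg R A Y'" by (rule in_classE[OF Y])
  obtain Z' :: "('r,'a) cx" where Z': "cx_iso R Z Z'" by (rule embeds_copy[OF cm_cod[OF g] Z])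
  obtain p q where p: "chain_map R X X' p" and q: "chain_map R X' X q"
    and qp: "\<And>n x. x \<in> carrier (obj X n) \<Longrightarrow> q n (p n x) = x"
    and pq: "\<And>n x. x \<in> carrier (obj X' n) \<Longrightarrow> p n (q n x) = x" by (rule cx_isoE[OF X'(1)]) blast
  obtain s t where s: "chain_map R Y Y' s" and t: "chain_map R Y' Y t"
    and ts: "\<And>n x. x \<in> carrier (obj Y n) \<Longrightarrow> t n (s n x) = x"
    and st: "\<And>n x. x \<in> carrier (obj Y' n) \<Longrightarrow> s n (t n x) = x" by (rule cx_isoE[OF Y'(1)]) blast
  obtain u v where u: "chain_map R Z Z' u" and v: "chain_map R Z' Z v"
    and vu: "\<And>n x. x \<in> carrier (obj Z n) \<Longrightarrow> v n (u n x) = x"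
    and uv: "\<And>n x. x \<in> carrier (obj Z' n) \<Longrightarrow> u n (v n x) = x" by (rule cx_isoE[OF Z']) blast
  note cl = linmap_closed[OF cm_lin[OF f]] linmap_closed[OF cm_lin[OF g]] linmap_closed[OF cm_lin[OF p]]
    linmap_closed[OF cm_lin[OF q]] linmap_closed[OF cm_lin[OF s]] linmap_closed[OF cm_lin[OF t]]
    linmap_closed[OF cm_lin[OF u]] linmap_closed[OF cm_lin[OF v]]
  have "ses R X' Y' Z' (\<lambda>n x. s n (f n (q n x))) (\<lambda>n y. u n (g n (t n y)))"
    unfolding ses_def
  proof (intro conjI allI)
    show "chain_map R X' Y' (\<lambda>n x. s n (f n (q n x)))"
      by (rule chain_map_comp[OF chain_map_comp[OF q f] s])
    show "chain_map R Y' Z' (\<lambda>n y. u n (g n (t n y)))"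
      by (rule chain_map_comp[OF chain_map_comp[OF t g] u])
    fix n
    show "inj_on (\<lambda>x. s n (f n (q n x))) (carrier (obj X' n))"
    proof (rule inj_onI)
      fix x y assume xy: "x \<in> carrier (obj X' n)" "y \<in> carrier (obj X' n)" "s n (f n (q n x)) = s n (f n (q n y))"
      then have "f n (q n x) = f n (q n y)" by (metis cl(1,4) ts)
      then have "q n x = q n y" using inj[of n] xy cl(4) by (meson inj_onD)
      then show "x = y" using xy pq by metis
    qed
    show "(\<lambda>y. u n (g n (t n y))) ` carrier (obj Y' n) = carrier (obj Z' n)"
    proof (intro equalityI subsetI)
      fix z assume z: "z \<in> carrier (obj Z' n)"
      then obtain y where "y \<in> carrier (obj Y n)" "g n y = v n z" using sur cl(8) by blast
      then show "z \<in> (\<lambda>y. u n (g n (t n y))) ` carrier (obj Y' n)"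
        using z by (intro image_eqI[of _ _ "s n y"]) (simp_all add: cl ts uv)
    qed (auto simp: cl)
    have u0: "u n \<zero>\<^bsub>obj Z n\<^esub> = \<zero>\<^bsub>obj Z' n\<^esub>" "v n \<zero>\<^bsub>obj Z' n\<^esub> = \<zero>\<^bsub>obj Z n\<^esub>"
      using linmap_zero[OF cm_lin[OF u]] linmap_zero[OF cm_lin[OF v]] by auto
    show "(\<lambda>x. s n (f n (q n x))) ` carrier (obj X' n) =
      {y \<in> carrier (obj Y' n). u n (g n (t n y)) = \<zero>\<^bsub>obj Z' n\<^esub>}"
    proof (intro equalityI subsetI)
      fix y assume y: "y \<in> {y \<in> carrier (obj Y' n). u n (g n (t n y)) = \<zero>\<^bsub>obj Z' n\<^esub>}"
      then have "g n (t n y) = \<zero>\<^bsub>obj Z n\<^esub>" using u0(2) vu cl(2,6) by (metis (mono_tags, lifting) mem_Collect_eq)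
      then obtain x where "x \<in> carrier (obj X n)" "f n x = t n y" using ker y cl(6) by blast
      then show "y \<in> (\<lambda>x. s n (f n (q n x))) ` carrier (obj X' n)"
        using y by (intro image_eqI[of _ _ "p n x"]) (simp_all add: cl qp st)
    qed (auto simp: cl ts gf u0)
  qed
  then have "gg R A Z'" by (rule gg.cofib[OF X'(2) Y'(2)])
  then show ?thesis using Z' unfolding in_class_def by blast
qed

lemma dsum_proj_transfer:
  assumes dp: "dsum_proj R Y K Xs \<iota> \<pi>"
    and F: "chain_map R Y Y' F" and G: "chain_map R Y' Y G"
    and GF: "\<And>n x. x \<in> carrier (obj Y n) \<Longrightarrow> G n (F n x) = x"
    and FG: "\<And>n x. x \<in> carrier (obj Y' n) \<Longrightarrow> F n (G n x) = x"
    and p: "\<And>k. k \<in> K \<Longrightarrow> chain_map R (Xs k) (Xs' k) (p k)" and q: "\<And>k. k \<in> K \<Longrightarrow> chain_map R (Xs' k) (Xs k) (q k)"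
    and qp: "\<And>k n x. k \<in> K \<Longrightarrow> x \<in> carrier (obj (Xs k) n) \<Longrightarrow> q k n (p k n x) = x"
    and pq: "\<And>k n x. k \<in> K \<Longrightarrow> x \<in> carrier (obj (Xs' k) n) \<Longrightarrow> p k n (q k n x) = x"
  shows "dsum_proj R Y' K Xs' (\<lambda>k n x. F n (\<iota> k n (q k n x))) (\<lambda>k n y. p k n (\<pi> k n (G n y)))"
proof -
  note cl = linmap_closed[OF cm_lin[OF F]] linmap_closed[OF cm_lin[OF G]] linmap_closed[OF cm_lin[OF p]]
    linmap_closed[OF cm_lin[OF q]] linmap_closed[OF cm_lin[OF dp_cm[OF dp]]] linmap_closed[OF dp_lin[OF dp]]
  have p0: "p k n x = \<zero>\<^bsub>obj (Xs' k) n\<^esub> \<longleftrightarrow> x = \<zero>\<^bsub>obj (Xs k) n\<^esub>"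
    if "k \<in> K" "x \<in> carrier (obj (Xs k) n)" for k n x
    using linmap_zero[OF cm_lin[OF p[OF that(1)]]] linmap_zero[OF cm_lin[OF q[OF that(1)]]] qp[OF that] by metis
  show ?thesis
    unfolding dsum_proj_def
  proof (intro conjI ballI allI impI)
    show "chain_complex R Y'" by (rule cm_cod[OF F])
    show "chain_map R (Xs' k) Y' (\<lambda>n x. F n (\<iota> k n (q k n x)))" if "k \<in> K" for k
      by (rule chain_map_comp[OF chain_map_comp[OF q dp_cm[OF dp]] F]) (use that in auto)
    show "linmap R (obj Y' n) (obj (Xs' k) n) (\<lambda>y. p k n (\<pi> k n (G n y)))" if "k \<in> K" for k n
      by (rule linmap_comp[OF linmap_comp[OF cm_lin[OF G] dp_lin[OF dp]] cm_lin[OF p]]) (use that in auto)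
    show "p k n (\<pi> k n (G n (F n (\<iota> k n (q k n x))))) = x" if "k \<in> K" "x \<in> carrier (obj (Xs' k) n)" for k n x
      using that by (simp add: cl GF dp_same[OF dp] pq)
    show "p l n (\<pi> l n (G n (F n (\<iota> k n (q k n x))))) = \<zero>\<^bsub>obj (Xs' l) n\<^esub>"
      if "k \<in> K" "l \<in> K" "k \<noteq> l" "x \<in> carrier (obj (Xs' k) n)" for k l n x
      using that by (simp add: cl GF dp_diff[OF dp] linmap_zero[OF cm_lin[OF p]])
    fix n y assume y: "y \<in> carrier (obj Y' n)"
    have eq: "p k n (\<pi> k n (G n y)) = \<zero>\<^bsub>obj (Xs' k) n\<^esub> \<longleftrightarrow> \<pi> k n (G n y) = \<zero>\<^bsub>obj (Xs k) n\<^esub>" if "k \<in> K" for k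
      using p0[OF that] cl(6)[OF that] cl(2)[OF y] by blast
    show "finite {k \<in> K. p k n (\<pi> k n (G n y)) \<noteq> \<zero>\<^bsub>obj (Xs' k) n\<^esub>}"
      by (rule finite_subset[OF _ dp_fin[OF dp cl(2)[OF y]]]) (use eq in auto)
    show "y = \<zero>\<^bsub>obj Y' n\<^esub>" if "\<forall>k\<in>K. p k n (\<pi> k n (G n y)) = \<zero>\<^bsub>obj (Xs' k) n\<^esub>"
      using dp_inj[OF dp cl(2)[OF y]] that eq FG[OF y] linmap_zero[OF cm_lin[OF F]] by metis
  qed
qed

text \<open>The closure rule for direct sums takes index sets in \<open>'a\<close>, so a family
  indexed by another type is first moved there along an injection.\<close>

lemma dsum_proj_reindex:
  assumes dp: "dsum_proj R Y K Xs \<iota> \<pi>" and \<nu>: "inj_on \<nu> K"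
  shows "dsum_proj R Y (\<nu> ` K) (\<lambda>a. Xs (inv_into K \<nu> a)) (\<lambda>a. \<iota> (inv_into K \<nu> a)) (\<lambda>a. \<pi> (inv_into K \<nu> a))"
  unfolding dsum_proj_def
proof (intro conjI ballI allI impI)
  note [simp] = inv_into_f_f[OF \<nu>]
  show "chain_complex R Y" by (rule dp_cc[OF dp])
  fix n y assume y: "y \<in> carrier (obj Y n)"
  have "{a \<in> \<nu> ` K. \<pi> (inv_into K \<nu> a) n y \<noteq> \<zero>\<^bsub>obj (Xs (inv_into K \<nu> a)) n\<^esub>} =
    \<nu> ` {k \<in> K. \<pi> k n y \<noteq> \<zero>\<^bsub>obj (Xs k) n\<^esub>}" by auto
  then show "finite {a \<in> \<nu> ` K. \<pi> (inv_into K \<nu> a) n y \<noteq> \<zero>\<^bsub>obj (Xs (inv_into K \<nu> a)) n\<^esub>}"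
    using dp_fin[OF dp y] by simp
  show "y = \<zero>\<^bsub>obj Y n\<^esub>" if "\<forall>a\<in>\<nu> ` K. \<pi> (inv_into K \<nu> a) n y = \<zero>\<^bsub>obj (Xs (inv_into K \<nu> a)) n\<^esub>"
    using dp_inj[OF dp y] that by auto
next
  fix a b n x
  assume ab: "a \<in> \<nu> ` K" "b \<in> \<nu> ` K" "a \<noteq> b" and x: "x \<in> carrier (obj (Xs (inv_into K \<nu> a)) n)"
  show "\<pi> (inv_into K \<nu> b) n (\<iota> (inv_into K \<nu> a) n x) = \<zero>\<^bsub>obj (Xs (inv_into K \<nu> b)) n\<^esub>"
    by (rule dp_diff[OF dp _ _ _ x]) (use ab inv_into_f_f[OF \<nu>] in auto)
qed (use inv_into_f_f[OF \<nu>] in \<open>auto simp: dp_cm[OF dp] dp_lin[OF dp] dp_same[OF dp]\<close>)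

lemma in_class_dsum:
  fixes Xs :: "'k \<Rightarrow> ('r,'c) cx" and \<nu> :: "'k \<Rightarrow> 'a"
  assumes dp: "dsum_proj R Y K Xs \<iota> \<pi>" and X: "\<And>k. k \<in> K \<Longrightarrow> in_class R A TYPE('a) (Xs k)"
    and Y: "embeds TYPE('a) Y" and \<nu>: "inj_on \<nu> K"
  shows "in_class R A TYPE('a) Y"
proof -
  obtain Y' :: "('r,'a) cx" where Y': "cx_iso R Y Y'" by (rule embeds_copy[OF dp_cc[OF dp] Y])
  obtain F G where FG: "chain_map R Y Y' F" "chain_map R Y' Y G"
    "\<And>n x. x \<in> carrier (obj Y n) \<Longrightarrow> G n (F n x) = x"
    "\<And>n x. x \<in> carrier (obj Y' n) \<Longrightarrow> F n (G n x) = x" by (rule cx_isoE[OF Y']) blast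
  obtain Xs' :: "'k \<Rightarrow> ('r,'a) cx" where Xs': "\<And>k. k \<in> K \<Longrightarrow> cx_iso R (Xs k) (Xs' k)"
    "\<And>k. k \<in> K \<Longrightarrow> gg R A (Xs' k)" using X unfolding in_class_def by metis
  have "\<forall>k\<in>K. \<exists>p q. chain_map R (Xs k) (Xs' k) p \<and> chain_map R (Xs' k) (Xs k) q \<and>
    (\<forall>n. \<forall>x\<in>carrier (obj (Xs k) n). q n (p n x) = x) \<and> (\<forall>n. \<forall>x\<in>carrier (obj (Xs' k) n). p n (q n x) = x)"
  proof
    fix k assume "k \<in> K"
    from cx_isoE[OF Xs'(1)[OF this]] show "\<exists>p q. chain_map R (Xs k) (Xs' k) p \<and> chain_map R (Xs' k) (Xs k) q \<and>
      (\<forall>n. \<forall>x\<in>carrier (obj (Xs k) n). q n (p n x) = x) \<and>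
      (\<forall>n. \<forall>x\<in>carrier (obj (Xs' k) n). p n (q n x) = x)" by metis
  qed
  then obtain p q where pq: "\<And>k. k \<in> K \<Longrightarrow> chain_map R (Xs k) (Xs' k) (p k)"
    "\<And>k. k \<in> K \<Longrightarrow> chain_map R (Xs' k) (Xs k) (q k)"
    "\<And>k n x. k \<in> K \<Longrightarrow> x \<in> carrier (obj (Xs k) n) \<Longrightarrow> q k n (p k n x) = x"
    "\<And>k n x. k \<in> K \<Longrightarrow> x \<in> carrier (obj (Xs' k) n) \<Longrightarrow> p k n (q k n x) = x"
    unfolding bchoice_iff by metis
  have "gg R A Y'"
    by (rule gg.dsum[OF _ dsum_proj_is_dsum[OF dsum_proj_reindex[OF dsum_proj_transfer[OF dp FG pq] \<nu>]]])
      (use Xs'(2) inv_into_f_f[OF \<nu>] in auto)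
  then show ?thesis using Y' unfolding in_class_def by blast
qed

text \<open>The zero complex is an empty direct sum and hence in every class; its inclusion into an
  exact complex is a weak equivalence.\<close>

lemma in_class_exact:
  fixes Z :: "('r,'c) cx"
  assumes Z: "chain_complex R Z" and ex: "\<And>n. exact_at Z n" and e: "embeds TYPE('a) Z"
  shows "in_class R A TYPE('a) Z"
proof -
  let ?O = "sub_cx Z (\<lambda>n. {\<zero>\<^bsub>obj Z n\<^esub>})"
  have M: "submodule {\<zero>\<^bsub>obj Z n\<^esub>} R (obj Z n)" for n
  proof -
    interpret M: module R "obj Z n" by (rule cc_module[OF Z])
    show ?thesis by (rule submoduleI'[OF cc_module[OF Z]]) auto
  qed
  note O = chain_complex_sub_cx[OF Z M]
  have O0: "chain_complex R ?O" and i: "chain_map R ?O Z (\<lambda>n x. x)"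
    by (rule O, simp add: linmap_zero[OF cc_lin[OF Z]])+
  \<comment> \<open>With no coordinates, joint injectivity says that every element is zero. The
    carriers are singletons, so even a constant map embeds them.\<close>
  have "dsum_proj R ?O ({} :: 'a set) (\<lambda>_. ?O) (\<lambda>_ _ x. x) (\<lambda>_ _ x. x)"
    unfolding dsum_proj_def using O0 by auto
  then have "in_class R A TYPE('a) ?O"
    by (rule in_class_dsum) (auto intro: embedsI[of "\<lambda>_. undefined"])
  moreover have "weq R ?O Z (\<lambda>n x. x)"
  proof (rule weqI[OF i])
    fix n
    interpret M: module R "obj Z n" by (rule cc_module[OF Z])
    show "\<exists>x\<in>cycles ?O n. \<exists>w\<in>carrier (obj Z (Suc n)). y = x \<oplus>\<^bsub>obj Z n\<^esub> dif Z n w"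
      if y: "y \<in> cycles Z n" for y
    proof -
      obtain w where "w \<in> carrier (obj Z (Suc n))" "y = dif Z n w" by (rule exact_atE[OF ex y])
      then show ?thesis
        using cycles_zero[OF O0, of n] linmap_closed[OF cc_lin[OF Z]]
        by (intro bexI[of _ "\<zero>\<^bsub>obj Z n\<^esub>"] bexI[of _ w]) simp_all
    qed
    show "x \<in> boundaries ?O n" if "x \<in> cycles ?O n" for x
      using that boundaries_zero[OF O0, of n] by (auto simp: cycles_iff)
  qed
  ultimately show ?thesis by (rule in_class_weq_fwd[OF _ _ e])
qed

lemma gg_of_acyclic:
  fixes Y :: "('r,'a) cx"
  assumes "acyclic R Y" shows "gg R A Y"
proof (rule in_class_gg)
  show "in_class R A TYPE('a) Y"
    using assms by (intro in_class_exact embedsI[of "\<lambda>x. x"]) (auto simp: acyclic_iff)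
  show "cx_iso R Y Y" using assms cx_iso_refl unfolding acyclic_iff by blast
qed

section \<open>Extensions, unions and retracts\<close>

lemma infinite_pairing:
  assumes "infinite (UNIV :: 'a set)"
  obtains p :: "'a \<times> 'a \<Rightarrow> 'a" where "inj p"
  using card_of_Times_same_infinite[OF assms] unfolding card_of_ordIso[symmetric] bij_betw_def
  by (auto simp: inj_on_def)

lemma infinite_nat_inj:
  assumes "infinite (UNIV :: 'a set)"
  obtains \<nu> :: "nat \<Rightarrow> 'a" where "inj \<nu>"
  using infinite_countable_subset[OF assms] by blast

definition eventually_const :: "(nat \<Rightarrow> 'c) \<Rightarrow> bool" where
  "eventually_const x \<longleftrightarrow> (\<exists>N. \<forall>k\<ge>N. x k = x N)"

text \<open>Such a sequence is determined by the index where it stabilises and by finitely many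
  values, and iterated pairing packs these into one element of \<open>'a\<close>.\<close>

lemma eventually_const_inj:
  assumes inf: "infinite (UNIV :: 'a set)" and e: "inj (e :: 'c \<Rightarrow> 'a)"
  obtains h :: "(nat \<Rightarrow> 'c) \<Rightarrow> 'a" where "inj_on h {x. eventually_const x}"
proof -
  obtain p :: "'a \<times> 'a \<Rightarrow> 'a" where p: "inj p" by (rule infinite_pairing[OF inf])
  obtain \<nu> :: "nat \<Rightarrow> 'a" where \<nu>: "inj \<nu>" by (rule infinite_nat_inj[OF inf])
  define N where "N x = (LEAST N. \<forall>k\<ge>N. x k = x N)" for x :: "nat \<Rightarrow> 'c"
  have N: "x k = x (N x)" if "eventually_const x" "k \<ge> N x" for x k
    using that LeastI_ex[of "\<lambda>N. \<forall>k\<ge>N. x k = x N"] unfolding eventually_const_def N_def by blast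
  define enc where "enc x l = foldr (\<lambda>k t. p (e (x k), t)) l (\<nu> 0)" for x :: "nat \<Rightarrow> 'c" and l
  have enc: "enc x l = enc y l \<Longrightarrow> k \<in> set l \<Longrightarrow> x k = y k" for x y l k
    by (induction l) (auto simp: enc_def dest!: injD[OF p] injD[OF e])
  \<comment> \<open>The entry at \<open>N x\<close> is the eventual value and must be recorded too,
    hence \<open>Suc\<close>. Recording \<open>N x\<close> itself ensures that two equal codes come
    from lists of the same length.\<close>
  define h where "h x = p (\<nu> (N x), enc x [0..<Suc (N x)])" for x
  have "inj_on h {x. eventually_const x}"
  proof (rule inj_onI)
    fix x y assume xy: "x \<in> {x. eventually_const x}" "y \<in> {x. eventually_const x}" "h x = h y"
    then have n: "N x = N y" and "enc x [0..<Suc (N x)] = enc y [0..<Suc (N x)]"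
      by (auto simp: h_def dest!: injD[OF p] injD[OF \<nu>])
    then have k: "x k = y k" if "k \<le> N x" for k
      by (intro enc[of x "[0..<Suc (N x)]"]) (use that in auto)
    show "x = y"
    proof
      fix l
      consider "l \<le> N x" | "l \<ge> N x" by linarith
      then show "x l = y l"
      proof cases
        case 2
        then have "x l = x (N x)" "y l = y (N x)" using N[of x l] N[of y l] xy(1,2) n by auto
        then show ?thesis using k[of "N x"] by simp
      qed (rule k)
    qed
  qed
  then show ?thesis by (rule that)
qed

text \<open>The homotopy fibre of a chain map from \<open>W\<close> to the suspension of
  \<open>X\<close>, given by maps \<open>p\<close> that lower the degree by one. Since degree
  \<open>n + 1\<close> of the suspension is \<open>X_n\<close>, both components sit in degree
  \<open>n\<close>. \<open>True\<close> marks the component in \<open>W\<close> and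
  \<open>False\<close> the one in \<open>X\<close>.\<close>

definition fib_cx :: "('r,'c) cx \<Rightarrow> ('r,'c) cx \<Rightarrow> (nat \<Rightarrow> 'c \<Rightarrow> 'c) \<Rightarrow> ('r, bool \<Rightarrow> 'c) cx" where
  "fib_cx W X p = \<lparr>obj = (\<lambda>n. prod_mod (\<lambda>b. if b then obj W n else obj X n)),
     dif = (\<lambda>n x b. if b then dif W n (x True) else p n (x True) \<oplus>\<^bsub>obj X n\<^esub> dif X n (x False))\<rparr>"

lemma fib_cx_simps [simp]:
  "x \<in> carrier (obj (fib_cx W X p) n) \<longleftrightarrow> x True \<in> carrier (obj W n) \<and> x False \<in> carrier (obj X n)"
  "\<zero>\<^bsub>obj (fib_cx W X p) n\<^esub> = (\<lambda>b. if b then \<zero>\<^bsub>obj W n\<^esub> else \<zero>\<^bsub>obj X n\<^esub>)"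
  "x \<oplus>\<^bsub>obj (fib_cx W X p) n\<^esub> y = (\<lambda>b. if b then x True \<oplus>\<^bsub>obj W n\<^esub> y True else x False \<oplus>\<^bsub>obj X n\<^esub> y False)"
  "a \<odot>\<^bsub>obj (fib_cx W X p) n\<^esub> x = (\<lambda>b. if b then a \<odot>\<^bsub>obj W n\<^esub> x True else a \<odot>\<^bsub>obj X n\<^esub> x False)"
  "dif (fib_cx W X p) n x = (\<lambda>b. if b then dif W n (x True) else p n (x True) \<oplus>\<^bsub>obj X n\<^esub> dif X n (x False))"
  by (auto simp: fib_cx_def fun_eq_iff all_bool_eq)

lemma chain_complex_fib_cx:
  assumes W: "chain_complex R W" and X: "chain_complex R X"
    and p: "\<And>n. linmap R (obj W (Suc n)) (obj X n) (p n)"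
    and anti: "\<And>n w. w \<in> carrier (obj W (Suc (Suc n))) \<Longrightarrow>
      p n (dif W (Suc n) w) = \<ominus>\<^bsub>obj X n\<^esub> dif X n (p (Suc n) w)"
  shows "chain_complex R (fib_cx W X p)"
proof -
  have M: "module R (obj (fib_cx W X p) n)" for n
    using module_prod_mod[of R "\<lambda>b. if b then obj W n else obj X n"] cc_module[OF W] cc_module[OF X]
    by (simp add: fib_cx_def)
  show ?thesis
    unfolding chain_complex_def
  proof (intro conjI allI ballI M)
    fix n
    interpret Xn: module R "obj X n" by (rule cc_module[OF X])
    show "linmap R (obj (fib_cx W X p) (Suc n)) (obj (fib_cx W X p) n) (dif (fib_cx W X p) n)"
      by (rule linmapI[OF M M])
        (auto simp: fun_eq_iff linmap_closed[OF p] linmap_closed[OF cc_lin[OF W]] linmap_closed[OF cc_lin[OF X]]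
          linmap_add[OF p] linmap_add[OF cc_lin[OF W]] linmap_add[OF cc_lin[OF X]]
          linmap_smult[OF p] linmap_smult[OF cc_lin[OF W]] linmap_smult[OF cc_lin[OF X]]
          Xn.M.a_ac Xn.smult_r_distr)
    fix x assume x: "x \<in> carrier (obj (fib_cx W X p) (Suc (Suc n)))"
    have c: "p (Suc n) (x True) \<in> carrier (obj X (Suc n))" "dif X (Suc n) (x False) \<in> carrier (obj X (Suc n))"
      using x linmap_closed[OF p] linmap_closed[OF cc_lin[OF X]] by auto
    show "dif (fib_cx W X p) n (dif (fib_cx W X p) (Suc n) x) = \<zero>\<^bsub>obj (fib_cx W X p) n\<^esub>"
      using x c by (auto simp: fun_eq_iff cc_dd[OF W] cc_dd[OF X] anti linmap_add[OF cc_lin[OF X]]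
        linmap_closed[OF cc_lin[OF X]] Xn.M.l_neg)
  qed
qed

text \<open>An extension \<open>0 \<rightarrow> Y \<rightarrow> W \<rightarrow> \<Sigma>X \<rightarrow> 0\<close> with \<open>X\<close> and \<open>Y\<close> in the class has \<open>W\<close> in the
  class: \<open>W\<close> is the cofibre of \<open>X \<rightarrow> fib_cx W X p\<close>, and \<open>Y \<rightarrow> fib_cx W X p\<close> is a weak equivalence.\<close>
lemma in_class_extension:
  fixes W X Y :: "('r,'c) cx" and e :: "'c \<Rightarrow> 'a"
  assumes inf: "infinite (UNIV :: 'a set)" and e: "inj e"
    and X: "in_class R A TYPE('a) X" and Y: "in_class R A TYPE('a) Y"
    and f: "chain_map R Y W f" and Xc: "chain_complex R X"
    and p: "\<And>n. linmap R (obj W (Suc n)) (obj X n) (p n)"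
    and anti: "\<And>n w. w \<in> carrier (obj W (Suc (Suc n))) \<Longrightarrow>
      p n (dif W (Suc n) w) = \<ominus>\<^bsub>obj X n\<^esub> dif X n (p (Suc n) w)"
    and inj: "\<And>n. inj_on (f n) (carrier (obj Y n))"
    and f0: "f 0 ` carrier (obj Y 0) = carrier (obj W 0)"
    and sur: "\<And>n. p n ` carrier (obj W (Suc n)) = carrier (obj X n)"
    and ker: "\<And>n. f (Suc n) ` carrier (obj Y (Suc n)) = {w \<in> carrier (obj W (Suc n)). p n w = \<zero>\<^bsub>obj X n\<^esub>}"
  shows "in_class R A TYPE('a) W"
proof -
  obtain pr :: "'a \<times> 'a \<Rightarrow> 'a" where pr: "inj pr" by (rule infinite_pairing[OF inf])
  note Yc = cm_dom[OF f] and Wc = cm_cod[OF f]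
  let ?M = "fib_cx W X p"
  note M = chain_complex_fib_cx[OF Wc Xc p anti]
  have zero: "\<zero>\<^bsub>obj V n\<^esub> \<in> carrier (obj V n)" if "chain_complex R V" for V :: "('r,'c) cx" and n
  proof -
    interpret V: module R "obj V n" by (rule cc_module[OF that])
    show ?thesis by simp
  qed
  note zX = zero[OF Xc] and zW = zero[OF Wc]
  have emb_M: "embeds TYPE('a) ?M"
  proof (rule embedsI)
    have "inj (\<lambda>x :: bool \<Rightarrow> 'c. pr (e (x True), e (x False)))"
      by (rule injI) (auto simp: fun_eq_iff all_bool_eq dest!: injD[OF pr] injD[OF e])
    then show "inj_on (\<lambda>x :: bool \<Rightarrow> 'c. pr (e (x True), e (x False))) (carrier (obj ?M n))" for n
      by (rule inj_on_subset) simp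
  qed
  \<comment> \<open>\<open>j\<close> sends \<open>w\<close> to \<open>(w, 0)\<close> and
    \<open>i\<close> sends \<open>x\<close> to \<open>(0, x)\<close>. Of the two, \<open>j\<close>
    commutes with the differentials only on elements killed by \<open>p\<close>, so it becomes a
    chain map after composition with \<open>f\<close>.\<close>
  define j where "j n w = (\<lambda>b. if b then w else \<zero>\<^bsub>obj X n\<^esub>)" for n w
  define i where "i n x = (\<lambda>b. if b then \<zero>\<^bsub>obj W n\<^esub> else x)" for n x
  have i: "chain_map R X ?M i"
  proof (rule chain_mapI[OF Xc M])
    fix n
    interpret Xn: module R "obj X n" by (rule cc_module[OF Xc])
    interpret Wn: module R "obj W n" by (rule cc_module[OF Wc])
    show "linmap R (obj X n) (obj ?M n) (i n)"
      by (rule linmapI[OF cc_module[OF Xc] cc_module[OF M]]) (auto simp: i_def fun_eq_iff)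
    show "i n (dif X n x) = dif ?M n (i (Suc n) x)" if "x \<in> carrier (obj X (Suc n))" for x
      using that linmap_zero[OF p] linmap_zero[OF cc_lin[OF Wc]] linmap_closed[OF cc_lin[OF Xc]]
      by (auto simp: i_def fun_eq_iff)
  qed
  have fib_p: "p n (f (Suc n) y) = \<zero>\<^bsub>obj X n\<^esub>" if "y \<in> carrier (obj Y (Suc n))" for n y
    using ker[of n] that by blast
  have jf: "chain_map R Y ?M (\<lambda>n y. j n (f n y))"
  proof (rule chain_mapI[OF Yc M])
    fix n
    interpret Xn: module R "obj X n" by (rule cc_module[OF Xc])
    show "linmap R (obj Y n) (obj ?M n) (\<lambda>y. j n (f n y))"
      by (rule linmapI[OF cc_module[OF Yc] cc_module[OF M]])
        (auto simp: j_def fun_eq_iff linmap_closed[OF cm_lin[OF f]] linmap_add[OF cm_lin[OF f]]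
          linmap_smult[OF cm_lin[OF f]])
    show "j n (f n (dif Y n y)) = dif ?M n (j (Suc n) (f (Suc n) y))" if "y \<in> carrier (obj Y (Suc n))" for y
      using that linmap_zero[OF cc_lin[OF Xc]] by (auto simp: j_def fun_eq_iff fib_p cm_comm[OF f])
  qed
  have lift: "\<exists>y\<in>carrier (obj Y n). f n y = w"
    if "w \<in> carrier (obj W n)" "\<And>k. n = Suc k \<Longrightarrow> p k w = \<zero>\<^bsub>obj X k\<^esub>" for n w
  proof (cases n)
    case 0
    have "w \<in> f n ` carrier (obj Y n)" using that(1) f0 0 by simp
    then show ?thesis by blast
  next
    case (Suc k)
    have "w \<in> f n ` carrier (obj Y n)" using that ker[of k] Suc by simp
    then show ?thesis by blast
  qed
  have "weq R Y ?M (\<lambda>n y. j n (f n y))"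
  proof (rule weqI[OF jf])
    fix n
    interpret Xn: module R "obj X n" by (rule cc_module[OF Xc])
    interpret Wn: module R "obj W n" by (rule cc_module[OF Wc])
    interpret Wn1: module R "obj W (Suc n)" by (rule cc_module[OF Wc])
    show "\<exists>y\<in>cycles Y n. \<exists>w\<in>carrier (obj ?M (Suc n)). x = j n (f n y) \<oplus>\<^bsub>obj ?M n\<^esub> dif ?M n w"
      if x: "x \<in> cycles ?M n" for x
    proof -
      have xc: "x True \<in> carrier (obj W n)" "x False \<in> carrier (obj X n)"
        using x by (auto simp: cycles_iff)
      have xk: "dif W k (x True) = \<zero>\<^bsub>obj W k\<^esub>" "p k (x True) \<oplus>\<^bsub>obj X k\<^esub> dif X k (x False) = \<zero>\<^bsub>obj X k\<^esub>"
        if "n = Suc k" for k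
        using x that by (auto simp: cycles_iff fun_eq_iff all_bool_eq)
      \<comment> \<open>Surjectivity on homology: subtracting the boundary of \<open>(w, 0)\<close>
        with \<open>p w\<close> equal to the second component moves the cycle into \<open>W\<close>.
        What remains is killed by \<open>p\<close> and so comes from \<open>Y\<close>.\<close>
      have "x False \<in> p n ` carrier (obj W (Suc n))" by (subst sur) (rule xc(2))
      then obtain w where w: "w \<in> carrier (obj W (Suc n))" "p n w = x False" by (metis imageE)
      have dw: "dif W n w \<in> carrier (obj W n)" by (rule linmap_closed[OF cc_lin[OF Wc] w(1)])
      have "\<exists>y\<in>carrier (obj Y n). f n y = x True \<ominus>\<^bsub>obj W n\<^esub> dif W n w"
      proof (rule lift)
        fix k assume k: "n = Suc k"
        interpret Xk: module R "obj X k" by (rule cc_module[OF Xc])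
        have c: "p k (x True) \<in> carrier (obj X k)" "dif X k (x False) \<in> carrier (obj X k)"
          using xc k linmap_closed[OF p] linmap_closed[OF cc_lin[OF Xc]] by auto
        have "p k (x True \<ominus>\<^bsub>obj W n\<^esub> dif W n w) = p k (x True) \<ominus>\<^bsub>obj X k\<^esub> p k (dif W n w)"
          using linmap_diff[OF p] xc dw k by simp
        also have "p k (dif W n w) = \<ominus>\<^bsub>obj X k\<^esub> dif X k (x False)" using anti[of w k] w k by simp
        finally show "p k (x True \<ominus>\<^bsub>obj W n\<^esub> dif W n w) = \<zero>\<^bsub>obj X k\<^esub>"
          using xk(2)[OF k] c by (simp add: a_minus_def)
      qed (use xc dw in simp)
      then obtain y where y: "y \<in> carrier (obj Y n)" "f n y = x True \<ominus>\<^bsub>obj W n\<^esub> dif W n w" by blast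
      have "dif Y k y = \<zero>\<^bsub>obj Y k\<^esub>" if k: "n = Suc k" for k
      proof (rule inj_onD[OF inj])
        interpret Wk: module R "obj W k" by (rule cc_module[OF Wc])
        have y': "y \<in> carrier (obj Y (Suc k))" using y k by simp
        have "f k (dif Y k y) = dif W k (x True \<ominus>\<^bsub>obj W n\<^esub> dif W n w)"
          using cm_comm[OF f y'] y k by simp
        also have "\<dots> = dif W k (x True) \<ominus>\<^bsub>obj W k\<^esub> dif W k (dif W n w)"
          using linmap_diff[OF cc_lin[OF Wc]] xc dw k by simp
        also have "\<dots> = \<zero>\<^bsub>obj W k\<^esub>" using xk(1)[OF k] cc_dd[OF Wc, of w k] w k by (simp add: a_minus_def)
        finally show "f k (dif Y k y) = f k \<zero>\<^bsub>obj Y k\<^esub>" using linmap_zero[OF cm_lin[OF f]] by simp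
        show "dif Y k y \<in> carrier (obj Y k)" by (rule linmap_closed[OF cc_lin[OF Yc] y'])
      qed (rule zero[OF Yc])
      then have yc: "y \<in> cycles Y n" using y by (simp add: cycles_iff)
      have "f n y \<oplus>\<^bsub>obj W n\<^esub> dif W n w = x True"
        unfolding y(2) using xc dw by (simp add: a_minus_def Wn.M.a_assoc Wn.M.l_neg)
      then have "x = j n (f n y) \<oplus>\<^bsub>obj ?M n\<^esub> dif ?M n (j (Suc n) w)"
        using w(2) xc linmap_zero[OF cc_lin[OF Xc], of n] by (simp add: fun_eq_iff all_bool_eq j_def)
      then show ?thesis using yc w zX by (intro bexI[of _ y] bexI[of _ "j (Suc n) w"]) (simp_all add: j_def)
    qed
    show "y \<in> boundaries Y n" if y: "y \<in> cycles Y n" "j n (f n y) \<in> boundaries ?M n" for y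
    proof -
      obtain x where xM: "x \<in> carrier (obj ?M (Suc n))" and eq: "j n (f n y) = dif ?M n x"
        using y(2) unfolding boundaries_def by blast
      from xM have x: "x True \<in> carrier (obj W (Suc n))" "x False \<in> carrier (obj X (Suc n))" by simp_all
      have e1: "f n y = dif W n (x True)" using fun_cong[OF eq, of True] by (simp add: j_def)
      have e2: "p n (x True) \<oplus>\<^bsub>obj X n\<^esub> dif X n (x False) = \<zero>\<^bsub>obj X n\<^esub>"
        using fun_cong[OF eq, of False] by (simp add: j_def)
      \<comment> \<open>Injectivity on homology: the bounding element \<open>x\<close> is changed by
        the boundary of \<open>(w, 0)\<close> in the same way, so that it comes from some
        \<open>v\<close> in \<open>Y\<close>, and \<open>v\<close> bounds \<open>y\<close>.\<close>
      have "x False \<in> p (Suc n) ` carrier (obj W (Suc (Suc n)))" by (subst sur) (rule x(2))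
      then obtain w where w: "w \<in> carrier (obj W (Suc (Suc n)))" "p (Suc n) w = x False" by (metis imageE)
      have dw: "dif W (Suc n) w \<in> carrier (obj W (Suc n))" by (rule linmap_closed[OF cc_lin[OF Wc] w(1)])
      have c: "p n (x True) \<in> carrier (obj X n)" "dif X n (x False) \<in> carrier (obj X n)"
        using x linmap_closed[OF p] linmap_closed[OF cc_lin[OF Xc]] by auto
      have "\<exists>v\<in>carrier (obj Y (Suc n)). f (Suc n) v = x True \<ominus>\<^bsub>obj W (Suc n)\<^esub> dif W (Suc n) w"
      proof (rule lift)
        fix k assume k: "Suc n = Suc k"
        have "p n (x True \<ominus>\<^bsub>obj W (Suc n)\<^esub> dif W (Suc n) w) = p n (x True) \<ominus>\<^bsub>obj X n\<^esub> p n (dif W (Suc n) w)"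
          by (rule linmap_diff[OF p x(1) dw])
        also have "\<dots> = \<zero>\<^bsub>obj X n\<^esub>" using c e2 anti[OF w(1)] w(2) by (simp add: a_minus_def)
        finally show "p k (x True \<ominus>\<^bsub>obj W (Suc n)\<^esub> dif W (Suc n) w) = \<zero>\<^bsub>obj X k\<^esub>" using k by simp
      qed (use x dw in simp)
      then obtain v where v: "v \<in> carrier (obj Y (Suc n))"
        "f (Suc n) v = x True \<ominus>\<^bsub>obj W (Suc n)\<^esub> dif W (Suc n) w" by blast
      have "f n (dif Y n v) = dif W n (x True) \<ominus>\<^bsub>obj W n\<^esub> dif W n (dif W (Suc n) w)"
        using cm_comm[OF f v(1)] v(2) linmap_diff[OF cc_lin[OF Wc] x(1) dw] by simp
      also have "\<dots> = f n y"
        using e1 cc_dd[OF Wc w(1)] linmap_closed[OF cc_lin[OF Wc] x(1)] by (simp add: a_minus_def)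
      finally have "dif Y n v = y"
        using inj_onD[OF inj, of n "dif Y n v" y] y linmap_closed[OF cc_lin[OF Yc] v(1)]
        by (simp add: cycles_iff)
      then show ?thesis using v(1) unfolding boundaries_def by blast
    qed
  qed
  then have "in_class R A TYPE('a) ?M" by (rule in_class_weq_fwd[OF Y _ emb_M])
  then show ?thesis
  proof (rule in_class_cofib[OF X _ _ i, of _ "\<lambda>n x. x True"])
    show "embeds TYPE('a) W" by (rule embedsI[of e]) (use e in \<open>auto intro: inj_on_subset\<close>)
    show "chain_map R ?M W (\<lambda>n x. x True)"
      by (intro chain_mapI M Wc linmapI cc_module) auto
    show "inj_on (i n) (carrier (obj X n))" for n by (rule inj_onI) (auto simp: i_def fun_eq_iff all_bool_eq)
    show "\<exists>y\<in>carrier (obj ?M n). y True = z" if "z \<in> carrier (obj W n)" for n z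
      using that zX by (intro bexI[of _ "j n z"]) (auto simp: j_def)
    show "\<exists>x\<in>carrier (obj X n). i n x = y" if "y \<in> carrier (obj ?M n)" "y True = \<zero>\<^bsub>obj W n\<^esub>" for n y
      using that by (intro bexI[of _ "y False"]) (auto simp: i_def fun_eq_iff all_bool_eq)
  qed (simp add: i_def)
qed

section \<open>Countable sums and increasing unions as complexes of sequences\<close>

definition seq_cx :: "('r,'c) cx \<Rightarrow> ('r, nat \<Rightarrow> 'c) cx" where
  "seq_cx F = \<lparr>obj = (\<lambda>n. prod_mod (\<lambda>_. obj F n)), dif = (\<lambda>n x k. dif F n (x k))\<rparr>"

lemma seq_cx_simps [simp]:
  "x \<in> carrier (obj (seq_cx F) n) \<longleftrightarrow> (\<forall>k. x k \<in> carrier (obj F n))"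
  "\<zero>\<^bsub>obj (seq_cx F) n\<^esub> = (\<lambda>k. \<zero>\<^bsub>obj F n\<^esub>)"
  "x \<oplus>\<^bsub>obj (seq_cx F) n\<^esub> y = (\<lambda>k. x k \<oplus>\<^bsub>obj F n\<^esub> y k)"
  "a \<odot>\<^bsub>obj (seq_cx F) n\<^esub> x = (\<lambda>k. a \<odot>\<^bsub>obj F n\<^esub> x k)"
  "dif (seq_cx F) n x = (\<lambda>k. dif F n (x k))"
  by (simp_all add: seq_cx_def)

lemma chain_complex_seq_cx:
  assumes F: "chain_complex R F" shows "chain_complex R (seq_cx F)"
proof -
  have M: "module R (obj (seq_cx F) n)" for n
    using module_prod_mod[of R "\<lambda>_ :: nat. obj F n"] cc_module[OF F] by (simp add: seq_cx_def)
  show ?thesis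
    unfolding chain_complex_def
    by (intro conjI allI ballI M linmapI)
      (auto simp: cc_dd[OF F] linmap_closed[OF cc_lin[OF F]] linmap_add[OF cc_lin[OF F]] linmap_smult[OF cc_lin[OF F]])
qed

text \<open>\<open>H k\<close> is meant as the \<open>k\<close>-th of a family of subcomplexes of
  \<open>F\<close>, with the degree as second argument. Eventually zero sequences realise the direct
  sum of this family as a subcomplex of a power of \<open>F\<close>.\<close>

definition fin_seqs :: "('r,'c) cx \<Rightarrow> (nat \<Rightarrow> nat \<Rightarrow> 'c set) \<Rightarrow> nat \<Rightarrow> (nat \<Rightarrow> 'c) set" where
  "fin_seqs F H n = {x. (\<forall>k. x k \<in> H k n) \<and> (\<exists>N. \<forall>k\<ge>N. x k = \<zero>\<^bsub>obj F n\<^esub>)}"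

definition const_seqs :: "('r,'c) cx \<Rightarrow> (nat \<Rightarrow> nat \<Rightarrow> 'c set) \<Rightarrow> nat \<Rightarrow> (nat \<Rightarrow> 'c) set" where
  "const_seqs F H n = {x. (\<forall>k. x k \<in> H k n) \<and> (\<exists>N c. \<forall>k\<ge>N. x k = c)}"

lemma fin_seqsI:
  "(\<And>k. x k \<in> H k n) \<Longrightarrow> (\<And>k. k \<ge> N \<Longrightarrow> x k = \<zero>\<^bsub>obj F n\<^esub>) \<Longrightarrow> x \<in> fin_seqs F H n"
  unfolding fin_seqs_def by blast

lemma const_seqsI:
  assumes "\<And>k. x k \<in> H k n" "\<And>k. k \<ge> N \<Longrightarrow> x k = c"
  shows "x \<in> const_seqs F H n"
  unfolding const_seqs_def using assms by blast

context
  fixes R :: "'r ring" and F :: "('r,'c) cx" and H :: "nat \<Rightarrow> nat \<Rightarrow> 'c set"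
  assumes F: "chain_complex R F" and H: "\<And>k n. submodule (H k n) R (obj F n)"
    and dH: "\<And>k n x. x \<in> H k (Suc n) \<Longrightarrow> dif F n x \<in> H k n"
begin

lemma H_closed:
  "x \<in> H k n \<Longrightarrow> x \<in> carrier (obj F n)" "\<zero>\<^bsub>obj F n\<^esub> \<in> H k n"
  "x \<in> H k n \<Longrightarrow> y \<in> H k n \<Longrightarrow> x \<oplus>\<^bsub>obj F n\<^esub> y \<in> H k n"
  "a \<in> carrier R \<Longrightarrow> x \<in> H k n \<Longrightarrow> a \<odot>\<^bsub>obj F n\<^esub> x \<in> H k n"
  "x \<in> H k n \<Longrightarrow> \<ominus>\<^bsub>obj F n\<^esub> x \<in> H k n"
proof -
  interpret M: module R "obj F n" by (rule cc_module[OF F])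
  note E = M.submoduleE[OF H]
  show "x \<in> H k n \<Longrightarrow> x \<in> carrier (obj F n)" for x using E(1) by blast
  show "x \<in> H k n \<Longrightarrow> y \<in> H k n \<Longrightarrow> x \<oplus>\<^bsub>obj F n\<^esub> y \<in> H k n" for x y by (rule E(5))
  show "a \<in> carrier R \<Longrightarrow> x \<in> H k n \<Longrightarrow> a \<odot>\<^bsub>obj F n\<^esub> x \<in> H k n" for a x by (rule E(4))
  show "x \<in> H k n \<Longrightarrow> \<ominus>\<^bsub>obj F n\<^esub> x \<in> H k n" for x by (rule E(3))
  show "\<zero>\<^bsub>obj F n\<^esub> \<in> H k n"
    using subgroup.one_closed[OF submodule.axioms(1)[OF H]] by simp
qed

lemma sub_H:
  "chain_complex R (sub_cx F (H k))" "chain_map R (sub_cx F (H k)) F (\<lambda>n x. x)"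
  by (rule chain_complex_sub_cx[OF F H dH], assumption)+

lemma fin_seqs_cx: "chain_complex R (sub_cx (seq_cx F) (fin_seqs F H))"
proof (rule chain_complex_sub_cx(1)[OF chain_complex_seq_cx[OF F]])
  fix n
  interpret M: module R "obj F n" by (rule cc_module[OF F])
  show "submodule (fin_seqs F H n) R (obj (seq_cx F) n)"
  proof (rule submoduleI'[OF cc_module[OF chain_complex_seq_cx[OF F]]])
    fix x y assume xy: "x \<in> fin_seqs F H n" "y \<in> fin_seqs F H n"
    then obtain N N' where "\<forall>k\<ge>N. x k = \<zero>\<^bsub>obj F n\<^esub>" "\<forall>k\<ge>N'. y k = \<zero>\<^bsub>obj F n\<^esub>"
      unfolding fin_seqs_def by blast
    then have "\<forall>k\<ge>max N N'. x k \<oplus>\<^bsub>obj F n\<^esub> y k = \<zero>\<^bsub>obj F n\<^esub>" by simp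
    then show "x \<oplus>\<^bsub>obj (seq_cx F) n\<^esub> y \<in> fin_seqs F H n"
      by (intro fin_seqsI[where N = "max N N'"]) (use xy H_closed(3) in \<open>auto simp: fin_seqs_def\<close>)
  next
    fix a x assume ax: "a \<in> carrier R" "x \<in> fin_seqs F H n"
    then obtain N where "\<forall>k\<ge>N. x k = \<zero>\<^bsub>obj F n\<^esub>" unfolding fin_seqs_def by blast
    then show "a \<odot>\<^bsub>obj (seq_cx F) n\<^esub> x \<in> fin_seqs F H n"
      by (intro fin_seqsI[where N = N]) (use ax H_closed(4) in \<open>auto simp: fin_seqs_def\<close>)
  next
    show "fin_seqs F H n \<subseteq> carrier (obj (seq_cx F) n)"
      by (rule subsetI) (simp add: fin_seqs_def, blast intro: H_closed(1))
  qed (simp_all add: fin_seqs_def H_closed(2))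
  fix x assume x: "x \<in> fin_seqs F H (Suc n)"
  then obtain N where "\<forall>k\<ge>N. x k = \<zero>\<^bsub>obj F (Suc n)\<^esub>" unfolding fin_seqs_def by blast
  then show "dif (seq_cx F) n x \<in> fin_seqs F H n"
    by (intro fin_seqsI[where N = N])
      (use x dH linmap_zero[OF cc_lin[OF F]] in \<open>auto simp: fin_seqs_def\<close>)
qed

lemma const_seqs_cx: "chain_complex R (sub_cx (seq_cx F) (const_seqs F H))"
proof (rule chain_complex_sub_cx(1)[OF chain_complex_seq_cx[OF F]])
  fix n
  interpret M: module R "obj F n" by (rule cc_module[OF F])
  show "submodule (const_seqs F H n) R (obj (seq_cx F) n)"
  proof (rule submoduleI'[OF cc_module[OF chain_complex_seq_cx[OF F]]])
    fix x y assume xy: "x \<in> const_seqs F H n" "y \<in> const_seqs F H n"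
    then obtain N c N' c' where N: "\<forall>k\<ge>N. x k = c" "\<forall>k\<ge>N'. y k = c'"
      unfolding const_seqs_def by blast
    then show "x \<oplus>\<^bsub>obj (seq_cx F) n\<^esub> y \<in> const_seqs F H n"
      by (intro const_seqsI[where N = "max N N'" and c = "c \<oplus>\<^bsub>obj F n\<^esub> c'"])
        (use xy H_closed(3) in \<open>auto simp: const_seqs_def\<close>)
  next
    fix a x assume ax: "a \<in> carrier R" "x \<in> const_seqs F H n"
    then obtain N c where "\<forall>k\<ge>N. x k = c" unfolding const_seqs_def by blast
    then show "a \<odot>\<^bsub>obj (seq_cx F) n\<^esub> x \<in> const_seqs F H n"
      by (intro const_seqsI[where N = N and c = "a \<odot>\<^bsub>obj F n\<^esub> c"])
        (use ax H_closed(4) in \<open>auto simp: const_seqs_def\<close>)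
  next
    show "const_seqs F H n \<subseteq> carrier (obj (seq_cx F) n)"
      by (rule subsetI) (simp add: const_seqs_def, blast intro: H_closed(1))
    show "\<zero>\<^bsub>obj (seq_cx F) n\<^esub> \<in> const_seqs F H n"
      by (rule const_seqsI[where c = "\<zero>\<^bsub>obj F n\<^esub>"]) (simp_all add: H_closed(2))
  qed
  fix x assume x: "x \<in> const_seqs F H (Suc n)"
  then obtain N c where "\<forall>k\<ge>N. x k = c" unfolding const_seqs_def by blast
  then show "dif (seq_cx F) n x \<in> const_seqs F H n"
    by (intro const_seqsI[where N = N and c = "dif F n c"]) (use dH x in \<open>auto simp: const_seqs_def\<close>)
qed

lemma fin_seqs_dsum:
  "dsum_proj R (sub_cx (seq_cx F) (fin_seqs F H)) UNIV (\<lambda>k. sub_cx F (H k))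
     (\<lambda>k n x l. if l = k then x else \<zero>\<^bsub>obj F n\<^esub>) (\<lambda>k n y. y k)"
  unfolding dsum_proj_def
proof (intro conjI ballI allI impI fin_seqs_cx)
  fix k
  show "chain_map R (sub_cx F (H k)) (sub_cx (seq_cx F) (fin_seqs F H)) (\<lambda>n x l. if l = k then x else \<zero>\<^bsub>obj F n\<^esub>)"
  proof (rule chain_mapI[OF sub_H(1) fin_seqs_cx])
    fix n
    interpret M: module R "obj F n" by (rule cc_module[OF F])
    have "(\<lambda>l. if l = k then x else \<zero>\<^bsub>obj F n\<^esub>) \<in> fin_seqs F H n" if "x \<in> H k n" for x
      by (rule fin_seqsI[where N = "Suc k"]) (use that H_closed(2) in auto)
    then show "linmap R (obj (sub_cx F (H k)) n) (obj (sub_cx (seq_cx F) (fin_seqs F H)) n)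
        (\<lambda>x l. if l = k then x else \<zero>\<^bsub>obj F n\<^esub>)"
      by (intro linmapI cc_module[OF sub_H(1)] cc_module[OF fin_seqs_cx]) auto
  qed (use linmap_zero[OF cc_lin[OF F]] in auto)
  fix n
  show "linmap R (obj (sub_cx (seq_cx F) (fin_seqs F H)) n) (obj (sub_cx F (H k)) n) (\<lambda>y. y k)"
    by (intro linmapI cc_module[OF sub_H(1)] cc_module[OF fin_seqs_cx]) (auto simp: fin_seqs_def)
next
  fix n y assume "y \<in> carrier (obj (sub_cx (seq_cx F) (fin_seqs F H)) n)"
  then obtain N where "\<forall>k\<ge>N. y k = \<zero>\<^bsub>obj F n\<^esub>" unfolding fin_seqs_def by auto
  then have "{k \<in> UNIV. y k \<noteq> \<zero>\<^bsub>obj (sub_cx F (H k)) n\<^esub>} \<subseteq> {..<N}" by (auto simp: not_le[symmetric])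
  then show "finite {k \<in> UNIV. y k \<noteq> \<zero>\<^bsub>obj (sub_cx F (H k)) n\<^esub>}" by (rule finite_subset) simp
qed auto

text \<open>A sequence is recovered from its differences, and it is eventually constant exactly if
  almost all differences vanish. Accordingly \<open>x\<close> in stage \<open>k\<close> becomes the
  sequence that is \<open>x\<close> from index \<open>k\<close> on, which is allowed because the
  stages increase. In these coordinates the inclusion of the eventually zero sequences is the map
  \<open>1 - shift\<close> of the usual telescope.\<close>

lemma const_seqs_dsum:
  assumes mono: "\<And>k l n. k \<le> l \<Longrightarrow> H k n \<subseteq> H l n"
  shows "dsum_proj R (sub_cx (seq_cx F) (const_seqs F H)) UNIV (\<lambda>k. sub_cx F (H k))
     (\<lambda>k n x l. if k \<le> l then x else \<zero>\<^bsub>obj F n\<^esub>)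
     (\<lambda>k n y. case k of 0 \<Rightarrow> y 0 | Suc l \<Rightarrow> y k \<ominus>\<^bsub>obj F n\<^esub> y l)"
  unfolding dsum_proj_def
proof (intro conjI ballI allI impI const_seqs_cx)
  let ?\<pi> = "\<lambda>k n (y :: nat \<Rightarrow> 'c). case k of 0 \<Rightarrow> y 0 | Suc l \<Rightarrow> y k \<ominus>\<^bsub>obj F n\<^esub> y l"
  fix k
  show "chain_map R (sub_cx F (H k)) (sub_cx (seq_cx F) (const_seqs F H)) (\<lambda>n x l. if k \<le> l then x else \<zero>\<^bsub>obj F n\<^esub>)"
  proof (rule chain_mapI[OF sub_H(1) const_seqs_cx])
    fix n
    interpret M: module R "obj F n" by (rule cc_module[OF F])
    have "(\<lambda>l. if k \<le> l then x else \<zero>\<^bsub>obj F n\<^esub>) \<in> const_seqs F H n" if "x \<in> H k n" for x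
      by (rule const_seqsI[where N = k and c = x]) (use that H_closed(2) subsetD[OF mono] in auto)
    then show "linmap R (obj (sub_cx F (H k)) n) (obj (sub_cx (seq_cx F) (const_seqs F H)) n)
        (\<lambda>x l. if k \<le> l then x else \<zero>\<^bsub>obj F n\<^esub>)"
      by (intro linmapI cc_module[OF sub_H(1)] cc_module[OF const_seqs_cx]) auto
  qed (use linmap_zero[OF cc_lin[OF F]] in auto)
  fix n
  interpret M: module R "obj F n" by (rule cc_module[OF F])
  show "linmap R (obj (sub_cx (seq_cx F) (const_seqs F H)) n) (obj (sub_cx F (H k)) n) (?\<pi> k n)"
  proof (intro linmapI cc_module[OF sub_H(1)] cc_module[OF const_seqs_cx])
    fix y z assume "y \<in> carrier (obj (sub_cx (seq_cx F) (const_seqs F H)) n)"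
      "z \<in> carrier (obj (sub_cx (seq_cx F) (const_seqs F H)) n)"
    then have c: "\<And>l. y l \<in> carrier (obj F n)" "\<And>l. z l \<in> carrier (obj F n)" "\<And>l. y l \<in> H l n"
      by (auto simp: const_seqs_def intro: H_closed(1))
    show "?\<pi> k n (y \<oplus>\<^bsub>obj (sub_cx (seq_cx F) (const_seqs F H)) n\<^esub> z) =
      ?\<pi> k n y \<oplus>\<^bsub>obj (sub_cx F (H k)) n\<^esub> ?\<pi> k n z"
      using c by (auto simp: a_minus_def M.M.minus_add M.M.a_ac split: nat.split)
    have "y l \<in> H k n" if "l \<le> k" for l using c(3) mono[OF that] by blast
    then show "?\<pi> k n y \<in> carrier (obj (sub_cx F (H k)) n)"
      using H_closed(3,5) by (auto simp: a_minus_def split: nat.split)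
    fix a assume "a \<in> carrier R"
    then show "?\<pi> k n (a \<odot>\<^bsub>obj (sub_cx (seq_cx F) (const_seqs F H)) n\<^esub> y) = a \<odot>\<^bsub>obj (sub_cx F (H k)) n\<^esub> ?\<pi> k n y"
      using c by (auto simp: a_minus_def M.smult_r_distr M.smult_r_minus split: nat.split)
  qed
  fix x assume "x \<in> carrier (obj (sub_cx F (H k)) n)"
  then have x: "x \<in> carrier (obj F n)" using H_closed(1) by simp
  then show "?\<pi> k n (\<lambda>l. if k \<le> l then x else \<zero>\<^bsub>obj F n\<^esub>) = x"
    by (auto simp: a_minus_def split: nat.split)
  show "?\<pi> l n (\<lambda>l. if k \<le> l then x else \<zero>\<^bsub>obj F n\<^esub>) = \<zero>\<^bsub>obj (sub_cx F (H l)) n\<^esub>" if "k \<noteq> l" for l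
    using that x by (auto simp: a_minus_def M.M.r_neg split: nat.split)
next
  let ?\<pi> = "\<lambda>k n (y :: nat \<Rightarrow> 'c). case k of 0 \<Rightarrow> y 0 | Suc l \<Rightarrow> y k \<ominus>\<^bsub>obj F n\<^esub> y l"
  fix n y assume "y \<in> carrier (obj (sub_cx (seq_cx F) (const_seqs F H)) n)"
  then have c: "\<And>l. y l \<in> carrier (obj F n)" and "\<exists>N d. \<forall>k\<ge>N. y k = d"
    by (auto simp: const_seqs_def intro: H_closed(1))
  then obtain N d where N: "\<forall>k\<ge>N. y k = d" by blast
  interpret M: module R "obj F n" by (rule cc_module[OF F])
  have "?\<pi> k n y = \<zero>\<^bsub>obj F n\<^esub>" if "k > N" for k
  proof (cases k)
    case (Suc l)
    then have "y k = y l" using N[rule_format, of k] N[rule_format, of l] that by simp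
    then show ?thesis using Suc c by (simp add: a_minus_def M.M.r_neg)
  qed (use that in simp)
  then have "{k \<in> UNIV. ?\<pi> k n y \<noteq> \<zero>\<^bsub>obj (sub_cx F (H k)) n\<^esub>} \<subseteq> {..N}"
    by (auto simp: not_less[symmetric])
  then show "finite {k \<in> UNIV. ?\<pi> k n y \<noteq> \<zero>\<^bsub>obj (sub_cx F (H k)) n\<^esub>}" by (rule finite_subset) simp
  show "y = \<zero>\<^bsub>obj (sub_cx (seq_cx F) (const_seqs F H)) n\<^esub>"
    if z: "\<forall>k\<in>UNIV. ?\<pi> k n y = \<zero>\<^bsub>obj (sub_cx F (H k)) n\<^esub>"
  proof -
    have "y k = \<zero>\<^bsub>obj F n\<^esub>" for k
    proof (induction k)
      case 0
      then show ?case using bspec[OF z, of 0] by simp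
    next
      case (Suc k)
      then show ?case using bspec[OF z, of "Suc k"] c M.M.minus_equality[of "\<zero>\<^bsub>obj F n\<^esub>" "\<zero>\<^bsub>obj F n\<^esub>"]
        by (simp add: a_minus_def)
    qed
    then show ?thesis by auto
  qed
qed

lemma seqs_embed:
  assumes inf: "infinite (UNIV :: 'a set)" and e: "inj (e :: 'c \<Rightarrow> 'a)"
  shows "embeds TYPE('a) (sub_cx (seq_cx F) (fin_seqs F H))"
    and "embeds TYPE('a) (sub_cx (seq_cx F) (const_seqs F H))"
proof -
  obtain h :: "(nat \<Rightarrow> 'c) \<Rightarrow> 'a" where h: "inj_on h {x. eventually_const x}"
    by (rule eventually_const_inj[OF inf e])
  show "embeds TYPE('a) (sub_cx (seq_cx F) (fin_seqs F H))"
  proof (rule embedsI, rule inj_on_subset[OF h], clarsimp)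
    fix n x assume "x \<in> fin_seqs F H n"
    then obtain N where "\<forall>k\<ge>N. x k = \<zero>\<^bsub>obj F n\<^esub>" unfolding fin_seqs_def by blast
    then have "\<forall>k\<ge>N. x k = x N" by simp
    then show "eventually_const x" unfolding eventually_const_def by blast
  qed
  show "embeds TYPE('a) (sub_cx (seq_cx F) (const_seqs F H))"
  proof (rule embedsI, rule inj_on_subset[OF h], clarsimp)
    fix n x assume "x \<in> const_seqs F H n"
    then obtain N c where "\<forall>k\<ge>N. x k = c" unfolding const_seqs_def by blast
    then have "\<forall>k\<ge>N. x k = x N" by simp
    then show "eventually_const x" unfolding eventually_const_def by blast
  qed
qed

lemma in_class_fin_seqs:
  assumes inf: "infinite (UNIV :: 'a set)" and e: "inj (e :: 'c \<Rightarrow> 'a)"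
    and X: "\<And>k. in_class R A TYPE('a) (sub_cx F (H k))"
  shows "in_class R A TYPE('a) (sub_cx (seq_cx F) (fin_seqs F H))"
proof -
  obtain \<nu> :: "nat \<Rightarrow> 'a" where "inj \<nu>" by (rule infinite_nat_inj[OF inf])
  then show ?thesis
    by (rule in_class_dsum[OF fin_seqs_dsum X seqs_embed(1)[OF inf e]])
qed

text \<open>The mapping telescope of the inclusions: eventually zero sequences in eventually constant
  ones, with the union as quotient.  The eventually constant sequences are again a direct sum,
  through their differences.\<close>
lemma in_class_union:
  assumes inf: "infinite (UNIV :: 'a set)" and e: "inj (e :: 'c \<Rightarrow> 'a)"
    and mono: "\<And>k l n. k \<le> l \<Longrightarrow> H k n \<subseteq> H l n"
    and un: "\<And>n. (\<Union>k. H k n) = carrier (obj F n)"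
    and X: "\<And>k. in_class R A TYPE('a) (sub_cx F (H k))"
  shows "in_class R A TYPE('a) F"
proof -
  let ?S = "sub_cx (seq_cx F) (fin_seqs F H)" and ?T = "sub_cx (seq_cx F) (const_seqs F H)"
  obtain \<nu> :: "nat \<Rightarrow> 'a" where \<nu>: "inj \<nu>" by (rule infinite_nat_inj[OF inf])
  have T: "in_class R A TYPE('a) ?T"
    by (rule in_class_dsum[OF const_seqs_dsum[OF mono] X seqs_embed(2)[OF inf e] \<nu>])
  define li where "li x = (THE c. \<exists>N. \<forall>k\<ge>N. x k = c)" for x :: "nat \<Rightarrow> 'c"
  have li: "li x = c" if "\<forall>k\<ge>N. x k = c" for x c N
    unfolding li_def
  proof (rule the_equality)
    show "\<exists>N. \<forall>k\<ge>N. x k = c" using that by blast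
    show "d = c" if d: "\<exists>N. \<forall>k\<ge>N. x k = d" for d
    proof -
      obtain N' where "\<forall>k\<ge>N'. x k = d" using d by blast
      then show ?thesis using \<open>\<forall>k\<ge>N. x k = c\<close>[rule_format, of "max N N'"] by simp
    qed
  qed
  have li_ev: "\<exists>N. \<forall>k\<ge>N. x k = li x" if x: "x \<in> const_seqs F H n" for x n
  proof -
    obtain N c where N: "\<forall>k\<ge>N. x k = c" using x unfolding const_seqs_def by blast
    show ?thesis using N unfolding li[OF N] by blast
  qed
  have li_c: "li x \<in> carrier (obj F n)" if x: "x \<in> const_seqs F H n" for x n
  proof -
    obtain N where "\<forall>k\<ge>N. x k = li x" using li_ev[OF x] by blast
    then have "li x = x N" by simp
    moreover have "x N \<in> carrier (obj F n)" using x by (auto simp: const_seqs_def intro: H_closed(1))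
    ultimately show ?thesis by simp
  qed
  show ?thesis
  proof (rule in_class_cofib[OF in_class_fin_seqs[OF inf e X] T, of F "\<lambda>n x. x" "\<lambda>n. li"])
    show "embeds TYPE('a) F" by (rule embedsI[of e]) (use e in \<open>auto intro: inj_on_subset\<close>)
    have ST: "fin_seqs F H n \<subseteq> const_seqs F H n" for n
      unfolding fin_seqs_def const_seqs_def by blast
    show "chain_map R ?S ?T (\<lambda>n x. x)"
      by (intro chain_mapI fin_seqs_cx const_seqs_cx linmapI cc_module) (use ST in auto)
    show "chain_map R ?T F (\<lambda>n. li)"
    proof (rule chain_mapI[OF const_seqs_cx F])
      fix n
      show "linmap R (obj ?T n) (obj F n) li"
      proof (rule linmapI[OF cc_module[OF const_seqs_cx] cc_module[OF F]])
        fix x y assume "x \<in> carrier (obj ?T n)" "y \<in> carrier (obj ?T n)"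
        then obtain N N' where "\<forall>k\<ge>N. x k = li x" "\<forall>k\<ge>N'. y k = li y"
          unfolding sub_cx_simps(1) by (blast dest: li_ev)
        then show "li (x \<oplus>\<^bsub>obj ?T n\<^esub> y) = li x \<oplus>\<^bsub>obj F n\<^esub> li y"
          by (intro li[of "max N N'"]) simp
      next
        fix a x assume "x \<in> carrier (obj ?T n)"
        then obtain N where "\<forall>k\<ge>N. x k = li x" unfolding sub_cx_simps(1) by (blast dest: li_ev)
        then show "li (a \<odot>\<^bsub>obj ?T n\<^esub> x) = a \<odot>\<^bsub>obj F n\<^esub> li x" by (intro li[of N]) simp
      qed (simp add: li_c)
      fix x assume "x \<in> carrier (obj ?T (Suc n))"
      then obtain N where "\<forall>k\<ge>N. x k = li x" unfolding sub_cx_simps(1) by (blast dest: li_ev)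
      then show "li (dif ?T n x) = dif F n (li x)" by (intro li[of N]) simp
    qed
    show "inj_on (\<lambda>x. x) (carrier (obj ?S n))" for n by simp
    show "\<exists>x\<in>carrier (obj ?T n). li x = z" if z: "z \<in> carrier (obj F n)" for n z
    proof -
      obtain k where "z \<in> H k n" using un[of n] z by blast
      then have "(\<lambda>l. if k \<le> l then z else \<zero>\<^bsub>obj F n\<^esub>) \<in> const_seqs F H n"
        by (intro const_seqsI[where N = k and c = z]) (use H_closed(2) subsetD[OF mono] in auto)
      moreover have "li (\<lambda>l. if k \<le> l then z else \<zero>\<^bsub>obj F n\<^esub>) = z" by (rule li[of k]) simp
      ultimately show ?thesis unfolding sub_cx_simps(1) by blast
    qed
    show "li x = \<zero>\<^bsub>obj F n\<^esub>" if x: "x \<in> carrier (obj ?S n)" for n x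
    proof -
      obtain N where "\<forall>k\<ge>N. x k = \<zero>\<^bsub>obj F n\<^esub>" using x unfolding fin_seqs_def by auto
      then show ?thesis by (rule li)
    qed
    show "\<exists>x\<in>carrier (obj ?S n). x = y" if y: "y \<in> carrier (obj ?T n)" "li y = \<zero>\<^bsub>obj F n\<^esub>" for n y
    proof -
      obtain N where "\<forall>k\<ge>N. y k = \<zero>\<^bsub>obj F n\<^esub>"
        using y li_ev[of y n] by auto
      then have "y \<in> fin_seqs F H n" by (intro fin_seqsI[where N = N]) (use y in \<open>auto simp: const_seqs_def\<close>)
      then show ?thesis by simp
    qed
  qed
qed

end

text \<open>Eilenberg swindle: with \<open>e = \<iota>\<pi>\<close>, the complex \<open>Z\<close> is the cofibre of the endomorphism
  \<open>x \<mapsto> (x\<^sub>n - e x\<^sub>n + e x\<^bsub>n-1\<^esub>)\<^sub>n\<close> of the countable power of \<open>X\<close>.\<close>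
lemma in_class_retract:
  fixes X :: "('r,'c) cx" and e0 :: "'c \<Rightarrow> 'a"
  assumes inf: "infinite (UNIV :: 'a set)" and e0: "inj e0"
    and X: "in_class R A TYPE('a) X" and Z: "embeds TYPE('a) Z"
    and \<iota>: "chain_map R Z X \<iota>" and \<pi>: "chain_map R X Z \<pi>"
    and id: "\<And>n z. z \<in> carrier (obj Z n) \<Longrightarrow> \<pi> n (\<iota> n z) = z"
  shows "in_class R A TYPE('a) Z"
proof -
  note Xc = cm_dom[OF \<pi>] and Zc = cm_cod[OF \<pi>]
  \<comment> \<open>The constant family, for which the eventually zero sequences form the countable
    power of \<open>X\<close>.\<close>
  define H where "H k n = carrier (obj X n)" for k n :: nat
  have H: "submodule (H k n) R (obj X n)" for k n
    unfolding H_def by (rule module.carrier_is_submodule[OF cc_module[OF Xc]])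
  have dH: "x \<in> H k (Suc n) \<Longrightarrow> dif X n x \<in> H k n" for k n x
    unfolding H_def by (rule linmap_closed[OF cc_lin[OF Xc]])
  let ?S = "sub_cx (seq_cx X) (fin_seqs X H)"
  have "sub_cx X (H k) = X" for k by (simp add: sub_cx_def H_def)
  then have "in_class R A TYPE('a) (sub_cx X (H k))" for k using X by (simp only:)
  note S = in_class_fin_seqs[OF Xc H dH inf e0 this]
  have Sc: "chain_complex R ?S" by (rule fin_seqs_cx[OF Xc H dH])
  define e where "e n x = \<iota> n (\<pi> n x)" for n x
  have ecm: "chain_map R X X e" unfolding e_def by (rule chain_map_comp[OF \<pi> \<iota>])
  note el = cm_lin[OF ecm]
  note ec = linmap_closed[OF el]
  have ee: "e n (e n x) = e n x" if "x \<in> carrier (obj X n)" for n x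
    using that id linmap_closed[OF cm_lin[OF \<pi>]] by (simp add: e_def)
  define a where "a n x = x \<ominus>\<^bsub>obj X n\<^esub> e n x" for n x
  have al: "linmap R (obj X n) (obj X n) (a n)" for n
    unfolding a_def by (rule linmap_minus_map[OF linmap_ident[OF cc_module[OF Xc]] el])
  note ac = linmap_closed[OF al]
  have acm: "chain_map R X X a"
  proof (rule chain_mapI[OF Xc Xc al])
    show "a n (dif X n x) = dif X n (a (Suc n) x)" if "x \<in> carrier (obj X (Suc n))" for n x
      using that by (simp add: a_def linmap_diff[OF cc_lin[OF Xc] _ ec] cm_comm[OF ecm])
  qed
  have aa: "a n (a n x) = a n x" and ae: "a n (e n x) = \<zero>\<^bsub>obj X n\<^esub>" and ea: "e n (a n x) = \<zero>\<^bsub>obj X n\<^esub>"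
    and sum: "a n x \<oplus>\<^bsub>obj X n\<^esub> e n x = x" if x: "x \<in> carrier (obj X n)" for n x
  proof -
    interpret M: module R "obj X n" by (rule cc_module[OF Xc])
    show ea: "e n (a n x) = \<zero>\<^bsub>obj X n\<^esub>"
      using linmap_diff[OF el x ec[OF x]] ee[OF x] ec[OF x] by (simp add: a_def a_minus_def M.M.r_neg)
    show "a n (a n x) = a n x" using ea ac[OF x] by (simp add: a_def[of n "a n x"] a_minus_def)
    show "a n (e n x) = \<zero>\<^bsub>obj X n\<^esub>" using ee x ec by (simp add: a_def a_minus_def M.M.r_neg)
    show "a n x \<oplus>\<^bsub>obj X n\<^esub> e n x = x" using x ec by (simp add: a_def a_minus_def M.M.a_assoc M.M.l_neg)
  qed
  \<comment> \<open>\<open>X\<close> splits into the image of \<open>a\<close> and the image of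
    \<open>e\<close>. The map \<open>f\<close> is the identity on the first part and shifts the
    second by one place, so only the copy of \<open>Z\<close> in place 0 is missed; \<open>g\<close>
    shifts back. The complement of \<open>Z\<close> cancels without having to be in the
    class.\<close>
  define f where "f n x = (\<lambda>k. a n (x k) \<oplus>\<^bsub>obj X n\<^esub> (case k of 0 \<Rightarrow> \<zero>\<^bsub>obj X n\<^esub> | Suc l \<Rightarrow> e n (x l)))" for n x
  define g where "g n x = (\<lambda>k. a n (x k) \<oplus>\<^bsub>obj X n\<^esub> e n (x (Suc k)))" for n and x :: "nat \<Rightarrow> 'c"
  have carr: "x k \<in> carrier (obj X n)" if "x \<in> carrier (obj ?S n)" for x k n
    using that by (simp add: fin_seqs_def H_def)
  have fS: "f n x \<in> carrier (obj ?S n)" and gS: "g n x \<in> carrier (obj ?S n)" if x: "x \<in> carrier (obj ?S n)" for n x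
  proof -
    interpret M: module R "obj X n" by (rule cc_module[OF Xc])
    obtain N where "\<forall>k\<ge>N. x k = \<zero>\<^bsub>obj X n\<^esub>" using x unfolding fin_seqs_def by auto
    then have "\<forall>k\<ge>Suc N. f n x k = \<zero>\<^bsub>obj X n\<^esub>" "\<forall>k\<ge>N. g n x k = \<zero>\<^bsub>obj X n\<^esub>"
      by (auto simp: f_def g_def linmap_zero[OF al] linmap_zero[OF el] split: nat.split)
    moreover have "f n x k \<in> carrier (obj X n)" "g n x k \<in> carrier (obj X n)" for k
      using carr[OF x] by (auto simp: f_def g_def ac ec split: nat.split)
    ultimately show "f n x \<in> carrier (obj ?S n)" "g n x \<in> carrier (obj ?S n)"
      by (auto simp: fin_seqs_def H_def simp del: One_nat_def)
  qed
  have fcm: "chain_map R ?S ?S f"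
  proof (rule chain_mapI[OF Sc Sc])
    fix n
    interpret M: module R "obj X n" by (rule cc_module[OF Xc])
    show "linmap R (obj ?S n) (obj ?S n) (f n)"
    proof (rule linmapI[OF cc_module[OF Sc] cc_module[OF Sc] fS])
      show "f n (x \<oplus>\<^bsub>obj ?S n\<^esub> y) = f n x \<oplus>\<^bsub>obj ?S n\<^esub> f n y"
        if x: "x \<in> carrier (obj ?S n)" and y: "y \<in> carrier (obj ?S n)" for x y
        using carr[OF x] carr[OF y]
        by (auto simp: f_def fun_eq_iff linmap_add[OF al] linmap_add[OF el] ac ec M.M.a_ac split: nat.split)
      show "f n (c \<odot>\<^bsub>obj ?S n\<^esub> x) = c \<odot>\<^bsub>obj ?S n\<^esub> f n x"
        if c: "c \<in> carrier R" and x: "x \<in> carrier (obj ?S n)" for c x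
        using c carr[OF x]
        by (auto simp: f_def fun_eq_iff linmap_smult[OF al] linmap_smult[OF el] ac ec M.smult_r_distr split: nat.split)
    qed
    show "f n (dif ?S n x) = dif ?S n (f (Suc n) x)" if x: "x \<in> carrier (obj ?S (Suc n))" for x
    proof -
      interpret M': module R "obj X (Suc n)" by (rule cc_module[OF Xc])
      show ?thesis
        using carr[OF x]
        by (auto simp: f_def fun_eq_iff linmap_add[OF cc_lin[OF Xc]] ac ec cm_comm[OF acm] cm_comm[OF ecm]
          linmap_zero[OF cc_lin[OF Xc]] split: nat.split)
    qed
  qed
  have gf: "g n (f n x) = x" if x: "x \<in> carrier (obj ?S n)" for n x
  proof
    fix k
    interpret M: module R "obj X n" by (rule cc_module[OF Xc])
    show "g n (f n x) k = x k"
      using carr[OF x]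
      by (auto simp: g_def f_def linmap_add[OF al] linmap_add[OF el] ac ec aa ae ea ee sum
        linmap_zero[OF al] split: nat.split)
  qed
  have fg: "f n (g n y) = y" if y: "y \<in> carrier (obj ?S n)" and y0: "\<pi> n (y 0) = \<zero>\<^bsub>obj Z n\<^esub>" for n y
  proof
    fix k
    interpret M: module R "obj X n" by (rule cc_module[OF Xc])
    have "e n (y 0) = \<zero>\<^bsub>obj X n\<^esub>" using y0 linmap_zero[OF cm_lin[OF \<iota>]] by (simp add: e_def)
    then have "a n (y 0) = y 0" using sum[OF carr[OF y], of 0] carr[OF y, of 0] ac[OF carr[OF y, of 0]] by simp
    then show "f n (g n y) k = y k"
      using carr[OF y]
      by (auto simp: g_def f_def linmap_add[OF al] linmap_add[OF el] ac ec aa ae ea ee sum split: nat.split)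
  qed
  have \<pi>a: "\<pi> n (a n x) = \<zero>\<^bsub>obj Z n\<^esub>" if x: "x \<in> carrier (obj X n)" for n x
  proof -
    have "\<pi> n (a n x) = \<pi> n (\<iota> n (\<pi> n (a n x)))"
      using id linmap_closed[OF cm_lin[OF \<pi>] ac[OF x]] by simp
    also have "\<iota> n (\<pi> n (a n x)) = \<zero>\<^bsub>obj X n\<^esub>" using ea[OF x] by (simp add: e_def)
    finally show ?thesis using linmap_zero[OF cm_lin[OF \<pi>]] by simp
  qed
  show ?thesis
  proof (rule in_class_cofib[OF S S Z fcm, of "\<lambda>n x. \<pi> n (x 0)"])
    show "chain_map R ?S Z (\<lambda>n x. \<pi> n (x 0))"
      by (rule chain_map_comp[of R ?S X "\<lambda>n x. x 0", OF _ \<pi>])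
        (intro chain_mapI Sc Xc linmapI cc_module, auto simp: fin_seqs_def H_def)
    show "inj_on (f n) (carrier (obj ?S n))" for n by (rule inj_on_inverseI) (rule gf)
    show "\<exists>y\<in>carrier (obj ?S n). \<pi> n (y 0) = z" if z: "z \<in> carrier (obj Z n)" for n z
    proof -
      interpret M: module R "obj X n" by (rule cc_module[OF Xc])
      show ?thesis
        using id[OF z] linmap_closed[OF cm_lin[OF \<iota>] z]
        by (intro bexI[of _ "\<lambda>k. if k = 0 then \<iota> n z else \<zero>\<^bsub>obj X n\<^esub>"])
          (auto simp: fin_seqs_def H_def intro!: exI[of _ "Suc 0"])
    qed
    show "\<pi> n (f n x 0) = \<zero>\<^bsub>obj Z n\<^esub>" if x: "x \<in> carrier (obj ?S n)" for n x
    proof -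
      interpret M: module R "obj X n" by (rule cc_module[OF Xc])
      show ?thesis using carr[OF x, of 0] by (simp add: f_def ac \<pi>a)
    qed
    show "\<exists>x\<in>carrier (obj ?S n). f n x = y"
      if "y \<in> carrier (obj ?S n)" "\<pi> n (y 0) = \<zero>\<^bsub>obj Z n\<^esub>" for n y
      using fg[OF that] gS[OF that(1)] by blast
  qed
qed

section \<open>Complexes of ideals\<close>

locale plain_cring = cring R for R :: "'r ring" (structure)

text \<open>The properties of \<open>r\<close> from which the rest is derived. With
  \<open>r = 0\<close> the interval complexes would split into single copies of \<open>R\<close>,
  and the second component of the order would be invisible.\<close>

locale square_zero = plain_cring R for R :: "'r ring" (structure) and r +
  assumes r_closed [simp]: "r \<in> carrier R" and rr: "r \<otimes> r = \<zero>" and r_nonzero: "r \<noteq> \<zero>"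
    and annihilator: "x \<in> carrier R \<Longrightarrow> r \<otimes> x = \<zero> \<Longrightarrow> \<exists>y\<in>carrier R. x = r \<otimes> y"

text \<open>The annihilator of \<open>r\<close> is an ideal that contains \<open>m\<close>, because
  \<open>m\<close> squares to zero, and is proper, because \<open>r\<close> is nonzero. By
  maximality it equals \<open>m\<close>, the ideal generated by \<open>r\<close>.\<close>

lemma square_zeroI:
  fixes R :: "'r ring"
  assumes loc: "local_ring R m" and r: "r \<in> carrier R" and m: "m = PIdl\<^bsub>R\<^esub> r"
    and sq: "\<forall>a\<in>m. \<forall>b\<in>m. a \<otimes>\<^bsub>R\<^esub> b = \<zero>\<^bsub>R\<^esub>" and nz: "m \<noteq> {\<zero>\<^bsub>R\<^esub>}"
  shows "square_zero R r"
proof -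
  interpret cring R using loc by (simp add: local_ring_def)
  have max: "maximalideal m R" using loc by (simp add: local_ring_def)
  have rm: "r \<in> m" using cgenideal_self[OF r] m by simp
  have rr: "r \<otimes>\<^bsub>R\<^esub> r = \<zero>\<^bsub>R\<^esub>" using sq rm by blast
  have r0: "r \<noteq> \<zero>\<^bsub>R\<^esub>"
  proof
    assume "r = \<zero>\<^bsub>R\<^esub>"
    then have "m \<subseteq> {\<zero>\<^bsub>R\<^esub>}" using m by (auto simp: cgenideal_def)
    then show False using nz rm r \<open>r = \<zero>\<^bsub>R\<^esub>\<close> by auto
  qed
  let ?I = "{x \<in> carrier R. r \<otimes>\<^bsub>R\<^esub> x = \<zero>\<^bsub>R\<^esub>}"
  have I: "ideal ?I R"
  proof (rule idealI[OF ring_axioms])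
    show "subgroup ?I (add_monoid R)"
    proof (rule subgroup.intro)
      show "inv\<^bsub>add_monoid R\<^esub> x \<in> ?I" if "x \<in> ?I" for x
        using that r unfolding a_inv_def[symmetric] by (simp add: r_minus)
    qed (use r in \<open>auto simp: r_distr\<close>)
    show "a \<in> ?I \<Longrightarrow> x \<in> carrier R \<Longrightarrow> x \<otimes>\<^bsub>R\<^esub> a \<in> ?I" for a x using r m_lcomm[of r x a] by simp
    show "a \<in> ?I \<Longrightarrow> x \<in> carrier R \<Longrightarrow> a \<otimes>\<^bsub>R\<^esub> x \<in> ?I" for a x using r by (simp add: m_assoc[symmetric])
  qed
  have mI: "m \<subseteq> ?I"
  proof
    fix x assume "x \<in> m"
    moreover from this have "x \<in> carrier R" using m r by (auto simp: cgenideal_def)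
    ultimately show "x \<in> ?I" using sq rm by blast
  qed
  have "?I = m \<or> ?I = carrier R"
    by (rule maximalideal.I_maximal[OF max I mI]) auto
  moreover have "?I \<noteq> carrier R"
  proof
    assume eq: "?I = carrier R"
    have "\<one>\<^bsub>R\<^esub> \<in> ?I" by (subst eq) simp
    then show False using r0 r by simp
  qed
  ultimately have "?I = m" by blast
  then have ann: "\<exists>y\<in>carrier R. x = r \<otimes>\<^bsub>R\<^esub> y" if "x \<in> carrier R" "r \<otimes>\<^bsub>R\<^esub> x = \<zero>\<^bsub>R\<^esub>" for x
  proof -
    have "x \<in> PIdl\<^bsub>R\<^esub> r" using that \<open>?I = m\<close> m by blast
    then show ?thesis using r by (auto simp: cgenideal_def m_comm)
  qed
  show ?thesis by unfold_locales (use r rr r0 ann in auto)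
qed

text \<open>Every module is an ideal and every differential a multiplication, which covers both the
  intervals and the maximal ideal in a single degree. The conditions on complexes and maps thereby
  become identities in \<open>R\<close>.\<close>

definition ideal_cx :: "'r ring \<Rightarrow> (nat \<Rightarrow> 'r set) \<Rightarrow> (nat \<Rightarrow> 'r) \<Rightarrow> ('r,'r) cx" where
  "ideal_cx R I c = \<lparr>obj = (\<lambda>n. (ring_mod R)\<lparr>carrier := I n\<rparr>), dif = (\<lambda>n x. c n \<otimes>\<^bsub>R\<^esub> x)\<rparr>"

lemma ideal_cx_simps [simp]:
  "carrier (obj (ideal_cx R I c) n) = I n" "\<zero>\<^bsub>obj (ideal_cx R I c) n\<^esub> = \<zero>\<^bsub>R\<^esub>"
  "x \<oplus>\<^bsub>obj (ideal_cx R I c) n\<^esub> y = x \<oplus>\<^bsub>R\<^esub> y" "a \<odot>\<^bsub>obj (ideal_cx R I c) n\<^esub> x = a \<otimes>\<^bsub>R\<^esub> x"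
  "dif (ideal_cx R I c) n x = c n \<otimes>\<^bsub>R\<^esub> x"
  by (simp_all add: ideal_cx_def ring_mod_def)

text \<open>\<open>interval_cx R c S\<close> has \<open>R\<close> in the degrees in \<open>S\<close>, with differential \<open>c\<close> between consecutive
  ones; \<open>\<Sigma>\<^sup>i E\<^sub>j\<close> is the case of an interval, up to sign.\<close>
definition interval_cx :: "'r ring \<Rightarrow> 'r \<Rightarrow> nat set \<Rightarrow> ('r,'r) cx" where
  "interval_cx R c S = ideal_cx R (\<lambda>n. if n \<in> S then carrier R else {\<zero>\<^bsub>R\<^esub>})
     (\<lambda>n. if n \<in> S \<and> Suc n \<in> S then c else \<zero>\<^bsub>R\<^esub>)"

definition max_ideal_cx :: "'r ring \<Rightarrow> 'r \<Rightarrow> nat \<Rightarrow> ('r,'r) cx" where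
  "max_ideal_cx R r i = ideal_cx R (\<lambda>n. if n = i then {r \<otimes>\<^bsub>R\<^esub> y | y. y \<in> carrier R} else {\<zero>\<^bsub>R\<^esub>})
     (\<lambda>n. \<zero>\<^bsub>R\<^esub>)"

context plain_cring
begin

lemma module_ring_mod: "module R (ring_mod R)"
proof (rule moduleI[OF is_cring])
  show "abelian_group (ring_mod R)"
  proof (rule abelian_groupI)
    fix x assume "x \<in> carrier (ring_mod R)"
    then show "\<exists>y\<in>carrier (ring_mod R). y \<oplus>\<^bsub>ring_mod R\<^esub> x = \<zero>\<^bsub>ring_mod R\<^esub>"
      by (intro bexI[of _ "\<ominus> x"]) (simp_all add: ring_mod_def l_neg)
  qed (simp_all add: ring_mod_def a_ac)
qed (simp_all add: ring_mod_def l_distr r_distr m_assoc)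

lemma submodule_ring_mod:
  assumes "I \<subseteq> carrier R" "\<zero> \<in> I" "\<And>x y. x \<in> I \<Longrightarrow> y \<in> I \<Longrightarrow> x \<oplus> y \<in> I"
    "\<And>a x. a \<in> carrier R \<Longrightarrow> x \<in> I \<Longrightarrow> a \<otimes> x \<in> I"
  shows "submodule I R (ring_mod R)"
  by (rule submoduleI'[OF module_ring_mod]) (use assms in \<open>auto simp: ring_mod_def\<close>)

lemma chain_complex_ideal_cx:
  assumes I: "\<And>n. submodule (I n) R (ring_mod R)" and c: "\<And>n. c n \<in> carrier R"
    and cI: "\<And>n x. x \<in> I (Suc n) \<Longrightarrow> c n \<otimes> x \<in> I n"
    and cc: "\<And>n x. x \<in> I (Suc (Suc n)) \<Longrightarrow> c n \<otimes> (c (Suc n) \<otimes> x) = \<zero>"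
  shows "chain_complex R (ideal_cx R I c)"
proof -
  have M: "module R (obj (ideal_cx R I c) n)" for n
    using submodule_restrict[OF module_ring_mod I] by (simp add: ideal_cx_def)
  have sub: "x \<in> carrier R" if "x \<in> I n" for x n
    using submodule_subset[OF I] that by (auto simp: ring_mod_def)
  show ?thesis
    unfolding chain_complex_def
    by (intro conjI allI ballI M linmapI) (auto simp: cI cc r_distr c sub m_lcomm)
qed

lemma chain_map_ideal_cx:
  assumes X: "chain_complex R (ideal_cx R I c)" and Y: "chain_complex R (ideal_cx R J d)"
    and sub: "\<And>n. I n \<subseteq> carrier R"
    and g: "\<And>n. g n \<in> carrier R" and gI: "\<And>n x. x \<in> I n \<Longrightarrow> g n \<otimes> x \<in> J n"
    and comm: "\<And>n x. x \<in> I (Suc n) \<Longrightarrow> g n \<otimes> (c n \<otimes> x) = d n \<otimes> (g (Suc n) \<otimes> x)"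
  shows "chain_map R (ideal_cx R I c) (ideal_cx R J d) (\<lambda>n x. g n \<otimes> x)"
proof -
  have sub': "x \<in> carrier R" if "x \<in> I n" for x n using sub that by blast
  show ?thesis
    by (intro chain_mapI X Y linmapI cc_module) (auto simp: gI comm r_distr g sub' m_lcomm)
qed

lemma interval_cx:
  assumes c: "c \<in> carrier R" "c \<otimes> c = \<zero>"
  shows "chain_complex R (interval_cx R c S)"
  unfolding interval_cx_def
proof (rule chain_complex_ideal_cx)
  show "submodule (if n \<in> S then carrier R else {\<zero>}) R (ring_mod R)" for n
    by (rule submodule_ring_mod) (auto split: if_splits)
qed (use c in \<open>auto split: if_splits simp: m_assoc[symmetric]\<close>)

text \<open>Rescaling degree \<open>n\<close> by the sign of parity \<open>n\<close> reverses the
  sign of every differential.\<close>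

lemma interval_cx_neg_iso:
  assumes c: "c \<in> carrier R" "c \<otimes> c = \<zero>"
  shows "cx_iso R (interval_cx R (\<ominus> c) S) (interval_cx R c S)"
proof -
  let ?g = "\<lambda>n :: nat. if even n then \<one> else \<ominus> \<one>"
  have c': "\<ominus> c \<in> carrier R" "\<ominus> c \<otimes> \<ominus> c = \<zero>" using c by (simp_all add: l_minus r_minus)
  note X = interval_cx[OF c'] and Y = interval_cx[OF c]
  show ?thesis
  proof (rule cx_isoI2[where f = "\<lambda>n x. ?g n \<otimes> x" and g = "\<lambda>n x. ?g n \<otimes> x"])
    show "chain_map R (interval_cx R (\<ominus> c) S) (interval_cx R c S) (\<lambda>n x. ?g n \<otimes> x)"
      unfolding interval_cx_def
      by (rule chain_map_ideal_cx[OF X[unfolded interval_cx_def] Y[unfolded interval_cx_def]])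
        (use c in \<open>auto split: if_splits simp: l_minus r_minus\<close>)
    show "chain_map R (interval_cx R c S) (interval_cx R (\<ominus> c) S) (\<lambda>n x. ?g n \<otimes> x)"
      unfolding interval_cx_def
      by (rule chain_map_ideal_cx[OF Y[unfolded interval_cx_def] X[unfolded interval_cx_def]])
        (use c in \<open>auto split: if_splits simp: l_minus r_minus\<close>)
  qed (auto simp: interval_cx_def l_minus split: if_splits)
qed

lemma module_zero_mod: "module R (zero_mod R)"
proof (rule moduleI[OF is_cring])
  show "abelian_group (zero_mod R)"
    by (rule abelian_groupI) (simp_all add: zero_mod_def)
qed (simp_all add: zero_mod_def)

lemma chain_complex_zero_cx: "chain_complex R (zero_cx R)"
  unfolding chain_complex_def
  by (intro conjI allI ballI linmapI) (auto simp: zero_cx_def module_zero_mod, auto simp: zero_mod_def)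

lemma acyclic_zero_cx: "acyclic R (zero_cx R)"
proof -
  have "exact_at (zero_cx R) n" for n
    unfolding exact_at_def
    by (auto simp: cycles_iff boundaries_def zero_cx_def zero_mod_def)
  then show ?thesis by (simp add: acyclic_iff chain_complex_zero_cx)
qed

text \<open>The sign depends on \<open>i\<close> alone, so it is the same in all degrees and can be
  rescaled away. Outside the interval the two module records differ although their carriers agree,
  hence an isomorphism and no equality.\<close>

lemma sigmaE_iso_interval_cx:
  assumes r: "r \<in> carrier R" "r \<otimes> r = \<zero>"
  shows "cx_iso R (sigmaE R r i j) (interval_cx R r {i..i+j})"
proof -
  define c where "c = (if even i then r else \<ominus> r)"
  have c: "c \<in> carrier R" "c \<otimes> c = \<zero>" using r by (simp_all add: c_def l_minus r_minus)
  note Y = interval_cx[OF c, of "{i..i+j}"]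
  have M: "module R (obj (sigmaE R r i j) n)" for n
    by (simp add: sigmaE_def module_ring_mod module_zero_mod)
  have s: "carrier (obj (sigmaE R r i j) n) = (if n \<in> {i..i+j} then carrier R else {\<zero>})"
    "\<zero>\<^bsub>obj (sigmaE R r i j) n\<^esub> = \<zero>" "x \<oplus>\<^bsub>obj (sigmaE R r i j) n\<^esub> y = x \<oplus> y"
    "a \<odot>\<^bsub>obj (sigmaE R r i j) n\<^esub> x = a \<otimes> x"
    "dif (sigmaE R r i j) n x = (if n \<in> {i..i+j} \<and> Suc n \<in> {i..i+j} then c \<otimes> x else \<zero>)" for n x y a
    by (auto simp: sigmaE_def ring_mod_def zero_mod_def c_def)
  have d: "linmap R (obj (sigmaE R r i j) (Suc n)) (obj (sigmaE R r i j) n) (dif (sigmaE R r i j) n)" for n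
    by (rule linmapI[OF M M]) (use c in \<open>auto simp: s r_distr m_lcomm\<close>)
  have X: "chain_complex R (sigmaE R r i j)"
    unfolding chain_complex_def
    by (intro conjI allI ballI M d) (use c in \<open>auto simp: s m_assoc[symmetric] split: if_splits\<close>)
  have "cx_iso R (sigmaE R r i j) (interval_cx R c {i..i+j})"
    by (rule cx_isoI2[where f = "\<lambda>n x. x" and g = "\<lambda>n x. x"]; (intro chain_mapI X Y linmapI M cc_module)?)
      (use c in \<open>auto simp: s interval_cx_def split: if_splits\<close>)
  moreover have "cx_iso R (interval_cx R c {i..i+j}) (interval_cx R r {i..i+j})"
    using interval_cx_neg_iso[OF r] cx_iso_refl[OF interval_cx[OF r]] by (simp add: c_def)
  ultimately show ?thesis by (rule cx_iso_trans)
qed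

end

lemma cx_iso_same:
  assumes X: "chain_complex R X" and Y: "chain_complex R Y" and o: "\<And>n. obj X n = obj Y n"
    and d: "\<And>n x. x \<in> carrier (obj X (Suc n)) \<Longrightarrow> dif X n x = dif Y n x"
  shows "cx_iso R X Y"
proof (rule cx_isoI2)
  show "chain_map R X Y (\<lambda>n x. x)"
    by (intro chain_mapI X Y linmapI cc_module) (auto simp: o d)
  show "chain_map R Y X (\<lambda>n x. x)"
    by (intro chain_mapI X Y linmapI cc_module) (auto simp: o d)
qed auto

section \<open>Invariants of the interval complexes: necessity of the order\<close>

context square_zero
begin

abbreviation "E \<equiv> interval_cx R r"

lemma E_cc: "chain_complex R (E S)"
  by (rule interval_cx[OF r_closed rr])

lemma E_carrier: "carrier (obj (E S) n) = (if n \<in> S then carrier R else {\<zero>})"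
  and E_dif: "dif (E S) n x = (if n \<in> S \<and> Suc n \<in> S then r else \<zero>) \<otimes> x"
  and E_zero: "\<zero>\<^bsub>obj (E S) n\<^esub> = \<zero>" and E_add: "x \<oplus>\<^bsub>obj (E S) n\<^esub> y = x \<oplus> y"
  and E_smult: "a \<odot>\<^bsub>obj (E S) n\<^esub> x = a \<otimes> x"
  by (simp_all add: interval_cx_def)

lemma E_exact:
  assumes "n \<notin> S" shows "exact_at (E S) n"
proof -
  interpret M: module R "obj (E S) (Suc n)" by (rule cc_module[OF E_cc])
  show ?thesis
    using boundaries_zero[OF E_cc, of S n] assms
    by (auto simp: exact_at_def cycles_iff E_carrier E_zero)
qed

text \<open>At the bottom of an interval the element 1 is a cycle. Boundaries are killed by
  \<open>r\<close>, whereas \<open>r\<close> times 1 is nonzero.\<close>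

lemma E_not_exact:
  assumes "n \<in> S" "\<And>k. n = Suc k \<Longrightarrow> k \<notin> S" shows "\<not> exact_at (E S) n"
proof
  assume "exact_at (E S) n"
  moreover have "\<one> \<in> cycles (E S) n" using assms by (auto simp: cycles_iff E_carrier E_dif E_zero)
  ultimately obtain w where w: "w \<in> carrier (obj (E S) (Suc n))" "\<one> = dif (E S) n w"
    by (rule exact_atE)
  then have w': "w \<in> carrier R" by (auto simp: E_carrier split: if_splits)
  have "r \<otimes> \<one> = r \<otimes> dif (E S) n w" using w(2) by simp
  also have "\<dots> = \<zero>" using w' by (simp add: E_dif m_assoc[symmetric] rr)
  finally show False using r_nonzero by simp
qed

lemma E_extendable: "extendable (E {i..i+j}) r i j"
  unfolding extendable_def
proof
  fix y assume "y \<in> cycles (E {i..i+j}) i"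
  then have "rchain (E {i..i+j}) r i j (\<lambda>_. y)"
    by (simp add: rchain_def E_carrier E_dif E_smult cycles_iff)
  then show "\<exists>z. rchain (E {i..i+j}) r i j z \<and> z 0 = y" by (intro exI) auto
qed

text \<open>Suppose that 1 in degree \<open>i\<close> extends. Inside the interval the chain
  condition reads \<open>r y_n = r y_(n+1)\<close>, so \<open>r y_n = r\<close> up to the top. The
  next term lies outside the interval and is zero, which forces \<open>r = 0\<close>.\<close>

lemma E_not_extendable:
  assumes "j' < j" shows "\<not> extendable (E {i..i+j'}) r i j"
proof
  assume *: "extendable (E {i..i+j'}) r i j"
  have "\<one> \<in> cycles (E {i..i+j'}) i" by (auto simp: cycles_iff E_carrier E_dif E_zero)
  then obtain y where y: "rchain (E {i..i+j'}) r i j y" "y 0 = \<one>" using * unfolding extendable_def by blast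
  have d: "r \<otimes> y n = dif (E {i..i+j'}) (i + n) (y (Suc n))" if "n \<le> j'" for n
    using y that assms by (simp add: rchain_def E_smult)
  have "r \<otimes> y n = r" if "n \<le> j'" for n
    using that
  proof (induction n)
    case (Suc n)
    then have "r \<otimes> y (Suc n) = r \<otimes> y n" using d[of n] by (simp add: E_dif)
    then show ?case using Suc by simp
  qed (simp add: y)
  moreover have "y (Suc j') = \<zero>"
  proof -
    have "y (Suc j') \<in> carrier (obj (E {i..i+j'}) (i + Suc j'))"
      using y(1) Suc_leI[OF assms] unfolding rchain_def by blast
    then show ?thesis by (simp add: E_carrier)
  qed
  ultimately have "r = \<zero>" using d[of j'] by (simp add: E_dif)
  then show False using r_nonzero by simp
qed

text \<open>Exactness below degree \<open>i\<close> separates different lowest degrees. If these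
  agree, extendability at that degree separates the lengths.\<close>

lemma E_order:
  assumes "gg R (sigmaE R r i j) Y" "cx_iso R (sigmaE R r i' j') Y"
  shows "(i, j) \<le> (i', j')"
proof -
  obtain p where p: "weq R (E {i..i+j}) (sigmaE R r i j) p"
    using sigmaE_iso_interval_cx[OF r_closed rr] cx_iso_sym cx_iso_weqE by metis
  obtain q where q: "weq R Y (E {i'..i'+j'}) q"
    using cx_iso_trans[OF cx_iso_sym[OF assms(2)] sigmaE_iso_interval_cx[OF r_closed rr]] cx_iso_weqE by metis
  have ex: "exact_at (sigmaE R r i j) n" if "n < i" for n
    by (rule exact_at_weq_fwd[OF p E_exact]) (use that in simp)
  have "exact_at (E {i'..i'+j'}) n" if "n < i" for n
    by (rule exact_at_weq_fwd[OF q gg_exact_below[OF assms(1) ex that]])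
  moreover have "\<not> exact_at (E {i'..i'+j'}) i'" by (rule E_not_exact) auto
  ultimately have ii: "i \<le> i'" by (meson not_less)
  have "extendable (sigmaE R r i j) r i j"
    by (rule extendable_weq_fwd[OF p r_closed rr E_extendable])
  then have "extendable Y r i j" using gg_extendable[OF assms(1) r_closed rr ex] by blast
  then have "extendable (E {i'..i'+j'}) r i j" by (rule extendable_weq_fwd[OF q r_closed rr])
  then have "i' = i \<Longrightarrow> j \<le> j'" using E_not_extendable by (meson not_less)
  then show ?thesis using ii by (auto simp: le_less)
qed

end

section \<open>Building the larger intervals: sufficiency of the order\<close>

locale square_zero_class = square_zero R r for R :: "'r ring" (structure) and r +
  fixes e :: "'r \<Rightarrow> 'a" and A :: "('r,'b) cx"
  assumes inf: "infinite (UNIV :: 'a set)" and e_inj: "inj e"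
begin

lemma emb: "embeds TYPE('a) (Z :: ('r,'r) cx)"
  by (rule embedsI[of e]) (use e_inj in \<open>auto intro: inj_on_subset\<close>)

text \<open>\<open>E T\<close>, suspended, is placed next to \<open>E S\<close>. The first condition
  keeps the degrees disjoint; the second forbids a differential from \<open>S\<close> into the
  shifted \<open>T\<close>, so that \<open>E S\<close> is a subcomplex. Differentials in the other
  direction are welcome and produce the splicing.\<close>

lemma C_E_extension:
  assumes S: "in_class R A TYPE('a) (E S)" and T: "in_class R A TYPE('a) (E T)" and ST: "\<And>n. n \<in> T \<Longrightarrow> Suc n \<notin> S \<and> Suc (Suc n) \<notin> S"
  shows "in_class R A TYPE('a) (E (S \<union> Suc ` T))"
proof -
  have nr: "\<ominus> r \<in> carrier R" "\<ominus> r \<otimes> \<ominus> r = \<zero>" by (simp_all add: l_minus r_minus rr)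
  \<comment> \<open>Suspension reverses the sign of the differential, so \<open>-r\<close> is taken
    here in order to obtain \<open>r\<close> in \<open>?W\<close>.\<close>
  let ?X = "interval_cx R (\<ominus> r) T" and ?W = "E (S \<union> Suc ` T)"
  have X: "in_class R A TYPE('a) ?X" by (rule in_class_iso[OF T interval_cx_neg_iso[OF r_closed rr]])
  note Xc = interval_cx[OF nr, of T]
  have carr: "carrier (obj ?X n) = (if n \<in> T then carrier R else {\<zero>})" for n
    by (simp add: interval_cx_def)
  let ?p = "\<lambda>n x. if n \<in> T then x else \<zero>"
  have Xm: "\<ominus>\<^bsub>obj ?X n\<^esub> x = \<ominus> x" if "x \<in> carrier (obj ?X n)" for x n
  proof -
    interpret M: module R "obj ?X n" by (rule cc_module[OF Xc])
    have xR: "x \<in> carrier R" using that by (auto simp: carr split: if_splits)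
    have "\<ominus> x \<in> carrier (obj ?X n)" using that by (auto simp: carr split: if_splits)
    moreover have "\<ominus> x \<oplus>\<^bsub>obj ?X n\<^esub> x = \<zero>\<^bsub>obj ?X n\<^esub>"
      using xR by (simp add: interval_cx_def l_neg)
    ultimately show ?thesis using that by (intro M.M.minus_equality)
  qed
  show ?thesis
  proof (rule in_class_extension[OF inf e_inj X S, of ?W "\<lambda>n x. x" ?p])
    show "chain_map R (E S) ?W (\<lambda>n x. x)"
      by (intro chain_mapI E_cc linmapI cc_module)
        (use ST in \<open>auto simp: E_carrier E_add E_smult E_dif split: if_splits\<close>)
    show "chain_complex R ?X" by (rule Xc)
    show "linmap R (obj ?W (Suc n)) (obj ?X n) (?p n)" for n
      by (intro linmapI cc_module[OF E_cc] cc_module[OF Xc])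
        (auto simp: E_carrier carr E_add E_smult interval_cx_def split: if_splits)
    fix n
    show "?p n (dif ?W (Suc n) w) = \<ominus>\<^bsub>obj ?X n\<^esub> dif ?X n (?p (Suc n) w)"
      if w: "w \<in> carrier (obj ?W (Suc (Suc n)))" for w
    proof -
      have wR: "w \<in> carrier R" using w by (auto simp: E_carrier split: if_splits)
      have pX: "?p (Suc n) w \<in> carrier (obj ?X (Suc n))" using wR by (simp add: carr)
      show ?thesis
        unfolding Xm[OF linmap_closed[OF cc_lin[OF Xc] pX]]
        using wR ST[of n] w by (auto simp: E_dif E_carrier interval_cx_def l_minus split: if_splits)
    qed
    show "inj_on (\<lambda>x. x) (carrier (obj (E S) n))" by simp
    show "(\<lambda>x. x) ` carrier (obj (E S) 0) = carrier (obj ?W 0)" by (auto simp: E_carrier)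
    show "?p n ` carrier (obj ?W (Suc n)) = carrier (obj ?X n)"
      by (auto simp: E_carrier carr image_iff split: if_splits)
    show "(\<lambda>x. x) ` carrier (obj (E S) (Suc n)) = {w \<in> carrier (obj ?W (Suc n)). ?p n w = \<zero>\<^bsub>obj ?X n\<^esub>}"
      using ST[of n] by (auto simp: E_carrier interval_cx_def split: if_splits)
  qed
qed

lemma C_E_empty: "in_class R A TYPE('a) (E {})"
  by (rule in_class_exact[OF E_cc E_exact emb]) simp

lemma C_E_suspension: "in_class R A TYPE('a) (E T) \<Longrightarrow> in_class R A TYPE('a) (E (Suc ` T))"
  using C_E_extension[OF C_E_empty, of T] by simp

lemma C_E_shift: "in_class R A TYPE('a) (E {a..b}) \<Longrightarrow> in_class R A TYPE('a) (E {a+k..b+k})"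
proof (induction k)
  case (Suc k)
  then show ?case using C_E_suspension[of "{a+k..b+k}"] by (simp add: image_Suc_atLeastAtMost)
qed simp

text \<open>The second interval starts at the top degree \<open>b\<close> of the first; after the
  suspension it starts at \<open>b + 1\<close>, directly above.\<close>

lemma C_E_glue:
  assumes "in_class R A TYPE('a) (E {a..b})" "in_class R A TYPE('a) (E {b..c})" "a \<le> b" "b \<le> c"
  shows "in_class R A TYPE('a) (E {a..Suc c})"
proof -
  have "{a..b} \<union> Suc ` {b..c} = {a..Suc c}" using assms(3,4) by (auto simp: image_Suc_atLeastAtMost)
  then show ?thesis using C_E_extension[OF assms(1,2)] by auto
qed

lemma C_E_long:
  assumes "in_class R A TYPE('a) (E {i..i+j})" shows "in_class R A TYPE('a) (E {i..i+j+k*(j+1)})"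
proof (induction k)
  case (Suc k)
  \<comment> \<open>The copy is shifted only to the present top degree, since the gluing suspends it
    once more.\<close>
  have "in_class R A TYPE('a) (E {i+(j+k*(j+1))..i+j+(j+k*(j+1))})" by (rule C_E_shift[OF assms])
  then have "in_class R A TYPE('a) (E {i+j+k*(j+1)..i+j+k*(j+1)+j})" by (simp add: algebra_simps)
  from C_E_glue[OF Suc this] show ?case by (simp add: algebra_simps)
qed (use assms in simp)

lemma C_E_ray:
  assumes "in_class R A TYPE('a) (E {i..i+j})" shows "in_class R A TYPE('a) (E {i..})"
proof -
  define b where "b k = i + j + k * (j + 1)" for k
  \<comment> \<open>The stages are the intervals of lengths \<open>(k + 1)(j + 1)\<close> starting
    in degree \<open>i\<close>, seen inside the ray.\<close>
  define H where "H k n = (if n \<in> {i..b k} then carrier R else {\<zero>})" for k n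
  have bm: "b k \<le> b l" if "k \<le> l" for k l unfolding b_def using that by (intro add_mono mult_le_mono1 order_refl)
  have bk: "k \<le> b k" for k by (simp add: b_def)
  have H: "submodule (H k n) R (obj (E {i..}) n)" for k n
    by (rule submoduleI'[OF cc_module[OF E_cc]])
      (auto simp: H_def E_carrier E_zero E_add E_smult split: if_splits)
  have dH: "dif (E {i..}) n x \<in> H k n" if "x \<in> H k (Suc n)" for k n x
    using that by (auto simp: H_def E_dif split: if_splits)
  show ?thesis
  proof (rule in_class_union[OF E_cc H dH inf e_inj])
    show "k \<le> l \<Longrightarrow> H k n \<subseteq> H l n" for k l n using bm[of k l] by (auto simp: H_def)
    show "(\<Union>k. H k n) = carrier (obj (E {i..}) n)" for n
    proof -
      have "n \<in> {i..} \<Longrightarrow> H n n = carrier R" using bk[of n] by (simp add: H_def)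
      then show ?thesis by (auto simp: E_carrier H_def split: if_splits)
    qed
    show "in_class R A TYPE('a) (sub_cx (E {i..}) (H k))" for k
    proof (rule in_class_iso[OF C_E_long[OF assms, of k, folded b_def]])
      show "cx_iso R (sub_cx (E {i..}) (H k)) (E {i..b k})"
      proof (rule cx_iso_same[OF chain_complex_sub_cx(1)[OF E_cc H dH] E_cc])
        show "obj (sub_cx (E {i..}) (H k)) n = obj (E {i..b k}) n" for n
          by (simp add: sub_cx_def interval_cx_def ideal_cx_def H_def)
        show "dif (sub_cx (E {i..}) (H k)) n x = dif (E {i..b k}) n x"
          if "x \<in> carrier (obj (sub_cx (E {i..}) (H k)) (Suc n))" for n x
          using that by (auto simp: E_dif H_def split: if_splits)
      qed
    qed
  qed
qed

abbreviation "K \<equiv> max_ideal_cx R r"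

lemma K_cc: "chain_complex R (K i)"
  unfolding max_ideal_cx_def
proof (rule chain_complex_ideal_cx)
  show "submodule (if n = i then {r \<otimes> y |y. y \<in> carrier R} else {\<zero>}) R (ring_mod R)" for n
  proof (cases "n = i")
    case True
    have "submodule {r \<otimes> y |y. y \<in> carrier R} R (ring_mod R)"
    proof (rule submodule_ring_mod)
      show "\<zero> \<in> {r \<otimes> y |y. y \<in> carrier R}" by (auto intro!: exI[of _ \<zero>])
      show "x \<oplus> y \<in> {r \<otimes> y |y. y \<in> carrier R}"
        if "x \<in> {r \<otimes> y |y. y \<in> carrier R}" "y \<in> {r \<otimes> y |y. y \<in> carrier R}" for x y
      proof -
        obtain u v where "u \<in> carrier R" "v \<in> carrier R" "x = r \<otimes> u" "y = r \<otimes> v" using \<open>x \<in> _\<close> \<open>y \<in> _\<close> by blast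
        then have "x \<oplus> y = r \<otimes> (u \<oplus> v)" "u \<oplus> v \<in> carrier R" by (simp_all add: r_distr)
        then show ?thesis by blast
      qed
      show "a \<otimes> x \<in> {r \<otimes> y |y. y \<in> carrier R}" if "a \<in> carrier R" "x \<in> {r \<otimes> y |y. y \<in> carrier R}" for a x
      proof -
        obtain u where "u \<in> carrier R" "x = r \<otimes> u" using \<open>x \<in> _\<close> by blast
        then have "a \<otimes> x = r \<otimes> (a \<otimes> u)" "a \<otimes> u \<in> carrier R" using \<open>a \<in> _\<close> by (simp_all add: m_lcomm)
        then show ?thesis by blast
      qed
    qed auto
    then show ?thesis using True by simp
  next
    case False
    have "submodule {\<zero>} R (ring_mod R)" by (rule submodule_ring_mod) auto
    then show ?thesis using False by simp
  qed
  show "\<zero> \<otimes> x \<in> (if n = i then {r \<otimes> y |y. y \<in> carrier R} else {\<zero>})"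
    if "x \<in> (if Suc n = i then {r \<otimes> y |y. y \<in> carrier R} else {\<zero>})" for n x
    using that by (auto split: if_splits intro!: exI[of _ \<zero>])
qed (auto split: if_splits)

lemma K_carrier: "x \<in> carrier (obj (K i) n) \<longleftrightarrow> (if n = i then (\<exists>y\<in>carrier R. x = r \<otimes> y) else x = \<zero>)"
  and K_dif: "dif (K i) n x = \<zero> \<otimes> x"
  and K_zero: "\<zero>\<^bsub>obj (K i) n\<^esub> = \<zero>" and K_add: "x \<oplus>\<^bsub>obj (K i) n\<^esub> y = x \<oplus> y"
  and K_smult: "a \<odot>\<^bsub>obj (K i) n\<^esub> x = a \<otimes> x"
  by (auto simp: max_ideal_cx_def)

lemma K_ring: "x \<in> carrier (obj (K i) n) \<Longrightarrow> x \<in> carrier R"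
  by (auto simp: K_carrier split: if_splits)

lemma K_uminus: "\<ominus>\<^bsub>obj (K i) n\<^esub> \<zero> = \<zero>"
proof -
  interpret M: module R "obj (K i) n" by (rule cc_module[OF K_cc])
  show ?thesis using M.M.minus_equality[of "\<zero>\<^bsub>obj (K i) n\<^esub>" "\<zero>\<^bsub>obj (K i) n\<^esub>"] M.M.zero_closed M.M.l_zero
    unfolding K_zero by blast
qed

text \<open>The ray is a resolution: its homology is \<open>R/rR\<close> in degree \<open>i\<close>
  and zero above, because the annihilator of \<open>r\<close> is \<open>rR\<close>. Multiplication
  by \<open>r\<close> in degree \<open>i\<close> identifies \<open>R/rR\<close> with
  \<open>rR\<close>.\<close>

lemma C_K:
  assumes "in_class R A TYPE('a) (E {i..})" shows "in_class R A TYPE('a) (K i)"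
proof -
  let ?g = "\<lambda>n. if n = i then r else \<zero>"
  have f: "chain_map R (E {i..}) (K i) (\<lambda>n x. ?g n \<otimes> x)"
  proof (intro chain_mapI E_cc K_cc linmapI cc_module)
    fix n x assume "x \<in> carrier (obj (E {i..}) (Suc n))"
    then have "x \<in> carrier R" by (auto simp: E_carrier split: if_splits)
    then show "?g n \<otimes> dif (E {i..}) n x = dif (K i) n (?g (Suc n) \<otimes> x)"
      by (auto simp: E_dif K_dif m_assoc[symmetric] rr)
  qed (auto simp: E_carrier E_add E_smult K_carrier K_add K_smult r_distr m_lcomm split: if_splits)
  have "weq R (E {i..}) (K i) (\<lambda>n x. ?g n \<otimes> x)"
  proof (rule weqI[OF f])
    fix n
    show "\<exists>x\<in>cycles (E {i..}) n. \<exists>w\<in>carrier (obj (K i) (Suc n)). y = ?g n \<otimes> x \<oplus>\<^bsub>obj (K i) n\<^esub> dif (K i) n w"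
      if y: "y \<in> cycles (K i) n" for y
    proof -
      have "\<exists>x\<in>cycles (E {i..}) n. y = ?g n \<otimes> x"
      proof (cases "n = i")
        case True
        then obtain x where "x \<in> carrier R" "y = r \<otimes> x" using y by (auto simp: cycles_iff K_carrier)
        then show ?thesis using True
          by (intro bexI[of _ x]) (auto simp: cycles_iff E_carrier E_dif E_zero)
      next
        case False
        then have "y = \<zero>" using y by (simp add: cycles_iff K_carrier)
        then show ?thesis using False cycles_zero[OF E_cc, of "{i..}" n]
          by (intro bexI[of _ \<zero>]) (auto simp: E_zero)
      qed
      then obtain x where x: "x \<in> cycles (E {i..}) n" "y = ?g n \<otimes> x" by blast
      then have "x \<in> carrier R" by (auto simp: cycles_iff E_carrier split: if_splits)
      then show ?thesis using x cycles_zero[OF K_cc, of i "Suc n"]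
        by (intro bexI[of _ x] bexI[of _ \<zero>]) (auto simp: K_add K_dif K_zero cycles_iff)
    qed
    show "x \<in> boundaries (E {i..}) n" if x: "x \<in> cycles (E {i..}) n" "?g n \<otimes> x \<in> boundaries (K i) n" for x
    proof (cases "i \<le> n")
      case True
      then have xR: "x \<in> carrier R" using x by (simp add: cycles_iff E_carrier)
      \<comment> \<open>In degree \<open>i\<close> this holds because the target has no nonzero
        boundaries; in higher degrees it is the cycle condition. The annihilator of \<open>r\<close>
        then supplies the bounding element.\<close>
      have "r \<otimes> x = \<zero>"
      proof (cases "n = i")
        case True
        then show ?thesis using x(2) K_ring by (auto simp: boundaries_def K_dif)
      next
        case False
        then obtain k where "n = Suc k" "i \<le> k" using \<open>i \<le> n\<close> by (cases n) auto
        then show ?thesis using x(1) by (simp add: cycles_iff E_dif E_zero)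
      qed
      then obtain y where "y \<in> carrier R" "x = r \<otimes> y" using annihilator[OF xR] by blast
      then show ?thesis using True unfolding boundaries_def
        by (intro image_eqI[of _ _ y]) (auto simp: E_dif E_carrier)
    next
      case False
      then show ?thesis using E_exact[of n "{i..}"] x(1) by (auto simp: exact_at_def)
    qed
  qed
  then show ?thesis by (rule in_class_weq_fwd[OF assms _ emb])
qed

text \<open>A suspension is an extension whose subcomplex is zero; here \<open>E {}\<close> is the
  zero complex.\<close>

lemma C_K_suspension:
  assumes "in_class R A TYPE('a) (K i)" shows "in_class R A TYPE('a) (K (Suc i))"
proof (rule in_class_extension[OF inf e_inj assms C_E_empty, of "K (Suc i)" "\<lambda>n x. x" "\<lambda>n x. if n = i then x else \<zero>"])
  show "chain_map R (E {}) (K (Suc i)) (\<lambda>n x. x)"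
    by (intro chain_mapI E_cc K_cc linmapI cc_module)
      (auto simp: E_carrier E_add E_smult E_dif K_carrier K_add K_smult K_dif intro!: bexI[of _ \<zero>])
  fix n
  show "linmap R (obj (K (Suc i)) (Suc n)) (obj (K i) n) (\<lambda>x. if n = i then x else \<zero>)"
    by (intro linmapI cc_module[OF K_cc]) (auto simp: K_carrier K_add K_smult)
  show "(if n = i then dif (K (Suc i)) (Suc n) w else \<zero>) =
      \<ominus>\<^bsub>obj (K i) n\<^esub> dif (K i) n (if Suc n = i then w else \<zero>)"
    if "w \<in> carrier (obj (K (Suc i)) (Suc (Suc n)))" for w
    using K_ring[OF that] K_uminus[of i n] cycles_zero[OF K_cc, of i n] by (auto simp: K_dif K_zero cycles_iff)
  show "(\<lambda>x. if n = i then x else \<zero>) ` carrier (obj (K (Suc i)) (Suc n)) = carrier (obj (K i) n)"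
    by (auto simp: K_carrier image_iff split: if_splits)
  show "(\<lambda>x. x) ` carrier (obj (E {}) (Suc n)) =
      {w \<in> carrier (obj (K (Suc i)) (Suc n)). (if n = i then w else \<zero>) = \<zero>\<^bsub>obj (K i) n\<^esub>}"
    by (auto simp: K_carrier E_carrier K_zero split: if_splits intro!: bexI[of _ \<zero>])
qed (auto simp: K_cc K_carrier E_carrier)

text \<open>In degree \<open>i + 1\<close>, multiplication by \<open>r\<close> maps \<open>R\<close>
  onto \<open>rR\<close> with kernel \<open>rR\<close>. This is an extension of the suspension of
  \<open>K i\<close> by \<open>K (Suc i)\<close>.\<close>

lemma C_E_point:
  assumes "in_class R A TYPE('a) (K i)" shows "in_class R A TYPE('a) (E {Suc i})"
proof (rule in_class_extension[OF inf e_inj assms C_K_suspension[OF assms], of _ "\<lambda>n x. x" "\<lambda>n x. if n = i then r \<otimes> x else \<zero>"])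
  show "chain_map R (K (Suc i)) (E {Suc i}) (\<lambda>n x. x)"
    by (intro chain_mapI E_cc K_cc linmapI cc_module)
      (auto simp: E_carrier E_add E_smult E_dif K_carrier K_add K_smult K_dif split: if_splits)
  fix n
  show "linmap R (obj (E {Suc i}) (Suc n)) (obj (K i) n) (\<lambda>x. if n = i then r \<otimes> x else \<zero>)"
    by (intro linmapI cc_module[OF K_cc] cc_module[OF E_cc])
      (auto simp: E_carrier E_add E_smult K_carrier K_add K_smult r_distr m_lcomm)
  show "(if n = i then r \<otimes> dif (E {Suc i}) (Suc n) w else \<zero>) =
      \<ominus>\<^bsub>obj (K i) n\<^esub> dif (K i) n (if Suc n = i then r \<otimes> w else \<zero>)"
    if "w \<in> carrier (obj (E {Suc i}) (Suc (Suc n)))" for w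
    using that K_uminus[of i n] cycles_zero[OF K_cc, of i n]
    by (auto simp: K_dif K_zero cycles_iff E_dif E_carrier split: if_splits)
  show "(\<lambda>x. if n = i then r \<otimes> x else \<zero>) ` carrier (obj (E {Suc i}) (Suc n)) = carrier (obj (K i) n)"
    by (auto simp: K_carrier E_carrier image_iff split: if_splits)
  show "(\<lambda>x. x) ` carrier (obj (K (Suc i)) (Suc n)) =
      {w \<in> carrier (obj (E {Suc i}) (Suc n)). (if n = i then r \<otimes> w else \<zero>) = \<zero>\<^bsub>obj (K i) n\<^esub>}"
    by (auto simp: K_carrier E_carrier K_zero m_assoc[symmetric] rr annihilator split: if_splits)
qed (auto simp: K_cc K_carrier E_carrier)

text \<open>In each single degree above \<open>i\<close> the ring itself is available, so every
  interval that starts above \<open>i\<close> can be stacked from points, and the given interval can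
  be lengthened by points on top.\<close>

lemma C_E_mono:
  assumes C: "in_class R A TYPE('a) (E {i..i+j})" and le: "(i, j) \<le> (i', j')"
  shows "in_class R A TYPE('a) (E {i'..i'+j'})"
proof -
  have pt: "in_class R A TYPE('a) (E {k..k})" if "k > i" for k
  proof -
    have "in_class R A TYPE('a) (E {Suc i..Suc i})" using C_E_point[OF C_K[OF C_E_ray[OF C]]] by simp
    from C_E_shift[OF this, of "k - Suc i"] show ?thesis using that by simp
  qed
  show ?thesis
  proof (cases "i < i'")
    case True
    show ?thesis
    proof (induction j')
      case (Suc j')
      show ?case using C_E_glue[OF Suc pt[of "i' + j'"]] True by simp
    qed (use pt True in simp)
  next
    case False
    then have i: "i' = i" and "j \<le> j'" using le by auto
    from this(2) show ?thesis unfolding i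
    proof (induction j' rule: dec_induct)
      case (step k)
      have "in_class R A TYPE('a) (E {i+k..i+k})"
      \<comment> \<open>Gluing suspends the point, so it is needed in degree \<open>i + k\<close>.
        For \<open>k > 0\<close> this degree exceeds \<open>i\<close>; for \<open>k = 0\<close> also
        \<open>j = 0\<close>, and the given complex is itself the point.\<close>
      proof (cases "k = 0")
        case True
        then show ?thesis using step C by simp
      qed (use pt in simp)
      from C_E_glue[OF step.IH this] show ?case by simp
    qed (rule C)
  qed
qed

end

section \<open>Perfect complexes and the theorem\<close>

lemma contractible_acyclic:
  assumes "contractible R X" shows "acyclic R X"
proof -
  have X: "chain_complex R X" using assms by (simp add: contractible_def)
  obtain s where s: "\<And>n. linmap R (obj X n) (obj X (Suc n)) (s n)"
    and s0: "\<And>x. x \<in> carrier (obj X 0) \<Longrightarrow> dif X 0 (s 0 x) = x"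
    and sn: "\<And>n x. x \<in> carrier (obj X (Suc n)) \<Longrightarrow>
      dif X (Suc n) (s (Suc n) x) \<oplus>\<^bsub>obj X (Suc n)\<^esub> s n (dif X n x) = x"
    using assms unfolding contractible_def by blast
  have "exact_at X n" for n
    unfolding exact_at_def
  proof
    fix x assume x: "x \<in> cycles X n"
    then have c: "s n x \<in> carrier (obj X (Suc n))" using linmap_closed[OF s] by (simp add: cycles_iff)
    have "dif X n (s n x) = x"
    proof (cases n)
      case 0
      then show ?thesis using s0 x by (simp add: cycles_iff)
    next
      case (Suc k)
      interpret M: module R "obj X (Suc k)" by (rule cc_module[OF X])
      have "s k (dif X k x) = \<zero>\<^bsub>obj X (Suc k)\<^esub>"
        using x Suc linmap_zero[OF s] by (simp add: cycles_iff)
      then show ?thesis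
        using sn[of x k] x c Suc linmap_closed[OF cc_lin[OF X] c] by (simp add: cycles_iff)
    qed
    then show "x \<in> boundaries X n" using c unfolding boundaries_def by (metis imageI)
  qed
  then show ?thesis using X by (simp add: acyclic_iff)
qed

lemma submodule_cycles:
  assumes X: "chain_complex R X" shows "submodule (cycles X n) R (obj X n)"
proof (rule submoduleI'[OF cc_module[OF X]])
  interpret M: module R "obj X n" by (rule cc_module[OF X])
  show "a \<odot>\<^bsub>obj X n\<^esub> x \<in> cycles X n" if a: "a \<in> carrier R" and x: "x \<in> cycles X n" for a x
  proof -
    have "dif X k (a \<odot>\<^bsub>obj X n\<^esub> x) = \<zero>\<^bsub>obj X k\<^esub>" if "n = Suc k" for k
    proof -
      interpret N: module R "obj X k" by (rule cc_module[OF X])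
      show ?thesis using that a x linmap_smult[OF cc_lin[OF X] a, of x k] by (simp add: cycles_iff)
    qed
    then show ?thesis using a x by (simp add: cycles_iff)
  qed
  show "cycles X n \<subseteq> carrier (obj X n)" by (auto simp: cycles_iff)
qed (use cycles_add[OF X] cycles_zero[OF X] in auto)

text \<open>By exactness the differential maps onto the cycles, and \<open>h\<close> is lifted
  through it. All modules involved have elements in the type of \<open>obj X n\<close>, as
  \<open>projective\<close> demands.\<close>

lemma projective_lift_cycles:
  assumes X: "chain_complex R X" and P: "projective R (obj X n)" and ex: "exact_at X n"
    and h: "linmap R (obj X n) (obj X n) h" and hc: "\<And>x. x \<in> carrier (obj X n) \<Longrightarrow> h x \<in> cycles X n"
  obtains s where "linmap R (obj X n) (obj X (Suc n)) s"
    "\<And>x. x \<in> carrier (obj X n) \<Longrightarrow> dif X n (s x) = h x"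
proof -
  let ?N = "(obj X n)\<lparr>carrier := cycles X n\<rparr>"
  have N: "module R ?N" by (rule submodule_restrict[OF cc_module[OF X] submodule_cycles[OF X]])
  have g: "linmap R (obj X (Suc n)) ?N (dif X n)"
    by (rule linmapI[OF cc_module[OF X] N])
      (simp_all add: boundary_cycle[OF X] linmap_add[OF cc_lin[OF X]] linmap_smult[OF cc_lin[OF X]])
  have f: "linmap R (obj X n) ?N h"
    by (rule linmapI[OF cc_module[OF X] N]) (simp_all add: hc linmap_add[OF h] linmap_smult[OF h])
  have sur: "dif X n ` carrier (obj X (Suc n)) = carrier ?N"
    using ex boundary_cycle[OF X] by (auto simp: exact_at_def boundaries_def)
  have "\<exists>s. linmap R (obj X n) (obj X (Suc n)) s \<and> (\<forall>x\<in>carrier (obj X n). dif X n (s x) = h x)"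
    using P g sur f unfolding projective_def by blast
  then show ?thesis using that by blast
qed

text \<open>The contraction is built degree by degree: the next map lifts \<open>x\<close> minus
  \<open>s\<close> applied to its differential. That element is a cycle because \<open>s\<close>
  inverts the differential on cycles, which is what \<open>S\<close> records; \<open>T\<close> is
  the homotopy relation between consecutive maps.\<close>

lemma projective_acyclic_contractible:
  assumes X: "chain_complex R X" and P: "\<And>n. projective R (obj X n)" and ex: "\<And>n. exact_at X n"
  shows "contractible R X"
proof -
  define S where "S n s \<longleftrightarrow> linmap R (obj X n) (obj X (Suc n)) s \<and> (\<forall>x\<in>cycles X n. dif X n (s x) = x)" for n s
  define T where "T n s s' \<longleftrightarrow> (\<forall>x\<in>carrier (obj X (Suc n)).
    dif X (Suc n) (s' x) \<oplus>\<^bsub>obj X (Suc n)\<^esub> s (dif X n x) = x)" for n s s'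
  have "\<exists>s. S 0 s"
  proof -
    obtain s where "linmap R (obj X 0) (obj X (Suc 0)) s" "\<And>x. x \<in> carrier (obj X 0) \<Longrightarrow> dif X 0 (s x) = x"
      by (rule projective_lift_cycles[OF X P ex linmap_ident[OF cc_module[OF X]]]) (auto simp: cycles_iff)
    then show ?thesis unfolding S_def by (auto simp: cycles_iff)
  qed
  moreover have "\<exists>s'. S (Suc n) s' \<and> T n s s'" if s: "S n s" for n s
  proof -
    interpret M: module R "obj X (Suc n)" by (rule cc_module[OF X])
    interpret N: module R "obj X n" by (rule cc_module[OF X])
    have sl: "linmap R (obj X n) (obj X (Suc n)) s" and sc: "\<And>x. x \<in> cycles X n \<Longrightarrow> dif X n (s x) = x"
      using s unfolding S_def by auto
    have sd: "linmap R (obj X (Suc n)) (obj X (Suc n)) (\<lambda>x. s (dif X n x))"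
      by (rule linmap_comp[OF cc_lin[OF X] sl])
    let ?h = "\<lambda>x. x \<ominus>\<^bsub>obj X (Suc n)\<^esub> s (dif X n x)"
    have h: "linmap R (obj X (Suc n)) (obj X (Suc n)) ?h"
      by (rule linmap_minus_map[OF linmap_ident[OF cc_module[OF X]] sd])
    have "?h x \<in> cycles X (Suc n)" if x: "x \<in> carrier (obj X (Suc n))" for x
    proof -
      note dx = linmap_closed[OF cc_lin[OF X] x]
      have "dif X n (?h x) = dif X n x \<ominus>\<^bsub>obj X n\<^esub> dif X n x"
        using linmap_diff[OF cc_lin[OF X] x linmap_closed[OF sd x]] sc[OF boundary_cycle[OF X x]] by simp
      then show ?thesis using linmap_closed[OF h x] dx by (simp add: cycles_iff a_minus_def N.M.r_neg)
    qed
    then obtain s' where s': "linmap R (obj X (Suc n)) (obj X (Suc (Suc n))) s'"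
      "\<And>x. x \<in> carrier (obj X (Suc n)) \<Longrightarrow> dif X (Suc n) (s' x) = ?h x"
      using projective_lift_cycles[OF X P ex h] by blast
    have "T n s s'"
      unfolding T_def using s'(2) linmap_closed[OF sd]
      by (simp add: a_minus_def M.M.a_assoc M.M.l_neg)
    moreover have "dif X (Suc n) (s' x) = x" if x: "x \<in> cycles X (Suc n)" for x
    proof -
      have c: "x \<in> carrier (obj X (Suc n))" "dif X n x = \<zero>\<^bsub>obj X n\<^esub>" using x by (auto simp: cycles_iff)
      have "dif X (Suc n) (s' x) \<oplus>\<^bsub>obj X (Suc n)\<^esub> s (dif X n x) = x"
        using \<open>T n s s'\<close> c(1) unfolding T_def by blast
      then show ?thesis
        using c linmap_zero[OF sl] linmap_closed[OF cc_lin[OF X] linmap_closed[OF s'(1) c(1)]] by simp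
    qed
    ultimately show ?thesis using s'(1) unfolding S_def by blast
  qed
  ultimately obtain s where s: "\<And>n. S n (s n)" "\<And>n. T n (s n) (s (Suc n))"
    using dependent_nat_choice[of S T] by blast
  have "dif X 0 (s 0 x) = x" if "x \<in> carrier (obj X 0)" for x
    using s(1)[of 0] that unfolding S_def by (simp add: cycles_iff)
  then show ?thesis
    using X s unfolding contractible_def S_def T_def by blast
qed

text \<open>Transitivity of the relation. The hypothesis speaks about copies of \<open>A\<close>,
  because \<open>A\<close> itself may have elements in another type.\<close>

lemma gg_trans:
  fixes Y :: "('r,'a) cx"
  assumes "gg R A Y" "\<And>Z :: ('r,'a) cx. cx_iso R A Z \<Longrightarrow> gg R B Z"
  shows "gg R B Y"
  using assms(1)
proof (induction rule: gg.induct)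
  case (base Y)
  then show ?case by (rule assms(2))
next
  case (dsum K Xs Y \<iota>)
  show ?case by (rule gg.dsum[OF _ dsum(2)]) (use dsum(1) in blast)
qed (rule gg.weq_fwd gg.weq_bwd gg.cofib; assumption)+

lemma gg_acyclic_iff:
  assumes "acyclic R A" shows "gg R A Y \<longleftrightarrow> acyclic R Y"
  using gg_acyclic[OF _ assms] gg_of_acyclic by blast

lemma (in square_zero) in_class_sigmaE_mono:
  fixes e :: "'r \<Rightarrow> 'a"
  assumes "infinite (UNIV :: 'a set)" "inj e" "(i, j) \<le> (i', j')"
  shows "in_class R (sigmaE R r i j) TYPE('a) (sigmaE R r i' j')"
proof -
  interpret square_zero_class R r e "sigmaE R r i j"
    by unfold_locales (use assms in auto)
  note iso = sigmaE_iso_interval_cx[OF r_closed rr]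
  have "in_class R (sigmaE R r i j) TYPE('a) (sigmaE R r i j)"
    by (rule in_class_base[OF cx_iso_cc(1)[OF iso] emb])
  then have "in_class R (sigmaE R r i j) TYPE('a) (E {i..i+j})"
    by (rule in_class_iso[OF _ cx_iso_sym[OF iso]])
  then show ?thesis by (rule in_class_iso[OF C_E_mono[OF _ assms(3)] iso])
qed

theorem theorem6p3:
  fixes R :: "'r ring" and m :: "'r set" and r :: 'r
  assumes "local_ring R m"
    and "r \<in> carrier R" and "m = PIdl\<^bsub>R\<^esub> r"
    and "\<forall>a\<in>m. \<forall>b\<in>m. a \<otimes>\<^bsub>R\<^esub> b = \<zero>\<^bsub>R\<^esub>"
    and "m \<noteq> {\<zero>\<^bsub>R\<^esub>}"
    and "infinite (UNIV :: 'a set)" and "\<exists>e :: 'r \<Rightarrow> 'a. inj e"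
  shows "(\<forall>i j i' j' (Y :: ('r,'a) cx). cx_iso R (sigmaE R r i' j') Y \<longrightarrow>
            (gg R (sigmaE R r i j) Y \<longleftrightarrow> (i, j) \<le> (i', j')))
       \<and> (\<forall>(X :: ('r,'a) cx) (Xs :: nat \<Rightarrow> ('r,'a) cx) \<iota> (ps :: (nat \<times> nat) list).
            perfect R X \<and> is_dsum R X {..length ps} Xs \<iota> \<and> acyclic R (Xs 0) \<and>
            (\<forall>k < length ps. cx_iso R (sigmaE R r (fst (ps ! k)) (snd (ps ! k))) (Xs (Suc k)))
            \<longrightarrow>
            (if contractible R X
             then (\<forall>Y :: ('r,'a) cx. gg R X Y \<longleftrightarrow> gg R (zero_cx R) Y)
             else (\<forall>Y :: ('r,'a) cx. gg R X Y \<longleftrightarrow>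
                     gg R (sigmaE R r (fst (Min (set ps))) (snd (Min (set ps)))) Y)))"
proof (intro conjI allI impI)
  interpret square_zero R r by (rule square_zeroI[OF assms(1-5)])
  obtain e :: "'r \<Rightarrow> 'a" where e: "inj e" using assms(7) by blast
  note mono = in_class_sigmaE_mono[OF assms(6) e]
  fix i j i' j' and Y :: "('r,'a) cx"
  assume "cx_iso R (sigmaE R r i' j') Y"
  then show "gg R (sigmaE R r i j) Y \<longleftrightarrow> (i, j) \<le> (i', j')"
    using E_order in_class_gg[OF mono] by blast
next
  interpret square_zero R r by (rule square_zeroI[OF assms(1-5)])
  obtain e :: "'r \<Rightarrow> 'a" where e: "inj e" using assms(7) by blast
  note mono = in_class_sigmaE_mono[OF assms(6) e]
  fix X :: "('r,'a) cx" and Xs :: "nat \<Rightarrow> ('r,'a) cx" and \<iota> and ps :: "(nat \<times> nat) list"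
  assume "perfect R X \<and> is_dsum R X {..length ps} Xs \<iota> \<and> acyclic R (Xs 0) \<and>
    (\<forall>k < length ps. cx_iso R (sigmaE R r (fst (ps ! k)) (snd (ps ! k))) (Xs (Suc k)))"
  then have perf: "perfect R X" and ds: "is_dsum R X {..length ps} Xs \<iota>" and ac: "acyclic R (Xs 0)"
    and iso: "\<And>k. k < length ps \<Longrightarrow> cx_iso R (sigmaE R r (fst (ps ! k)) (snd (ps ! k))) (Xs (Suc k))"
    by auto
  have X: "chain_complex R X" and proj: "\<And>n. projective R (obj X n)" using perf by (auto simp: perfect_def)
  obtain \<pi> where dp: "dsum_proj R X {..length ps} Xs \<iota> \<pi>" by (rule is_dsum_dsum_proj[OF ds])
  have id_emb: "embeds TYPE('a) (Z :: ('r,'a) cx)" for Z by (rule embedsI[of "\<lambda>x. x"]) simp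
  show "if contractible R X
    then (\<forall>Y :: ('r,'a) cx. gg R X Y \<longleftrightarrow> gg R (zero_cx R) Y)
    else (\<forall>Y :: ('r,'a) cx. gg R X Y \<longleftrightarrow> gg R (sigmaE R r (fst (Min (set ps))) (snd (Min (set ps)))) Y)"
  proof (cases "contractible R X")
    case True
    \<comment> \<open>Both classes consist of exactly the acyclic complexes.\<close>
    then show ?thesis
      by (simp add: gg_acyclic_iff[OF contractible_acyclic] gg_acyclic_iff[OF acyclic_zero_cx])
  next
    case False
    \<comment> \<open>Otherwise only the acyclic summand is left, and an acyclic complex of
      projectives is contractible.\<close>
    have "ps \<noteq> []"
    proof
      assume "ps = []"
      then have "exact_at X n" for n
        using exact_at_dsum[OF ds] ac by (auto simp: acyclic_iff)
      then show False using False projective_acyclic_contractible[OF X proj] by blast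
    qed
    then have min: "Min (set ps) \<in> set ps" by simp
    then obtain l where l: "l < length ps" "ps ! l = Min (set ps)" by (auto simp: in_set_conv_nth)
    let ?E = "sigmaE R r (fst (Min (set ps))) (snd (Min (set ps)))"
    obtain \<nu> :: "nat \<Rightarrow> 'a" where \<nu>: "inj \<nu>" by (rule infinite_nat_inj[OF assms(6)])
    \<comment> \<open>Every summand of \<open>X\<close> is acyclic or at least as large as the
      minimum in the order, hence in the class of \<open>?E\<close>.\<close>
    have "in_class R ?E TYPE('a) X"
    proof (rule in_class_dsum[OF dp _ id_emb inj_on_subset[OF \<nu> subset_UNIV]])
      fix k assume k: "k \<in> {..length ps}"
      show "in_class R ?E TYPE('a) (Xs k)"
      proof (cases k)
        case 0
        then show ?thesis using in_class_self[OF gg_of_acyclic[OF ac]] by simp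
      next
        case (Suc n)
        then have n: "n < length ps" using k by simp
        then have "Min (set ps) \<le> ps ! n" by simp
        then have "in_class R ?E TYPE('a) (sigmaE R r (fst (ps ! n)) (snd (ps ! n)))"
          by (intro mono) simp
        then show ?thesis using in_class_iso cx_iso_sym[OF iso[OF n]] Suc by blast
      qed
    qed
    then have 1: "gg R ?E Z" if "cx_iso R X Z" for Z :: "('r,'a) cx"
      using in_class_gg that by blast
    \<comment> \<open>Conversely the summand that attains the minimum is a retract of
      \<open>X\<close>. Its index is \<open>Suc l\<close> because index 0 belongs to the acyclic
      part.\<close>
    have "in_class R X TYPE('a) (Xs (Suc l))"
    proof (rule in_class_retract[OF assms(6) inj_on_id2 _ id_emb])
      show "in_class R X TYPE('a) X" by (rule in_class_base[OF X id_emb])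
      show "chain_map R (Xs (Suc l)) X (\<iota> (Suc l))" using dp_cm[OF dp] l by simp
      show "chain_map R X (Xs (Suc l)) (\<pi> (Suc l))" using dsum_proj_chain_map[OF dp] l by simp
      show "\<pi> (Suc l) n (\<iota> (Suc l) n z) = z" if "z \<in> carrier (obj (Xs (Suc l)) n)" for n z
        using dp_same[OF dp _ that] l by simp
    qed
    moreover have "cx_iso R ?E (Xs (Suc l))" using iso[OF l(1)] l(2) by simp
    ultimately have "in_class R X TYPE('a) ?E" by (rule in_class_iso)
    then have 2: "gg R X Z" if "cx_iso R ?E Z" for Z :: "('r,'a) cx"
      using in_class_gg that by blast
    have "gg R X Y \<longleftrightarrow> gg R ?E Y" for Y :: "('r,'a) cx"
      using gg_trans[of R X Y ?E] gg_trans[of R ?E Y X] 1 2 by blast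
    then show ?thesis using False by simp
  qed
qed

end
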